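(* Let $N\geqslant 4$ be an integer, let $\mathcal{C}$ be a category of noncrossing (two-coloured) partitions and let $\mathbb{G}$ be the associated easy quantum group. Then the group $\mathcal{G}(\mathbb{G})$ of (equivalence classes of) one-dimensional representations of $\mathbb{G}$, under tensor product, is cyclic (and in particular abelian).
   Context: **Partitions.** A (two-coloured) partition in $P^{\circ,\bullet}(k,l)$, $k,l\geqslant 0$, is a set partition of $k$ upper points and $l$ lower points (each row ordered from left to right) together with a colour, white ($\circ$) or black ($\bullet$), for each point. It is noncrossing if its blocks can be drawn by strings between the two rows without crossings. Operations: $p\otimes q$ is horizontal concatenation; for $p\in P^{\circ,\bullet}(k,l)$, $q\in P^{\circ,\bullet}(l,m)$ with the lower colouring of $p$ equal to the upper colouring of $q$, $qp\in P^{\circ,\bullet}(k,m)$ is vertical concatenation ($p$ on top of $q$, middle points and closed loops being removed); $p^{*}$ is the reflection in the horizontal axis (colours unchanged); a rotation moves the leftmost (resp. rightmost) point of one row to the left (resp. right) end of the other row, keeping its connections and inverting its colour. A category of partitions $\mathcal{C}$ is a set of coloured partitions stable under all these operations and containing the white identity (one upper and one lower point, both white, connected). It is a category of noncrossing partitions if all its elements are noncrossing. **Easy quantum group.** For $p\in P^{\circ,\bullet}(k,l)$ let $\mathring{T}_p:(\mathbb{C}^N)^{\otimes k}\to(\mathbb{C}^N)^{\otimes l}$, $\mathring{T}_p(e_{i_1}\otimes\dots\otimes e_{i_k})=\sum_{j_1,\dots,j_l=1}^N\delta_p(i,j)\,e_{j_1}\otimes\dots\otimes e_{j_l}$, with $\delta_p(i,j)=1$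 if all points in a common block of $p$ carry equal indices and $0$ otherwise. Words $w$ in $\{1,-1\}$ are identified with colourings via $\circ\mapsto 1$, $\bullet\mapsto -1$; $u^{\otimes w}=u^{w_1}\otimes\dots\otimes u^{w_k}$ with $u^{1}=u$, $u^{-1}=\overline{u}$. The easy quantum group associated to $\mathcal{C}$ and $N$ is the compact quantum group $\mathbb{G}$ with fundamental representation $u$ on $\mathbb{C}^N$ (every finite-dimensional representation is contained in a direct sum of representations $u^{\otimes w}$), given by Woronowicz's Tannaka–Krein duality, such that $\mathrm{Hom}(u^{\otimes w},u^{\otimes w'})$ is the linear span of the maps $\mathring{T}_p$ for $p\in\mathcal{C}$ with upper colouring $w$ and lower colouring $w'$. In $\mathcal{G}(\mathbb{G})$ the inverse is given by the contragredient. *)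

theory Defs
  imports
    Complex_Main
    "HOL-Library.Disjoint_Sets"
    "HOL-Algebra.Elementary_Groups"
    "Jordan_Normal_Form.Matrix"
begin

section \<open>Two-coloured partitions\<close>

datatype colour = White | Black

fun flip :: "colour \<Rightarrow> colour" where
  "flip White = Black"
| "flip Black = White"

text \<open>Points are numbered from left to right starting with 0; \<open>Inl i\<close> is the \<open>i\<close>-th upper point
  and \<open>Inr j\<close> the \<open>j\<close>-th lower point.\<close>

datatype cpart = CPart (upper: "colour list") (lower: "colour list") (blocks: "(nat + nat) set set")

definition points :: "nat \<Rightarrow> nat \<Rightarrow> (nat + nat) set" where
  "points k l = Inl ` {..<k} \<union> Inr ` {..<l}"

definition coloured_partition :: "cpart \<Rightarrow> bool" where
  "coloured_partition p \<longleftrightarrow>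
     partition_on (points (length (upper p)) (length (lower p))) (blocks p)"

definition relabel :: "('p \<Rightarrow> 'q) \<Rightarrow> 'p set set \<Rightarrow> 'q set set" where
  "relabel f B = (\<lambda>b. f ` b) ` B"

definition white_identity :: cpart where
  "white_identity = CPart [White] [White] {{Inl 0, Inr 0}}"

definition part_tensor :: "cpart \<Rightarrow> cpart \<Rightarrow> cpart" where
  "part_tensor p q = CPart (upper p @ upper q) (lower p @ lower q)
     (blocks p \<union> relabel (map_sum ((+) (length (upper p))) ((+) (length (lower p)))) (blocks q))"

text \<open>The diagram with \<open>p\<close> on top of \<open>q\<close> has three rows of points: \<open>Inl i\<close> (top),
  \<open>Inr (Inl j)\<close> (middle) and \<open>Inr (Inr m)\<close> (bottom).\<close>

definition stack_edges :: "cpart \<Rightarrow> cpart \<Rightarrow> ((nat + nat + nat) \<times> (nat + nat + nat)) set" where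
  "stack_edges p q =
     {(x, y). \<exists>b \<in> relabel (map_sum id Inl) (blocks p) \<union> relabel Inr (blocks q). x \<in> b \<and> y \<in> b}"

text \<open>\<open>part_comp q p\<close> is the vertical concatenation \<open>qp\<close>, meaningful if \<open>lower p = upper q\<close>.\<close>

definition part_comp :: "cpart \<Rightarrow> cpart \<Rightarrow> cpart" where
  "part_comp q p = CPart (upper p) (lower q)
     (let P = points (length (upper p)) (length (lower q))
      in P // {(x, y) \<in> P \<times> P. (map_sum id Inr x, map_sum id Inr y) \<in> (stack_edges p q)\<^sup>+})"

definition part_adj :: "cpart \<Rightarrow> cpart" where
  "part_adj p = CPart (lower p) (upper p) (relabel (case_sum Inr Inl) (blocks p))"

definition rotate_upper_left :: "cpart \<Rightarrow> cpart" where
  "rotate_upper_left p = CPart (tl (upper p)) (flip (hd (upper p)) # lower p)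
     (relabel (case_sum (\<lambda>i. if i = 0 then Inr 0 else Inl (i - 1)) (\<lambda>j. Inr (Suc j))) (blocks p))"

definition rotate_upper_right :: "cpart \<Rightarrow> cpart" where
  "rotate_upper_right p = CPart (butlast (upper p)) (lower p @ [flip (last (upper p))])
     (relabel (case_sum (\<lambda>i. if Suc i = length (upper p) then Inr (length (lower p)) else Inl i) Inr)
        (blocks p))"

definition rotate_lower_left :: "cpart \<Rightarrow> cpart" where
  "rotate_lower_left p = CPart (flip (hd (lower p)) # upper p) (tl (lower p))
     (relabel (case_sum (\<lambda>i. Inl (Suc i)) (\<lambda>j. if j = 0 then Inl 0 else Inr (j - 1))) (blocks p))"

definition rotate_lower_right :: "cpart \<Rightarrow> cpart" where
  "rotate_lower_right p = CPart (upper p @ [flip (last (lower p))]) (butlast (lower p))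
     (relabel (case_sum Inl (\<lambda>j. if Suc j = length (lower p) then Inl (length (upper p)) else Inr j))
        (blocks p))"

definition category_of_partitions :: "cpart set \<Rightarrow> bool" where
  "category_of_partitions C \<longleftrightarrow>
     (\<forall>p\<in>C. coloured_partition p) \<and>
     white_identity \<in> C \<and>
     (\<forall>p\<in>C. \<forall>q\<in>C. part_tensor p q \<in> C) \<and>
     (\<forall>p\<in>C. \<forall>q\<in>C. lower p = upper q \<longrightarrow> part_comp q p \<in> C) \<and>
     (\<forall>p\<in>C. part_adj p \<in> C) \<and>
     (\<forall>p\<in>C. upper p \<noteq> [] \<longrightarrow> rotate_upper_left p \<in> C \<and> rotate_upper_right p \<in> C) \<and>
     (\<forall>p\<in>C. lower p \<noteq> [] \<longrightarrow> rotate_lower_left p \<in> C \<and> rotate_lower_right p \<in> C)"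

text \<open>Position of a point when walking around the boundary of the diagram: the upper row from left
  to right, then the lower row from right to left. Strings between the two rows can be drawn without
  crossings iff no two blocks alternate along this walk.\<close>

fun boundary_pos :: "nat \<Rightarrow> nat \<Rightarrow> nat + nat \<Rightarrow> nat" where
  "boundary_pos k l (Inl i) = i"
| "boundary_pos k l (Inr j) = k + (l - Suc j)"

definition noncrossing :: "cpart \<Rightarrow> bool" where
  "noncrossing p \<longleftrightarrow>
     (let pos = boundary_pos (length (upper p)) (length (lower p)) in
      \<not> (\<exists>b \<in> blocks p. \<exists>b' \<in> blocks p. b \<noteq> b' \<and>
           (\<exists>x1 \<in> b. \<exists>x2 \<in> b'. \<exists>x3 \<in> b. \<exists>x4 \<in> b'.
              pos x1 < pos x2 \<and> pos x2 < pos x3 \<and> pos x3 < pos x4)))"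


section \<open>The maps associated to partitions\<close>

text \<open>The basis vector \<open>e\<^bsub>i\<^sub>0\<^esub> \<otimes> \<dots> \<otimes> e\<^bsub>i\<^sub>k\<^sub>-\<^sub>1\<^esub>\<close> of \<open>(\<complex>\<^sup>N)\<^sup>\<otimes>\<^sup>k\<close> has number
  \<open>\<Sum>m<k. i\<^sub>m * N ^ (k - 1 - m)\<close>, as in the Kronecker product below; \<open>digit N k x m\<close> recovers \<open>i\<^sub>m\<close>
  from the number \<open>x\<close>.\<close>

definition digit :: "nat \<Rightarrow> nat \<Rightarrow> nat \<Rightarrow> nat \<Rightarrow> nat" where
  "digit N k x m = (x div N ^ (k - 1 - m)) mod N"

definition part_map :: "nat \<Rightarrow> cpart \<Rightarrow> complex mat" where
  "part_map N p =
     (let k = length (upper p); l = length (lower p) in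
      mat (N ^ l) (N ^ k) (\<lambda>(j, i).
        let index = case_sum (digit N k i) (digit N l j)
        in if \<forall>b \<in> blocks p. \<forall>x \<in> b. \<forall>y \<in> b. index x = index y then 1 else 0))"

definition mat_span :: "nat \<Rightarrow> nat \<Rightarrow> complex mat set \<Rightarrow> complex mat set" where
  "mat_span nr nc X =
     {mat nr nc (\<lambda>ij. \<Sum>M\<in>F. c M * M $$ ij) | F c. finite F \<and> F \<subseteq> X}"

definition kron :: "'a::semiring_1 mat \<Rightarrow> 'a mat \<Rightarrow> 'a mat" where
  "kron A B = mat (dim_row A * dim_row B) (dim_col A * dim_col B)
     (\<lambda>(i, j). A $$ (i div dim_row B, j div dim_col B) * B $$ (i mod dim_row B, j mod dim_col B))"


section \<open>Compact quantum groups\<close>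

locale complex_star_algebra = vector_space scale
  for scale :: "complex \<Rightarrow> 'a::ring_1 \<Rightarrow> 'a" (infixr \<open>*s\<close> 75) +
  fixes star :: "'a \<Rightarrow> 'a"
  assumes scale_mult_left: "(c *s a) * b = c *s (a * b)"
    and scale_mult_right: "a * (c *s b) = c *s (a * b)"
    and star_star: "star (star a) = a"
    and star_add: "star (a + b) = star a + star b"
    and star_scale: "star (c *s a) = cnj c *s star a"
    and star_mult: "star (a * b) = star b * star a"
begin

text \<open>The algebraic tensor product \<open>A \<otimes> A\<close> is realised inside the dual of the space of bilinear forms
  on \<open>A\<close> (these separate its points): \<open>tensor2 [(x\<^sub>1, y\<^sub>1), \<dots>, (x\<^sub>n, y\<^sub>n)]\<close> is
  \<open>x\<^sub>1 \<otimes> y\<^sub>1 + \<dots> + x\<^sub>n \<otimes> y\<^sub>n\<close>. Outside the bilinear forms the functional is set to 0, so that equality of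
  functions is equality in \<open>A \<otimes> A\<close>. Likewise for \<open>A \<otimes> A \<otimes> A\<close>.\<close>

definition bilinear_form :: "('a \<Rightarrow> 'a \<Rightarrow> complex) \<Rightarrow> bool" where
  "bilinear_form f \<longleftrightarrow>
     (\<forall>y. Vector_Spaces.linear scale (*) (\<lambda>x. f x y)) \<and>
     (\<forall>x. Vector_Spaces.linear scale (*) (\<lambda>y. f x y))"

definition trilinear_form :: "('a \<Rightarrow> 'a \<Rightarrow> 'a \<Rightarrow> complex) \<Rightarrow> bool" where
  "trilinear_form f \<longleftrightarrow>
     (\<forall>y z. Vector_Spaces.linear scale (*) (\<lambda>x. f x y z)) \<and>
     (\<forall>x z. Vector_Spaces.linear scale (*) (\<lambda>y. f x y z)) \<and>
     (\<forall>x y. Vector_Spaces.linear scale (*) (\<lambda>z. f x y z))"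

definition tensor2 :: "('a \<times> 'a) list \<Rightarrow> ('a \<Rightarrow> 'a \<Rightarrow> complex) \<Rightarrow> complex" where
  "tensor2 xs = (\<lambda>f. if bilinear_form f then (\<Sum>(x, y)\<leftarrow>xs. f x y) else 0)"

definition tensor3 :: "('a \<times> 'a \<times> 'a) list \<Rightarrow> ('a \<Rightarrow> 'a \<Rightarrow> 'a \<Rightarrow> complex) \<Rightarrow> complex" where
  "tensor3 xs = (\<lambda>f. if trilinear_form f then (\<Sum>(x, y, z)\<leftarrow>xs. f x y z) else 0)"

definition scalar_mat :: "complex mat \<Rightarrow> 'a mat" where
  "scalar_mat T = map_mat (\<lambda>c. c *s 1) T"

definition conj_mat :: "'a mat \<Rightarrow> 'a mat" where
  "conj_mat v = map_mat star v"

definition unitary_mat :: "'a mat \<Rightarrow> bool" where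
  "unitary_mat v \<longleftrightarrow> square_mat v \<and>
     inverts_mat v (transpose_mat (conj_mat v)) \<and> inverts_mat (transpose_mat (conj_mat v)) v"

end

text \<open>The Hopf *-algebra axioms are written with arbitrary representatives \<open>\<Sum>i. x\<^sub>i \<otimes> y\<^sub>i\<close> of the
  coproducts (Sweedler notation).\<close>

locale hopf_star_algebra = complex_star_algebra scale star
  for scale :: "complex \<Rightarrow> 'a::ring_1 \<Rightarrow> 'a" (infixr \<open>*s\<close> 75) and star :: "'a \<Rightarrow> 'a" +
  fixes comult :: "'a \<Rightarrow> ('a \<Rightarrow> 'a \<Rightarrow> complex) \<Rightarrow> complex"
    and counit :: "'a \<Rightarrow> complex"
    and antipode :: "'a \<Rightarrow> 'a"
  assumes comult_tensor: "\<exists>xs. comult a = tensor2 xs"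
    and comult_add: "\<lbrakk>comult a = tensor2 xs; comult b = tensor2 ys\<rbrakk>
          \<Longrightarrow> comult (a + b) = tensor2 (xs @ ys)"
    and comult_scale: "comult a = tensor2 xs
          \<Longrightarrow> comult (c *s a) = tensor2 [(c *s x, y). (x, y) \<leftarrow> xs]"
    and comult_one: "comult 1 = tensor2 [(1, 1)]"
    and comult_mult: "\<lbrakk>comult a = tensor2 xs; comult b = tensor2 ys\<rbrakk>
          \<Longrightarrow> comult (a * b) = tensor2 [(x * x', y * y'). (x, y) \<leftarrow> xs, (x', y') \<leftarrow> ys]"
    and comult_star: "comult a = tensor2 xs
          \<Longrightarrow> comult (star a) = tensor2 [(star x, star y). (x, y) \<leftarrow> xs]"
    and coassoc: "\<lbrakk>comult a = tensor2 xs; \<And>x. comult x = tensor2 (r x)\<rbrakk>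
          \<Longrightarrow> tensor3 [(x', x'', y). (x, y) \<leftarrow> xs, (x', x'') \<leftarrow> r x]
            = tensor3 [(x, y', y''). (x, y) \<leftarrow> xs, (y', y'') \<leftarrow> r y]"
    and counit_linear: "Vector_Spaces.linear scale (*) counit"
    and counit_one: "counit 1 = 1"
    and counit_mult: "counit (a * b) = counit a * counit b"
    and counit_left: "comult a = tensor2 xs \<Longrightarrow> (\<Sum>(x, y)\<leftarrow>xs. counit x *s y) = a"
    and counit_right: "comult a = tensor2 xs \<Longrightarrow> (\<Sum>(x, y)\<leftarrow>xs. counit y *s x) = a"
    and antipode_linear: "Vector_Spaces.linear scale scale antipode"
    and antipode_left: "comult a = tensor2 xs \<Longrightarrow> (\<Sum>(x, y)\<leftarrow>xs. antipode x * y) = counit a *s 1"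
    and antipode_right: "comult a = tensor2 xs \<Longrightarrow> (\<Sum>(x, y)\<leftarrow>xs. x * antipode y) = counit a *s 1"
begin

text \<open>A finite-dimensional representation on \<open>\<complex>\<^sup>n\<close> is an invertible \<open>n \<times> n\<close> matrix with
  \<open>\<Delta>(v\<^sub>i\<^sub>j) = \<Sum>k. v\<^sub>i\<^sub>k \<otimes> v\<^sub>k\<^sub>j\<close>.\<close>

definition fd_rep :: "'a mat \<Rightarrow> bool" where
  "fd_rep v \<longleftrightarrow> invertible_mat v \<and>
     (\<forall>i<dim_row v. \<forall>j<dim_row v.
        comult (v $$ (i, j)) = tensor2 [(v $$ (i, k), v $$ (k, j)). k \<leftarrow> [0..<dim_row v]])"

definition hom_space :: "'a mat \<Rightarrow> 'a mat \<Rightarrow> complex mat set" where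
  "hom_space v w =
     {T \<in> carrier_mat (dim_row w) (dim_row v). scalar_mat T * v = w * scalar_mat T}"

definition equivalent :: "'a mat \<Rightarrow> 'a mat \<Rightarrow> bool" where
  "equivalent v w \<longleftrightarrow> (\<exists>T \<in> hom_space v w. invertible_mat T)"

definition contained_in :: "'a mat \<Rightarrow> 'a mat \<Rightarrow> bool" where
  "contained_in v w \<longleftrightarrow> (\<exists>T \<in> hom_space v w. \<forall>x \<in> carrier_vec (dim_row v).
     T *\<^sub>v x = 0\<^sub>v (dim_row w) \<longrightarrow> x = 0\<^sub>v (dim_row v))"

primrec word_rep :: "'a mat \<Rightarrow> colour list \<Rightarrow> 'a mat" where
  "word_rep u [] = 1\<^sub>m 1"
| "word_rep u (c # w) = kron (case c of White \<Rightarrow> u | Black \<Rightarrow> conj_mat u) (word_rep u w)"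

definition fundamental :: "'a mat \<Rightarrow> bool" where
  "fundamental u \<longleftrightarrow> fd_rep u \<and>
     (\<forall>v. fd_rep v \<longrightarrow> (\<exists>ws. contained_in v (diag_block_mat (map (word_rep u) ws))))"

definition easy_for :: "cpart set \<Rightarrow> nat \<Rightarrow> 'a mat \<Rightarrow> bool" where
  "easy_for C N u \<longleftrightarrow> dim_row u = N \<and> fundamental u \<and>
     (\<forall>w w'. hom_space (word_rep u w) (word_rep u w') =
        mat_span (N ^ length w') (N ^ length w)
          (part_map N ` {p \<in> C. upper p = w \<and> lower p = w'}))"

definition one_dim_reps :: "'a mat set" where
  "one_dim_reps = {v. fd_rep v \<and> dim_row v = 1}"

definition one_dim_equiv :: "('a mat \<times> 'a mat) set" where
  "one_dim_equiv = {(v, w) \<in> one_dim_reps \<times> one_dim_reps. equivalent v w}"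

definition one_dim_group :: "'a mat set monoid" where
  "one_dim_group =
     \<lparr>carrier = one_dim_reps // one_dim_equiv,
      monoid.mult = (\<lambda>X Y. \<Union>v\<in>X. \<Union>w\<in>Y. one_dim_equiv `` {kron v w}),
      monoid.one = one_dim_equiv `` {1\<^sub>m 1}\<rparr>"

end

text \<open>A compact quantum group is given by the Hopf *-algebra of coefficients of its
  finite-dimensional unitary representations (a CQG algebra).\<close>

locale compact_quantum_group = hopf_star_algebra +
  assumes unitary_coefficients_span:
    "span (\<Union> {elements_mat v | v. fd_rep v \<and> unitary_mat v}) = UNIV"

end

theory Submission
  imports Defs
begin

text \<open>
  Let \<open>g\<close> be a one-dimensional representation, realised by a vector \<open>\<zeta> \<noteq> 0\<close> with
  \<open>u\<^sup>w \<zeta> = \<zeta> g\<close>. Then \<open>\<zeta>\<zeta>\<^sup>*\<close> is a self-intertwiner, hence a combination of maps \<open>T\<^sub>p\<close> with \<open>p\<close> noncrossing.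
  Pair it with the vectors \<open>a \<otimes> b \<otimes> a \<otimes> \<dots>\<close> and \<open>b \<otimes> a \<otimes> b \<otimes> \<dots>\<close>, where \<open>a = e\<^sub>0 - e\<^sub>1\<close> and
  \<open>b = e\<^sub>2 - e\<^sub>3\<close> (this uses \<open>N \<ge> 4\<close>). A noncrossing \<open>p\<close> other than the identity has, in one of its rows, a
  singleton or two neighbouring connected points, so it contributes nothing; the identity contributes a
  multiple of an invertible \<open>2 \<times> 2\<close> matrix, whereas \<open>\<zeta>\<zeta>\<^sup>*\<close> contributes a matrix of rank at most one.
  So the coefficient of the identity vanishes, and some other \<open>p\<close> satisfies \<open>\<zeta>\<^sup>*T\<^sub>p\<zeta> \<noteq> 0\<close>.

  Partial traces of \<open>T\<^sub>p\<^sup>*T\<^sub>p\<close> show that at its singleton or pair of points either one or two tensor factors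
  contain a one-dimensional representation \<open>h\<close> spanned by a block vector, or two factors can be merged into
  one. Contracting there realises \<open>g h\<^sup>-\<^sup>1\<close>, respectively \<open>g\<close>, on a shorter word of letters, so by
  induction \<open>g\<close> is a product of such \<open>h\<close>. No composition of partitions is needed: of the category
  one only uses the four rotations of the identity, which make \<open>u\<close> and its conjugate unitary.

  Finally every such \<open>h\<close> is a power of a single \<open>\<gamma>\<close>. Up to adjoints, \<open>h\<close> is given by a relation
  \<open>\<Sum>\<^sub>k u\<^bsub>i\<^sub>1k\<^esub> \<cdots> u\<^bsub>i\<^sub>dk\<^esub> = \<delta>\<^bsub>i\<^sub>1=\<dots>=i\<^sub>d\<^esub> h\<close>. Such relations of lengths \<open>d > e\<close> yield one of length \<open>d - e\<close> for the
  quotient, so the relation of minimal length \<open>d\<close> gives a generator \<open>\<gamma>\<close>. If \<open>d \<ge> 2\<close>, then \<open>\<gamma>\<close> commutes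
  with all \<open>u\<^bsub>ij\<^esub>\<close>; if \<open>d = 1\<close>, all row sums of \<open>u\<close> equal \<open>\<gamma>\<close>. Either way the letters produced by the
  contractions stay under control.
\<close>

section \<open>Noncrossing labellings\<close>

text \<open>A contraction in the middle of a word leaves an element \<open>h\<close> between the
  remaining letters. Moving it to the right end conjugates the letters that it passes, and merging
  replaces two letters by the matrix of their entrywise products. So the words in \<open>u\<close>
  and its conjugate are not stable under the reduction. The induction therefore runs over words of
  abstract letters; all that survives of the category is the property \<open>spanned\<close> of a
  single word, which a contraction passes on to the shorter word.

  The vectors \<open>a\<close> and \<open>b\<close> are chosen with coordinate sum zero, which
  annihilates singletons, and with disjoint supports, which annihilates connected neighbours.

  Entries of letters do not commute, and partial traces on the left and on the right produce
  products in both orders. This is why unitarity of a letter and of its entrywise conjugate is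
  carried along together.\<close>

definition idx :: "nat \<Rightarrow> nat \<Rightarrow> nat list set" where
  "idx N k = {xs. length xs = k \<and> set xs \<subseteq> {..<N}}"

lemma finite_idx [simp]: "finite (idx N k)"
  using finite_lists_length_eq[of "{..<N}" k] by (simp add: idx_def conj_commute)

lemma idx_0 [simp]: "idx N 0 = {[]}"
  by (auto simp: idx_def)

lemma idx_length: "xs \<in> idx N k \<Longrightarrow> length xs = k"
  by (simp add: idx_def)

lemma idx_Cons [simp]: "x # xs \<in> idx N (Suc k) \<longleftrightarrow> x < N \<and> xs \<in> idx N k"
  by (auto simp: idx_def)

lemma idx_append: "xs \<in> idx N k \<Longrightarrow> ys \<in> idx N l \<Longrightarrow> xs @ ys \<in> idx N (k + l)"
  by (auto simp: idx_def)

lemma idx_rev: "xs \<in> idx N k \<Longrightarrow> rev xs \<in> idx N k"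
  by (auto simp: idx_def)

lemma idx_replicate: "x < N \<Longrightarrow> replicate k x \<in> idx N k"
  by (auto simp: idx_def)

lemma idx_SucE:
  assumes "xs \<in> idx N (Suc k)"
  obtains y ys where "xs = y # ys" "y < N" "ys \<in> idx N k"
  using assms by (cases xs) (auto simp: idx_def)

lemma idx_addE:
  assumes "xs \<in> idx N (k + l)"
  obtains ys zs where "xs = ys @ zs" "ys \<in> idx N k" "zs \<in> idx N l"
proof
  show "xs = take k xs @ drop k xs" by simp
  show "take k xs \<in> idx N k" "drop k xs \<in> idx N l"
    using assms set_take_subset[of k xs] set_drop_subset[of k xs] by (auto simp: idx_def)
qed

lemma sum_idx_Suc: "(\<Sum>xs\<in>idx N (Suc k). F xs) = (\<Sum>x<N. \<Sum>xs\<in>idx N k. F (x # xs))"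
proof -
  have "(\<Sum>x<N. \<Sum>xs\<in>idx N k. F (x # xs)) = (\<Sum>(x, xs)\<in>{..<N} \<times> idx N k. F (x # xs))"
    by (rule sum.cartesian_product)
  also have "\<dots> = (\<Sum>xs\<in>idx N (Suc k). F xs)"
    by (rule sum.reindex_bij_witness[where i = "\<lambda>xs. (hd xs, tl xs)" and j = "\<lambda>(x, xs). x # xs"])
      (auto elim!: idx_SucE)
  finally show ?thesis ..
qed

lemma sum_idx_add:
  "(\<Sum>xs\<in>idx N (k + l). F xs) = (\<Sum>xs\<in>idx N k. \<Sum>ys\<in>idx N l. F (xs @ ys))"
  by (induction k arbitrary: F) (simp_all add: sum_idx_Suc)

text \<open>A partition of \<open>n\<close> points on a line is encoded by a labelling of \<open>{..<n}\<close> whose fibres are the blocks;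
  only the equalities between labels matter.\<close>

definition skip :: "nat \<Rightarrow> nat \<Rightarrow> nat" where
  "skip p x = (if x < p then x else Suc x)"

definition nc_labelling :: "nat \<Rightarrow> (nat \<Rightarrow> 'l) \<Rightarrow> bool" where
  "nc_labelling n f \<longleftrightarrow>
     (\<forall>a b c d. a < b \<and> b < c \<and> c < d \<and> d < n \<and> f a = f c \<and> f b = f d \<longrightarrow> f a = f b)"

lemma ncD:
  "nc_labelling n f \<Longrightarrow> a < b \<Longrightarrow> b < c \<Longrightarrow> c < d \<Longrightarrow> d < n \<Longrightarrow> f a = f c \<Longrightarrow> f b = f d \<Longrightarrow> f a = f b"
  unfolding nc_labelling_def by blast

text \<open>The condition under which the Kronecker symbol of the partition is 1 at the indices
  \<open>xs\<close>.\<close>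

definition agrees :: "(nat \<Rightarrow> 'l) \<Rightarrow> nat list \<Rightarrow> bool" where
  "agrees f xs \<longleftrightarrow> (\<forall>a<length xs. \<forall>b<length xs. f a = f b \<longrightarrow> xs ! a = xs ! b)"

lemma agreesD: "agrees f xs \<Longrightarrow> a < length xs \<Longrightarrow> b < length xs \<Longrightarrow> f a = f b \<Longrightarrow> xs ! a = xs ! b"
  unfolding agrees_def by blast

lemma nth_skip:
  assumes "length xs = p" "x < length (xs @ ys)"
  shows "(xs @ k # ys) ! skip p x = (xs @ ys) ! x"
  using assms by (auto simp: skip_def nth_append Suc_diff_le)

lemma skip_cases:
  assumes "y \<noteq> p" "y < Suc n" "p \<le> n"
  obtains x where "y = skip p x" "x < n"
proof (cases "y < p")
  case True
  show ?thesis by (rule that[of y]) (use True assms in \<open>auto simp: skip_def\<close>)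
next
  case False
  show ?thesis by (rule that[of "y - 1"]) (use False assms in \<open>auto simp: skip_def\<close>)
qed

text \<open>Isolates the index \<open>k\<close> at the point \<open>p\<close>: it is free if
  \<open>p\<close> is a singleton and forced by the rest of its block otherwise. This is what a sum
  over \<open>k\<close> needs.\<close>

lemma agrees_insert:
  assumes p: "length xs = p"
  shows "agrees f (xs @ k # ys) \<longleftrightarrow>
    agrees (f \<circ> skip p) (xs @ ys) \<and>
    (\<forall>x<length (xs @ ys). f (skip p x) = f p \<longrightarrow> (xs @ ys) ! x = k)" (is "?L \<longleftrightarrow> ?R")
proof
  have b: "skip p x < length (xs @ k # ys)" if "x < length (xs @ ys)" for x
    using that by (auto simp: skip_def)
  have kk: "(xs @ k # ys) ! p = k" using p by auto
  {
    assume L: ?L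
    have "agrees (f \<circ> skip p) (xs @ ys)"
      unfolding agrees_def
    proof (intro allI impI)
      fix a c assume *: "a < length (xs @ ys)" "c < length (xs @ ys)" "(f \<circ> skip p) a = (f \<circ> skip p) c"
      from agreesD[OF L b[OF *(1)] b[OF *(2)]] *(3)
      show "(xs @ ys) ! a = (xs @ ys) ! c"
        using nth_skip[OF p *(1)] nth_skip[OF p *(2)] by (simp)
    qed
    moreover have "(xs @ ys) ! x = k" if "x < length (xs @ ys)" "f (skip p x) = f p" for x
      using agreesD[OF L b[OF that(1)] _ that(2)] nth_skip[OF p that(1)] kk p by simp
    ultimately show ?R by blast
  }
  {
    assume R: ?R
    show ?L unfolding agrees_def
    proof (intro allI impI)
      fix a c assume *: "a < length (xs @ k # ys)" "c < length (xs @ k # ys)" "f a = f c"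
      have pn: "p \<le> length (xs @ ys)" using p by simp
      consider "a = p" "c = p" | "a \<noteq> p" "c = p" | "a = p" "c \<noteq> p" | "a \<noteq> p" "c \<noteq> p" by blast
      then show "(xs @ k # ys) ! a = (xs @ k # ys) ! c"
      proof cases
        case 2
        then obtain x where x: "a = skip p x" "x < length (xs @ ys)"
          using skip_cases[of a p "length (xs @ ys)"] * pn by auto
        then have "(xs @ ys) ! x = k" using R 2 * by auto
        then show ?thesis using x 2 nth_skip[OF p x(2)] kk by simp
      next
        case 3
        then obtain x where x: "c = skip p x" "x < length (xs @ ys)"
          using skip_cases[of c p "length (xs @ ys)"] * pn by auto
        then have "(xs @ ys) ! x = k" using R 3 * by auto
        then show ?thesis using x 3 nth_skip[OF p x(2)] kk by simp
      next
        case 4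
        obtain x where x: "a = skip p x" "x < length (xs @ ys)"
          using skip_cases[of a p "length (xs @ ys)"] * pn 4 by auto
        obtain y where y: "c = skip p y" "y < length (xs @ ys)"
          using skip_cases[of c p "length (xs @ ys)"] * pn 4 by auto
        have "f (skip p x) = f (skip p y)" using * x y by simp
        then have "(xs @ ys) ! x = (xs @ ys) ! y"
          using agreesD[OF conjunct1[OF R] x(2) y(2)] by simp
        then show ?thesis using x y nth_skip[OF p x(2)] nth_skip[OF p y(2)] by simp
      qed auto
    qed
  }
qed

text \<open>The point \<open>Suc p\<close> is deleted and its block is united with that of
  \<open>p\<close>, by renaming its label.\<close>

definition merge_label :: "nat \<Rightarrow> (nat \<Rightarrow> 'l) \<Rightarrow> nat \<Rightarrow> 'l" where
  "merge_label p f x =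
     (if f (skip (Suc p) x) = f (Suc p) then f p else f (skip (Suc p) x))"

lemma agrees_merge:
  assumes p: "length xs = p"
  shows "agrees (merge_label p f) (xs @ k # ys) \<longleftrightarrow> agrees f (xs @ k # k # ys)"
proof -
  let ?g = "f \<circ> skip (Suc p)" and ?zs = "xs @ k # ys"
  have gp: "?g p = f p" by (simp add: skip_def)
  have zp: "?zs ! p = k" and lp: "p < length ?zs" using p by auto
  have "agrees f (xs @ k # k # ys) \<longleftrightarrow>
     agrees ?g ?zs \<and> (\<forall>x<length ?zs. ?g x = f (Suc p) \<longrightarrow> ?zs ! x = k)"
    using agrees_insert[of "xs @ [k]" "Suc p" f k ys] p by simp
  moreover have "agrees (merge_label p f) ?zs \<longleftrightarrow>
     agrees ?g ?zs \<and> (\<forall>x<length ?zs. ?g x = f (Suc p) \<longrightarrow> ?zs ! x = k)" (is "?L \<longleftrightarrow> ?R")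
  proof
    assume L: ?L
    have "?zs ! x = k" if "x < length ?zs" "?g x = f (Suc p)" for x
      using agreesD[OF L that(1) lp] that zp gp by (auto simp: merge_label_def)
    moreover have "agrees ?g ?zs"
      unfolding agrees_def
    proof (intro allI impI)
      fix a b assume *: "a < length ?zs" "b < length ?zs" "?g a = ?g b"
      then have "merge_label p f a = merge_label p f b" by (simp only: merge_label_def comp_apply)
      then show "?zs ! a = ?zs ! b" using agreesD[OF L *(1,2)] by blast
    qed
    ultimately show ?R by blast
  next
    assume R: ?R
    have m: "merge_label p f x = (if ?g x = f (Suc p) then f p else ?g x)" for x
      by (simp add: merge_label_def)
    show ?L unfolding agrees_def
    proof (intro allI impI)
      fix a b assume *: "a < length ?zs" "b < length ?zs" "merge_label p f a = merge_label p f b"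
      have 1: "?zs ! x = k" if "x < length ?zs" "?g x = f (Suc p) \<or> ?g x = f p" for x
        using R that agreesD[of ?g ?zs x p] gp zp lp by metis
      show "?zs ! a = ?zs ! b"
        using * 1[of a] 1[of b] R agreesD[of ?g ?zs a b] unfolding m by (metis (full_types))
    qed
  qed
  ultimately show ?thesis by blast
qed

lemma skip_less: "a < b \<Longrightarrow> skip p a < skip p b"
  by (auto simp: skip_def)

lemma skip_neq: "skip p a \<noteq> p"
  by (auto simp: skip_def)

lemma skip_bound: "a < n \<Longrightarrow> skip p a < Suc n"
  by (auto simp: skip_def)

lemma nc_skip: "nc_labelling (Suc n) f \<Longrightarrow> nc_labelling n (f \<circ> skip p)"
  unfolding nc_labelling_def[of n]
proof (intro allI impI, elim conjE)
  fix a b c d assume nc: "nc_labelling (Suc n) f" and *: "a < b" "b < c" "c < d" "d < n"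
    "(f \<circ> skip p) a = (f \<circ> skip p) c" "(f \<circ> skip p) b = (f \<circ> skip p) d"
  then show "(f \<circ> skip p) a = (f \<circ> skip p) b"
    using ncD[OF nc skip_less[OF *(1)] skip_less[OF *(2)] skip_less[OF *(3)] skip_bound[OF *(4)]]
    by (simp only: comp_apply)
qed

text \<open>Since \<open>p\<close> and \<open>Suc p\<close> are neighbours, every other point lies
  on the same side of both. In a would-be crossing with the united block, one of the four points can
  be traded for whichever of the two has the required label, and then \<open>f\<close> itself would
  cross.\<close>

lemma nc_merge:
  assumes nc: "nc_labelling (Suc n) f" and p: "Suc p \<le> n"
  shows "nc_labelling n (merge_label p f)"
  unfolding nc_labelling_def
proof (intro allI impI, elim conjE)
  fix a b c d assume *: "a < b" "b < c" "c < d" "d < n"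
    and m: "merge_label p f a = merge_label p f c" "merge_label p f b = merge_label p f d"
  define A B C D where "A = skip (Suc p) a" "B = skip (Suc p) b" "C = skip (Suc p) c" "D = skip (Suc p) d"
  note d = this
  have o: "A < B" "B < C" "C < D" "D < Suc n" using * by (auto simp: d skip_less skip_bound)
  have ne: "A \<noteq> Suc p" "B \<noteq> Suc p" "C \<noteq> Suc p" "D \<noteq> Suc p" by (simp_all add: d skip_neq)
  note nD = ncD[OF nc]
  \<comment> \<open>Membership in the united block.\<close>
  define I where "I x \<longleftrightarrow> f x = f p \<or> f x = f (Suc p)" for x
  have pn: "Suc p < Suc n" using p by simp
  have rep: "\<exists>q. (q = p \<or> q = Suc p) \<and> f q = f x" if "I x" for x
    using that by (auto simp: I_def)
  have mI: "merge_label p f x = (if I (skip (Suc p) x) then f p else f (skip (Suc p) x))" for x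
    by (auto simp: merge_label_def I_def)
  have Ip: "\<not> I x \<Longrightarrow> f x \<noteq> f p \<and> f x \<noteq> f (Suc p)" for x by (auto simp: I_def)
  have nIp: "\<not> I x \<Longrightarrow> x \<noteq> p \<and> x \<noteq> Suc p" for x by (auto simp: I_def)
  have AC: "(I A \<and> I C) \<or> (\<not> I A \<and> \<not> I C \<and> f A = f C)"
    using m(1) unfolding mI d[symmetric] using Ip by (metis)
  have BD: "(I B \<and> I D) \<or> (\<not> I B \<and> \<not> I D \<and> f B = f D)"
    using m(2) unfolding mI d[symmetric] using Ip by (metis)
  have "(I A \<and> I B) \<or> (\<not> I A \<and> \<not> I B \<and> f A = f B)"
  proof (cases "I A")
    case True
    then have C: "I C" using AC by blast
    have "I B"
    proof (rule ccontr)
      assume nB: "\<not> I B"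
      then have nD': "\<not> I D" "f B = f D" using BD by auto
      obtain qa where qa: "qa = p \<or> qa = Suc p" "f qa = f A" using rep[OF True] by blast
      obtain qc where qc: "qc = p \<or> qc = Suc p" "f qc = f C" using rep[OF C] by blast
      have fA: "f A \<noteq> f B" "f C \<noteq> f B" using True C nB by (auto simp: I_def)
      consider "p < B" | "B < p" "p < D" | "D < p" using nIp[OF nB] nIp[OF nD'(1)] by linarith
      then show False
      proof cases
        case 1
        then have "qc < B" using qc nIp[OF nB] by auto
        then show False using nD[of qc B C D] o qc nD' fA by auto
      next
        case 2
        then have "B < qa" "qa < D" using qa nIp[OF nD'(1)] by auto
        then show False using nD[of A B qa D] o qa nD' fA by auto
      next
        case 3
        then have "D < qc" "qc < Suc n" using qc pn by auto
        then show False using nD[of B C D qc] o qc nD' fA by auto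
      qed
    qed
    then show ?thesis using True by blast
  next
    case False
    then have C: "\<not> I C" "f A = f C" using AC by auto
    have "\<not> I B"
    proof
      assume B: "I B"
      then have D: "I D" using BD by blast
      obtain qb where qb: "qb = p \<or> qb = Suc p" "f qb = f B" using rep[OF B] by blast
      obtain qd where qd: "qd = p \<or> qd = Suc p" "f qd = f D" using rep[OF D] by blast
      have fA: "f A \<noteq> f B" "f A \<noteq> f D" using B D False by (auto simp: I_def)
      consider "p < A" | "A < p" "p < C" | "C < p" using nIp[OF False] nIp[OF C(1)] by linarith
      then show False
      proof cases
        case 1
        then have "qb < A" using qb nIp[OF False] by auto
        then show False using nD[of qb A B C] o qb C fA by auto
      next
        case 2
        then have "A < qd" "qd < C" using qd nIp[OF C(1)] by auto
        then show False using nD[of A qd C D] o qd C fA by auto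
      next
        case 3
        then have "C < qb" "qb < Suc n" using qb pn by auto
        then show False using nD[of A B C qb] o qb C fA by auto
      qed
    qed
    then have "f B = f D" using BD by auto
    then show ?thesis using nD[of A B C D] o C \<open>\<not> I B\<close> False by auto
  qed
  then show "merge_label p f a = merge_label p f b" unfolding mI d[symmetric] by auto
qed

text \<open>Walking the boundary backwards exchanges the rows of a diagram, so this is the labelling
  of the adjoint partition.\<close>

definition rev_label :: "nat \<Rightarrow> (nat \<Rightarrow> 'l) \<Rightarrow> nat \<Rightarrow> 'l" where
  "rev_label n f x = f (n - Suc x)"

lemma agrees_rev: 
  assumes "length xs = n" shows "agrees (rev_label n f) xs \<longleftrightarrow> agrees f (rev xs)"
proof -
  have 1: "agrees (rev_label (length xs) f) xs" if "agrees f (rev xs)" for f :: "nat \<Rightarrow> 'a" and xs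
    unfolding agrees_def rev_label_def
  proof (intro allI impI)
    fix a b assume *: "a < length xs" "b < length xs" "f (length xs - Suc a) = f (length xs - Suc b)"
    show "xs ! a = xs ! b"
      using agreesD[OF that, of "length xs - Suc a" "length xs - Suc b"] * by (simp add: rev_nth)
  qed
  have 2: "agrees f (rev xs)" if "agrees (rev_label n f) xs"
    unfolding agrees_def
  proof (intro allI impI)
    fix a b assume *: "a < length (rev xs)" "b < length (rev xs)" "f a = f b"
    show "rev xs ! a = rev xs ! b"
      using agreesD[OF that, of "length xs - Suc a" "length xs - Suc b"] * assms
      by (simp add: rev_nth rev_label_def Suc_diff_Suc)
  qed
  show ?thesis using 1[of f xs] 2 assms by blast
qed

text \<open>From here on the \<open>2t\<close> points are those of a diagram with \<open>t\<close> upper and \<open>t\<close> lower points, numbered along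
  the boundary walk, so the lower points occur from right to left.\<close>

definition reducible_at :: "nat \<Rightarrow> (nat \<Rightarrow> 'l) \<Rightarrow> nat \<Rightarrow> bool" where
  "reducible_at t f p \<longleftrightarrow>
     p < t \<and> ((\<forall>y<2 * t. f y = f p \<longrightarrow> y = p) \<or> (Suc p < t \<and> f p = f (Suc p)))"

text \<open>The rainbow is the identity partition seen along the boundary walk. A pair of connected points at
  minimal distance is adjacent by noncrossingness, so it straddles the two rows.\<close>

lemma irreducible_is_rainbow:
  assumes nc: "nc_labelling (2 * t) f"
    and up: "\<And>p. \<not> reducible_at t f p"
    and lo: "\<And>p. \<not> reducible_at t (rev_label (2 * t) f) p"
    and x: "x < t"
  shows "f x = f (2 * t - Suc x)"
    and "\<And>y. y < 2 * t \<Longrightarrow> f x = f y \<Longrightarrow> y = x \<or> y = 2 * t - Suc x"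
proof -
  have S: "\<exists>y<2*t. y \<noteq> x \<and> f y = f x" if "x < 2 * t" for x
  proof (cases "x < t")
    case True
    then show ?thesis using up[of x] by (auto simp: reducible_at_def)
  next
    case False
    then have "2 * t - Suc x < t" using that by auto
    then obtain y where y: "y < 2 * t" "rev_label (2 * t) f y = rev_label (2 * t) f (2 * t - Suc x)" "y \<noteq> 2 * t - Suc x"
      using lo[of "2 * t - Suc x"] by (auto simp: reducible_at_def)
    show ?thesis
      by (rule exI[of _ "2 * t - Suc y"]) (use y that in \<open>auto simp: rev_label_def Suc_diff_Suc\<close>)
  qed
  have adj: "Suc x = t" if "Suc x < 2 * t" "f x = f (Suc x)" for x
  proof (rule ccontr)
    assume ne: "Suc x \<noteq> t"
    show False
    proof (cases "Suc x < t")
      case True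
      then show False using up[of x] that by (auto simp: reducible_at_def)
    next
      case False
      then have *: "Suc (2 * t - Suc (Suc x)) < t" using that ne by auto
      have "2 * t - Suc (2 * t - Suc (Suc x)) = Suc x" "2 * t - Suc (Suc (2 * t - Suc (Suc x))) = x"
        using that by auto
      then show False using lo[of "2 * t - Suc (Suc x)"] * that by (auto simp: reducible_at_def rev_label_def)
    qed
  qed
  \<comment> \<open>Induction on the distance: the point after \<open>x\<close> has a partner, which
    noncrossing traps strictly between \<open>x\<close> and \<open>y\<close>, and this shorter pair
    already straddles the two rows.\<close>
  have ins: "x < t \<and> t \<le> y" if "x < y" "y < 2 * t" "f x = f y" for x y
    using that
  proof (induction "y - x" arbitrary: x y rule: less_induct)
    case less
    show ?case
    proof (cases "f (Suc x) = f x")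
      case True
      then show ?thesis using adj[of x] less.prems by auto
    next
      case False
      then have xy: "Suc x < y" using less.prems by (cases "y = Suc x") auto
      then obtain z where z: "z < 2 * t" "z \<noteq> Suc x" "f z = f (Suc x)" using S[of "Suc x"] less.prems by auto
      have "\<not> z < x" using ncD[OF nc, of z x "Suc x" y] xy z less.prems False by auto
      moreover have "\<not> z > y" using ncD[OF nc, of x "Suc x" y z] xy z less.prems False by auto
      moreover have "z \<noteq> x" "z \<noteq> y" using z False less.prems by auto
      ultimately have "Suc x < z" "z < y" using z by auto
      then have "Suc x < t \<and> t \<le> z" using z by (intro less.hyps) auto
      then show ?thesis using \<open>z < y\<close> by auto
    qed
  qed
  \<comment> \<open>The induction starts at the middle of the walk. Points nearer to it are already
    matched with their mirror images, so a partner of \<open>x\<close> that is nearer than the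
    mirror image of \<open>x\<close> would connect two points of one row.\<close>
  have main: "f x = f (2 * t - Suc x)" if "x < t" for x
    using that
  proof (induction "t - x" arbitrary: x rule: less_induct)
    case less
    obtain y where y: "y < 2 * t" "y \<noteq> x" "f y = f x" using S[of x] less.prems by auto
    have yt: "t \<le> y" using ins[of x y] ins[of y x] y less.prems by (cases "x < y") auto
    have "\<not> y < 2 * t - Suc x"
    proof
      assume a: "y < 2 * t - Suc x"
      define x' where "x' = 2 * t - Suc y"
      have x': "x < x'" "x' < t" "2 * t - Suc x' = y" using a y yt by (auto simp: x'_def)
      then have "f x' = f y" using less.hyps[of x'] by auto
      then show False using ins[of x x'] y x' by auto
    qed
    \<comment> \<open>If the partner lay beyond the mirror image \<open>z\<close> of
      \<open>x\<close>, then the partner \<open>w\<close> of \<open>z\<close> in the upper row would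
      either connect two points of one row at once, or do so after noncrossing is applied to
      \<open>w\<close>, \<open>x\<close>, \<open>z\<close>, \<open>y\<close>.\<close>
    moreover have "\<not> y > 2 * t - Suc x"
    proof
      assume a: "y > 2 * t - Suc x"
      define z where "z = 2 * t - Suc x"
      have z: "x < z" "z < y" "t \<le> z" "z < 2 * t" using a y less.prems by (auto simp: z_def)
      obtain w where w: "w < 2 * t" "w \<noteq> z" "f w = f z" using S[of z] z by auto
      have wt: "w < t" using ins[of w z] ins[of z w] w z by (cases "w < z") auto
      consider "w = x" | "w > x" | "w < x" by linarith
      then show False
      proof cases
        case 1
        then show False using ins[of z y] z w y by auto
      next
        case 2
        then have "f w = f (2 * t - Suc w)" using less.hyps[of w] wt by auto
        moreover have "2 * t - Suc w < z" "t \<le> 2 * t - Suc w" using 2 wt by (auto simp: z_def)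
        ultimately show False using ins[of "2 * t - Suc w" z] z w by auto
      next
        case 3
        then have "f w = f x" using ncD[OF nc, of w x z y] z w y by auto
        then show False using ins[of w x] 3 less.prems by auto
      qed
    qed
    ultimately have "y = 2 * t - Suc x" by linarith
    then show ?case using y by simp
  qed
  show "f x = f (2 * t - Suc x)" using main x by blast
  show "y = x \<or> y = 2 * t - Suc x" if "y < 2 * t" "f x = f y" for y
  proof (rule ccontr)
    assume ne: "\<not> (y = x \<or> y = 2 * t - Suc x)"
    have "t \<le> y" using ins[of x y] ins[of y x] that ne x by (cases "x < y") auto
    moreover have "f y = f (2 * t - Suc x)" using main[OF x] that by simp
    ultimately show False
      using ins[of y "2 * t - Suc x"] ins[of "2 * t - Suc x" y] ne that x by (cases "y < 2 * t - Suc x") auto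
  qed
qed

text \<open>The entry of the partition map in row \<open>r\<close> and column \<open>c\<close>. The
  upper indices \<open>c\<close> come first on the boundary walk; the lower ones are met from right
  to left, hence \<open>rev r\<close>.\<close>

definition part_op :: "(nat \<Rightarrow> 'l) \<Rightarrow> nat list \<Rightarrow> nat list \<Rightarrow> complex" where
  "part_op f r c = of_bool (agrees f (c @ rev r))"

lemma part_op_rainbow:
  assumes nc: "nc_labelling (2 * t) f"
    and up: "\<And>p. \<not> reducible_at t f p"
    and lo: "\<And>p. \<not> reducible_at t (rev_label (2 * t) f) p"
    and l: "length r = t" "length c = t"
  shows "part_op f r c = of_bool (r = c)"
proof -
  note R = irreducible_is_rainbow[OF nc up lo]
  have n: "(c @ rev r) ! x = c ! x" "(c @ rev r) ! (2 * t - Suc x) = r ! x" if "x < t" for x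
    using that l by (auto simp: nth_append rev_nth)
  have "agrees f (c @ rev r) \<longleftrightarrow> r = c"
  proof
    assume C: "agrees f (c @ rev r)"
    show "r = c"
    proof (rule nth_equalityI)
      fix x assume "x < length r"
      then show "r ! x = c ! x"
        using agreesD[OF C, of x "2 * t - Suc x"] n[of x] R(1)[of x] l by auto
    qed (use l in auto)
  next
    assume rc: "r = c"
    have half: "(c @ rev r) ! x = (c @ rev r) ! y" if "x < t" "y < 2 * t" "f x = f y" for x y
      using R(2)[OF that] n[of x] that rc by auto
    show "agrees f (c @ rev r)"
      unfolding agrees_def
    proof (intro allI impI)
      fix a b assume *: "a < length (c @ rev r)" "b < length (c @ rev r)" "f a = f b"
      then have ab: "a < 2 * t" "b < 2 * t" using l by auto
      show "(c @ rev r) ! a = (c @ rev r) ! b"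
      proof (cases "a < t")
        case True
        then show ?thesis using half[of a b] ab * by auto
      next
        case False
        define a' where "a' = 2 * t - Suc a"
        have a': "a' < t" "2 * t - Suc a' = a" using False ab by (auto simp: a'_def)
        then have "f a' = f a" using R(1)[of a'] by simp
        then show ?thesis using half[of a' a] half[of a' b] a' ab * by auto
      qed
    qed
  qed
  then show ?thesis by (simp add: part_op_def)
qed

lemma part_op_rev_label:
  assumes "length r = t" "length c = t"
  shows "part_op (rev_label (2 * t) f) r c = part_op f c r"
  using assms agrees_rev[of "c @ rev r" "2 * t" f] by (simp add: part_op_def)

text \<open>Scalar factors are allowed because closing a loop produces a factor \<open>N\<close>.\<close>

definition nc_multiple :: "'l itself \<Rightarrow> nat \<Rightarrow> nat \<Rightarrow> (nat list \<Rightarrow> complex) \<Rightarrow> bool" where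
  "nc_multiple _ N n \<phi> \<longleftrightarrow> (\<exists>\<kappa> (f :: nat \<Rightarrow> 'l). \<kappa> \<noteq> 0 \<and> nc_labelling n f \<and>
     (\<forall>xs\<in>idx N n. \<phi> xs = \<kappa> * of_bool (agrees f xs)))"

lemma nc_multiple_sum:
  assumes N: "N > 0" and m: "nc_multiple TYPE('l) N (p + Suc q) \<phi>"
    and \<psi>: "\<And>xs ys. xs \<in> idx N p \<Longrightarrow> ys \<in> idx N q \<Longrightarrow> \<psi> (xs @ ys) = (\<Sum>k<N. \<phi> (xs @ k # ys))"
  shows "nc_multiple TYPE('l) N (p + q) \<psi>"
proof -
  obtain \<kappa> and f :: "nat \<Rightarrow> 'l" where f: "\<kappa> \<noteq> 0" "nc_labelling (Suc (p + q)) f"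
    "\<And>xs. xs \<in> idx N (p + Suc q) \<Longrightarrow> \<phi> xs = \<kappa> * of_bool (agrees f xs)"
    using m by (auto simp: nc_multiple_def)
  define \<mu> :: complex where "\<mu> = (if \<exists>x<p + q. f (skip p x) = f p then 1 else of_nat N)"
  have "\<psi> zs = \<kappa> * \<mu> * of_bool (agrees (f \<circ> skip p) zs)" if zs: "zs \<in> idx N (p + q)" for zs
  proof -
    obtain xs ys where z: "zs = xs @ ys" "xs \<in> idx N p" "ys \<in> idx N q" using idx_addE[OF zs] .
    have lx: "length xs = p" and lz: "length (xs @ ys) = p + q" using z by (auto simp: idx_length)
    have in_idx: "xs @ k # ys \<in> idx N (p + Suc q)" if "k < N" for k
      using z that by (intro idx_append) auto
    have "(\<Sum>k<N. of_bool (agrees f (xs @ k # ys))) = \<mu> * of_bool (agrees (f \<circ> skip p) zs)"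
    proof (cases "agrees (f \<circ> skip p) zs")
      case False
      then have "\<not> agrees f (xs @ k # ys)" for k using agrees_insert[OF lx] z by blast
      then show ?thesis using False by simp
    next
      case C: True
      show ?thesis
      proof (cases "\<exists>x<p + q. f (skip p x) = f p")
        case False
        then have "agrees f (xs @ k # ys)" for k
          using C unfolding agrees_insert[OF lx] lz z(1) by blast
        moreover have "\<mu> = of_nat N" unfolding \<mu>_def by (rule if_not_P[OF False])
        ultimately show ?thesis using C by simp
      next
        case True
        then obtain x0 where x0: "x0 < p + q" "f (skip p x0) = f p" by blast
        have "agrees f (xs @ k # ys) \<longleftrightarrow> k = zs ! x0" for k
        proof
          assume "agrees f (xs @ k # ys)"
          then show "k = zs ! x0" using agrees_insert[OF lx, of f k ys] x0 lz z(1) by metis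
        next
          assume k: "k = zs ! x0"
          show "agrees f (xs @ k # ys)"
            unfolding agrees_insert[OF lx]
          proof (intro conjI allI impI)
            show "agrees (f \<circ> skip p) (xs @ ys)" using C z by simp
            fix x assume "x < length (xs @ ys)" "f (skip p x) = f p"
            then show "(xs @ ys) ! x = k"
              using agreesD[OF C, of x x0] x0 lz z k by simp
          qed
        qed
        moreover have "zs ! x0 < N" using zs x0(1) nth_mem[of x0 zs] by (auto simp: idx_def simp del: nth_mem)
        ultimately show ?thesis using C True by (simp add: \<mu>_def)
      qed
    qed
    moreover have "\<psi> zs = (\<Sum>k<N. \<kappa> * of_bool (agrees f (xs @ k # ys)))"
      using \<psi> z f(3) in_idx by (auto intro!: sum.cong)
    ultimately show ?thesis by (simp add: sum_distrib_left[symmetric] mult.assoc)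
  qed
  moreover have "\<kappa> * \<mu> \<noteq> 0" using f(1) N by (simp add: \<mu>_def)
  moreover have "nc_labelling (p + q) (f \<circ> skip p)" using f(2) by (intro nc_skip) simp
  ultimately show ?thesis unfolding nc_multiple_def by blast
qed

lemma nc_multiple_merge:
  assumes m: "nc_multiple TYPE('l) N (p + Suc (Suc q)) \<phi>"
    and \<psi>: "\<And>xs k ys. xs \<in> idx N p \<Longrightarrow> k < N \<Longrightarrow> ys \<in> idx N q \<Longrightarrow> \<psi> (xs @ k # ys) = \<phi> (xs @ k # k # ys)"
  shows "nc_multiple TYPE('l) N (p + Suc q) \<psi>"
proof -
  obtain \<kappa> and f :: "nat \<Rightarrow> 'l" where f: "\<kappa> \<noteq> 0" "nc_labelling (Suc (Suc (p + q))) f"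
    "\<And>xs. xs \<in> idx N (p + Suc (Suc q)) \<Longrightarrow> \<phi> xs = \<kappa> * of_bool (agrees f xs)"
    using m by (auto simp: nc_multiple_def)
  have "\<psi> zs = \<kappa> * of_bool (agrees (merge_label p f) zs)" if zs: "zs \<in> idx N (p + Suc q)" for zs
  proof -
    obtain xs k ys where z: "zs = xs @ k # ys" "xs \<in> idx N p" "k < N" "ys \<in> idx N q"
      using idx_addE[OF zs] by (metis idx_SucE)
    have "xs @ k # k # ys \<in> idx N (p + Suc (Suc q))"
      using z by (intro idx_append) auto
    then have "\<psi> zs = \<kappa> * of_bool (agrees f (xs @ k # k # ys))"
      using \<psi> z f(3) by auto
    then show ?thesis using agrees_merge[of xs p f k ys] z by (simp add: idx_length)
  qed
  moreover have "nc_labelling (p + Suc q) (merge_label p f)" using nc_merge[OF f(2), of p] by simp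
  ultimately show ?thesis using f(1) unfolding nc_multiple_def by blast
qed

lemma agrees_replicate: "agrees f (replicate n k)"
  by (simp add: agrees_def)

section \<open>Test vectors that detect the identity partition\<close>

definition letter_vec :: "bool \<Rightarrow> nat \<Rightarrow> complex" where
  "letter_vec s k = (if s then of_bool (k = 0) - of_bool (k = 1) else of_bool (k = 2) - of_bool (k = 3))"

fun alternating :: "bool \<Rightarrow> nat list \<Rightarrow> complex" where
  "alternating s [] = 1"
| "alternating s (k # ks) = letter_vec s k * alternating (\<not> s) ks"

lemma sum_letter_vec: "N \<ge> 4 \<Longrightarrow> (\<Sum>k<N. letter_vec s k) = 0"
  by (cases s) (simp_all add: letter_vec_def sum_subtractf)

lemma letter_vec_orthogonal: "letter_vec s k * letter_vec (\<not> s) k = 0"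
  by (simp add: letter_vec_def of_bool_def)

lemma sum_letter_vec_square: "N \<ge> 4 \<Longrightarrow> (\<Sum>k<N. letter_vec s k * letter_vec s k) = 2"
proof -
  assume N: "N \<ge> 4"
  have "letter_vec s k * letter_vec s k = (if s then of_bool (k = 0) + of_bool (k = 1) else of_bool (k = 2) + of_bool (k = 3))" for k
    by (auto simp: letter_vec_def)
  then show ?thesis using N by (cases s) (simp_all add: sum.distrib)
qed

text \<open>\<open>s = even n\<close> is \<open>s\<close> for even \<open>n\<close> and its negation
  for odd \<open>n\<close>, which is the letter due after a prefix of length
  \<open>n\<close>.\<close>

lemma alternating_append:
  "alternating s (xs @ ys) = alternating s xs * alternating (s = even (length xs)) ys"
proof (induction xs arbitrary: s)
  case (Cons x xs)
  have "((\<not> s) = even (length xs)) = (s = even (length (x # xs)))" by auto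
  then show ?case by (simp only: append_Cons alternating.simps Cons.IH mult.assoc)
qed simp

lemma sum_alternating_square:
  assumes "N \<ge> 4"
  shows "(\<Sum>xs\<in>idx N t. alternating s xs * alternating s xs) = 2 ^ t"
proof (induction t arbitrary: s)
  case (Suc t)
  have "(\<Sum>xs\<in>idx N (Suc t). alternating s xs * alternating s xs)
      = (\<Sum>k<N. letter_vec s k * letter_vec s k * (\<Sum>xs\<in>idx N t. alternating (\<not> s) xs * alternating (\<not> s) xs))"
    by (simp add: sum_idx_Suc sum_distrib_left algebra_simps)
  also have "\<dots> = 2 * 2 ^ t" using assms by (simp add: Suc sum_letter_vec_square flip: sum_distrib_right)
  finally show ?case by simp
qed simp

lemma alternating_orthogonal:
  "xs \<noteq> [] \<Longrightarrow> alternating True xs * alternating False xs = 0"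
  using letter_vec_orthogonal[of True "hd xs"] by (cases xs) auto

text \<open>The factor at position \<open>p\<close> separates from the rest, and its coordinates sum
  to zero.\<close>

lemma alternating_kills_singleton:
  assumes "N \<ge> 4" and t: "p < t"
    and "\<And>xs k ys. xs \<in> idx N p \<Longrightarrow> k < N \<Longrightarrow> ys \<in> idx N (t - Suc p) \<Longrightarrow> F (xs @ k # ys) = F (xs @ 0 # ys)"
  shows "(\<Sum>c\<in>idx N t. alternating s c * F c) = 0"
proof -
  have tp: "t = p + Suc (t - Suc p)" using t by simp
  have "(\<Sum>c\<in>idx N t. alternating s c * F c) = (\<Sum>xs\<in>idx N p. \<Sum>k<N. \<Sum>ys\<in>idx N (t - Suc p).
      alternating s (xs @ k # ys) * F (xs @ k # ys))"
    by (subst tp, subst sum_idx_add, simp add: sum_idx_Suc)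
  also have "\<dots> = (\<Sum>xs\<in>idx N p. \<Sum>k<N. \<Sum>ys\<in>idx N (t - Suc p).
      letter_vec (s = even p) k * (alternating s xs * alternating (s \<noteq> even p) ys * F (xs @ 0 # ys)))"
  proof (intro sum.cong refl)
    fix xs k ys assume "xs \<in> idx N p" "k \<in> {..<N}" "ys \<in> idx N (t - Suc p)"
    then show "alternating s (xs @ k # ys) * F (xs @ k # ys) =
      letter_vec (s = even p) k * (alternating s xs * alternating (s \<noteq> even p) ys * F (xs @ 0 # ys))"
      using assms(3)[of xs k ys] by (simp add: alternating_append idx_length)
  qed
  also have "\<dots> = 0" using sum_letter_vec[OF assms(1), of "s = even p"]
    by (simp add: sum_distrib_left[symmetric] sum_distrib_right[symmetric])
  finally show ?thesis .
qed

text \<open>Neighbouring factors of an alternating vector have disjoint supports, so only different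
  indices \<open>a\<close>, \<open>b\<close> could contribute, and there \<open>F\<close> vanishes
  by assumption.\<close>

lemma alternating_kills_pair:
  assumes t: "Suc p < t"
    and "\<And>xs a b ys. xs \<in> idx N p \<Longrightarrow> a < N \<Longrightarrow> b < N \<Longrightarrow> ys \<in> idx N (t - Suc (Suc p)) \<Longrightarrow> a \<noteq> b \<Longrightarrow> F (xs @ a # b # ys) = 0"
  shows "(\<Sum>c\<in>idx N t. alternating s c * F c) = 0"
proof (rule sum.neutral, rule ballI)
  fix c assume c: "c \<in> idx N t"
  have tp: "t = p + Suc (Suc (t - Suc (Suc p)))" using t by simp
  obtain xs zs where z: "c = xs @ zs" "xs \<in> idx N p" "zs \<in> idx N (Suc (Suc (t - Suc (Suc p))))"
    using idx_addE[of c N p] c tp by metis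
  obtain a b ys where a: "zs = a # b # ys" "a < N" "b < N" "ys \<in> idx N (t - Suc (Suc p))"
    using z(3) by (metis idx_SucE)
  show "alternating s c * F c = 0"
  proof (cases "a = b")
    case True
    then have "alternating s c = alternating s xs * (letter_vec (s = even p) a * letter_vec (\<not> (s = even p)) a) *
       alternating (s = even p) ys"
      using z a by (simp add: alternating_append idx_length)
    then show ?thesis by (simp only: letter_vec_orthogonal) simp
  next
    case False
    then show ?thesis using assms(2) z a by simp
  qed
qed

lemma agrees_singleton_indep:
  assumes "\<forall>y<2 * t. f y = f p \<longrightarrow> y = p" "length xs = p" "length xs + Suc (length ys) = 2 * t"
  shows "agrees f (xs @ k # ys) \<longleftrightarrow> agrees f (xs @ l # ys)"
proof -
  have "f (skip p x) \<noteq> f p" if "x < length (xs @ ys)" for x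
  proof
    assume "f (skip p x) = f p"
    moreover have "skip p x < 2 * t" using that assms(3) by (simp add: skip_def)
    ultimately show False using assms(1) skip_neq[of p x] by blast
  qed
  then show ?thesis using agrees_insert[OF assms(2)] by blast
qed

lemma agrees_pair:
  assumes "agrees f (xs @ a # b # ys)" "f p = f (Suc p)" "length xs = p"
  shows "a = b"
  using agreesD[OF assms(1), of p "Suc p"] assms(2,3) by (auto simp: nth_append)

text \<open>This treats the upper row; the lower row follows by passing to
  \<open>rev_label\<close>.\<close>

lemma reducible_test:
  assumes N: "N \<ge> 4" and red: "reducible_at t f p" and r: "r \<in> idx N t"
  shows "(\<Sum>c\<in>idx N t. alternating s c * part_op f r c) = 0"
proof (cases "\<forall>y<2 * t. f y = f p \<longrightarrow> y = p")
  case True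
  have p: "p < t" using red by (simp add: reducible_at_def)
  show ?thesis
  proof (rule alternating_kills_singleton[OF N p])
    fix xs k ys assume "xs \<in> idx N p" "k < N" "ys \<in> idx N (t - Suc p)"
    then show "part_op f r (xs @ k # ys) = part_op f r (xs @ 0 # ys)"
      using agrees_singleton_indep[OF True, of xs "ys @ rev r" k 0] p r
      by (simp add: part_op_def idx_length)
  qed
next
  case False
  then have p: "Suc p < t" "f p = f (Suc p)" using red by (auto simp: reducible_at_def)
  show ?thesis
  proof (rule alternating_kills_pair[OF p(1)])
    fix xs ys and a b :: nat assume "xs \<in> idx N p" "a \<noteq> b"
    then show "part_op f r (xs @ a # b # ys) = 0"
      using agrees_pair[of f xs a b "ys @ rev r" p] p by (auto simp: part_op_def idx_length)
  qed
qed

section \<open>Intertwiners over a *-algebra\<close>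

context complex_star_algebra
begin

lemma star_zero [simp]: "star 0 = 0"
  using star_add[of 0 0] by simp

lemma star_one [simp]: "star 1 = 1"
  using star_mult[of "star 1" 1] by (simp add: star_star)

lemma star_sum: "star (sum f A) = (\<Sum>x\<in>A. star (f x))"
  by (induction A rule: infinite_finite_induct) (simp_all add: star_add)

lemmas scale_sums = scale_sum_right scale_sum_left sum_distrib_left sum_distrib_right
  scale_mult_left scale_mult_right mult.assoc

text \<open>Both \<open>M\<close> and its entrywise conjugate are unitary; in a noncommutative algebra neither implies the
  other.\<close>

definition bi_unitary :: "'i set \<Rightarrow> ('i \<Rightarrow> 'i \<Rightarrow> 'a) \<Rightarrow> bool" where
  "bi_unitary I M \<longleftrightarrow> finite I \<and> (\<forall>i\<in>I. \<forall>j\<in>I.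
     (\<Sum>k\<in>I. M i k * star (M j k)) = of_bool (i = j) \<and>
     (\<Sum>k\<in>I. star (M i k) * M j k) = of_bool (i = j) \<and>
     (\<Sum>k\<in>I. M k i * star (M k j)) = of_bool (i = j) \<and>
     (\<Sum>k\<in>I. star (M k i) * M k j) = of_bool (i = j))"

lemma bi_unitaryD:
  assumes "bi_unitary I M" "i \<in> I" "j \<in> I"
  shows "(\<Sum>k\<in>I. M i k * star (M j k)) = of_bool (i = j)"
    "(\<Sum>k\<in>I. star (M i k) * M j k) = of_bool (i = j)"
    "(\<Sum>k\<in>I. M k i * star (M k j)) = of_bool (i = j)"
    "(\<Sum>k\<in>I. star (M k i) * M k j) = of_bool (i = j)"
  using assms by (auto simp: bi_unitary_def)

lemma bi_unitary_finite: "bi_unitary I M \<Longrightarrow> finite I"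
  by (simp add: bi_unitary_def)

text \<open>The scalar matrix \<open>T\<close> commutes with \<open>M\<close>: this is
  \<open>M T = T M\<close>, entry by entry in the algebra.\<close>

definition endo :: "'i set \<Rightarrow> ('i \<Rightarrow> 'i \<Rightarrow> 'a) \<Rightarrow> ('i \<Rightarrow> 'i \<Rightarrow> complex) \<Rightarrow> bool" where
  "endo I M T \<longleftrightarrow> (\<forall>i\<in>I. \<forall>k\<in>I. (\<Sum>j\<in>I. T j k *s M i j) = (\<Sum>j\<in>I. T i j *s M j k))"

lemma endoD: "endo I M T \<Longrightarrow> i \<in> I \<Longrightarrow> k \<in> I \<Longrightarrow>
    (\<Sum>j\<in>I. T j k *s M i j) = (\<Sum>j\<in>I. T i j *s M j k)"
  by (simp add: endo_def)

lemma endo_cong: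
  assumes "\<And>i j. i \<in> I \<Longrightarrow> j \<in> I \<Longrightarrow> S i j = T i j"
  shows "endo I M S \<longleftrightarrow> endo I M T"
  unfolding endo_def using assms by (intro ball_cong refl arg_cong2[of _ _ _ _ "(=)"] sum.cong) auto

lemma endo_scale:
  assumes "\<kappa> \<noteq> 0" shows "endo I M (\<lambda>i j. \<kappa> * T i j) \<longleftrightarrow> endo I M T"
  using assms by (simp add: endo_def scale_sum_right[symmetric] flip: scale_scale)

lemma endo_mult:
  assumes S: "endo I M S" and T: "endo I M T"
  shows "endo I M (\<lambda>i k. \<Sum>j\<in>I. S i j * T j k)"
  unfolding endo_def
proof (intro ballI)
  fix i k assume ik: "i \<in> I" "k \<in> I"
  have "(\<Sum>j\<in>I. (\<Sum>l\<in>I. S j l * T l k) *s M i j) = (\<Sum>l\<in>I. T l k *s (\<Sum>j\<in>I. S j l *s M i j))"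
    by (simp add: scale_sums, subst sum.swap, simp add: mult.commute)
  also have "\<dots> = (\<Sum>l\<in>I. T l k *s (\<Sum>j\<in>I. S i j *s M j l))"
    using endoD[OF S] ik by (intro sum.cong) auto
  also have "\<dots> = (\<Sum>j\<in>I. S i j *s (\<Sum>l\<in>I. T l k *s M j l))"
    by (simp add: scale_sums, subst sum.swap, simp add: mult.commute)
  also have "\<dots> = (\<Sum>j\<in>I. S i j *s (\<Sum>l\<in>I. T j l *s M l k))"
    using endoD[OF T] ik by (intro sum.cong) auto
  also have "\<dots> = (\<Sum>l\<in>I. (\<Sum>j\<in>I. S i j * T j l) *s M l k)"
    by (simp add: scale_sums, subst sum.swap, simp add: mult.commute)
  finally show "(\<Sum>j\<in>I. (\<Sum>l\<in>I. S j l * T l k) *s M i j) = (\<Sum>l\<in>I. (\<Sum>j\<in>I. S i j * T j l) *s M l k)" .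
qed

text \<open>Multiplying \<open>M T = T M\<close> by the adjoint of \<open>M\<close> on both sides
  shows that \<open>T\<close> commutes with that adjoint; the adjoint of the resulting identity is
  the claim.\<close>

lemma endo_adjoint:
  assumes U: "bi_unitary I M" and T: "endo I M T"
  shows "endo I M (\<lambda>i k. cnj (T k i))"
  unfolding endo_def
proof (intro ballI)
  fix i k assume ik: "i \<in> I" "k \<in> I"
  note fin = bi_unitary_finite[OF U]
  have "(\<Sum>j\<in>I. T k j *s star (M i j)) = (\<Sum>j\<in>I. \<Sum>l\<in>I. T l j *s (of_bool (k = l) * star (M i j)))"
    using fin ik by (intro sum.cong refl) (simp add: of_bool_def if_distrib[where f = "\<lambda>x. x * _"] if_distrib[where f = "\<lambda>x. _ *s x"] cong: if_cong)
  also have "\<dots> = (\<Sum>j\<in>I. \<Sum>l\<in>I. T l j *s ((\<Sum>a\<in>I. star (M a k) * M a l) * star (M i j)))"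
    using bi_unitaryD(4)[OF U ik(2)] by (intro sum.cong refl) auto
  also have "\<dots> = (\<Sum>j\<in>I. \<Sum>a\<in>I. \<Sum>l\<in>I. T l j *s (star (M a k) * M a l * star (M i j)))"
    by (simp add: scale_sums, rule sum.cong[OF refl], rule sum.swap)
  also have "\<dots> = (\<Sum>a\<in>I. \<Sum>j\<in>I. star (M a k) * ((\<Sum>l\<in>I. T l j *s M a l) * star (M i j)))"
    by (subst sum.swap) (simp add: scale_sums)
  also have "\<dots> = (\<Sum>a\<in>I. \<Sum>j\<in>I. star (M a k) * ((\<Sum>l\<in>I. T a l *s M l j) * star (M i j)))"
    using endoD[OF T] by (intro sum.cong refl) auto
  also have "\<dots> = (\<Sum>a\<in>I. star (M a k) * (\<Sum>l\<in>I. T a l *s (\<Sum>j\<in>I. M l j * star (M i j))))"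
    by (simp add: scale_sums, rule sum.cong[OF refl], rule sum.swap)
  also have "\<dots> = (\<Sum>a\<in>I. star (M a k) * (\<Sum>l\<in>I. T a l *s of_bool (l = i)))"
    using bi_unitaryD(1)[OF U _ ik(1)] by (intro sum.cong refl arg_cong2[of _ _ _ _ "(*)"]) auto
  also have "\<dots> = (\<Sum>a\<in>I. T a i *s star (M a k))"
    using fin ik by (intro sum.cong refl) (simp add: of_bool_def if_distrib[where f = "\<lambda>x. _ *s x"] scale_mult_right cong: if_cong)
  finally have "star (\<Sum>j\<in>I. T k j *s star (M i j)) = star (\<Sum>a\<in>I. T a i *s star (M a k))" by simp
  then show "(\<Sum>j\<in>I. cnj (T k j) *s M i j) = (\<Sum>j\<in>I. cnj (T j i) *s M j k)"
    by (simp add: star_sum star_scale star_star)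
qed

lemma sum_delta_scale:
  assumes "finite A" "a \<in> A"
  shows "(\<Sum>x\<in>A. F x *s (of_bool (a = x) * G x)) = F a *s G a"
    "(\<Sum>x\<in>A. F x *s (of_bool (x = a) * G x)) = F a *s G a"
    "(\<Sum>x\<in>A. F x *s (G x * of_bool (a = x))) = F a *s G a"
    "(\<Sum>x\<in>A. F x *s (G x * of_bool (x = a))) = F a *s G a"
  using assms by (simp_all add: of_bool_def if_distrib[where f = "\<lambda>x. x * _"] if_distrib[where f = "\<lambda>x. _ * x"] if_distrib[where f = "\<lambda>x. _ *s x"] cong: if_cong)

text \<open>Multiply by \<open>star (U i c)\<close> from the left and sum over \<open>i\<close> and
  \<open>c\<close>. As entries do not commute, both sides produce products of the form
  \<open>star U * U\<close>: one sum is unitarity of \<open>U\<close>, the other is unitarity of its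
  entrywise conjugate.\<close>

lemma left_trace:
  assumes U: "bi_unitary A U"
    and H: "\<And>i j c l. i \<in> A \<Longrightarrow> j \<in> B \<Longrightarrow> c \<in> A \<Longrightarrow> l \<in> B \<Longrightarrow>
      (\<Sum>a\<in>A. \<Sum>b\<in>B. T a b c l *s (U i a * V j b)) = (\<Sum>a\<in>A. \<Sum>b\<in>B. T i j a b *s (U a c * V b l))"
    and jl: "j \<in> B" "l \<in> B"
  shows "(\<Sum>b\<in>B. (\<Sum>c\<in>A. T c b c l) *s V j b) = (\<Sum>b\<in>B. (\<Sum>i\<in>A. T i j i b) *s V b l)"
proof -
  note fin = bi_unitary_finite[OF U]
  have "(\<Sum>c\<in>A. \<Sum>i\<in>A. star (U i c) * (\<Sum>a\<in>A. \<Sum>b\<in>B. T a b c l *s (U i a * V j b)))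
     = (\<Sum>c\<in>A. \<Sum>b\<in>B. \<Sum>a\<in>A. T a b c l *s ((\<Sum>i\<in>A. star (U i c) * U i a) * V j b))"
  proof (intro sum.cong refl)
    fix c
    have "(\<Sum>i\<in>A. star (U i c) * (\<Sum>a\<in>A. \<Sum>b\<in>B. T a b c l *s (U i a * V j b)))
      = (\<Sum>i\<in>A. \<Sum>b\<in>B. \<Sum>a\<in>A. T a b c l *s (star (U i c) * U i a * V j b))"
      by (simp add: scale_sums, rule sum.cong[OF refl], rule sum.swap)
    also have "\<dots> = (\<Sum>b\<in>B. \<Sum>i\<in>A. \<Sum>a\<in>A. T a b c l *s (star (U i c) * U i a * V j b))"
      by (rule sum.swap)
    also have "\<dots> = (\<Sum>b\<in>B. \<Sum>a\<in>A. T a b c l *s ((\<Sum>i\<in>A. star (U i c) * U i a) * V j b))"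
      by (simp add: scale_sums, rule sum.cong[OF refl], rule sum.swap)
    finally show "(\<Sum>i\<in>A. star (U i c) * (\<Sum>a\<in>A. \<Sum>b\<in>B. T a b c l *s (U i a * V j b)))
      = (\<Sum>b\<in>B. \<Sum>a\<in>A. T a b c l *s ((\<Sum>i\<in>A. star (U i c) * U i a) * V j b))" .
  qed
  also have "\<dots> = (\<Sum>c\<in>A. \<Sum>b\<in>B. T c b c l *s V j b)"
    using bi_unitaryD(4)[OF U] fin by (intro sum.cong refl) (simp add: sum_delta_scale)
  also have "\<dots> = (\<Sum>b\<in>B. (\<Sum>c\<in>A. T c b c l) *s V j b)"
    by (subst sum.swap) (simp add: scale_sums)
  finally have L: "(\<Sum>c\<in>A. \<Sum>i\<in>A. star (U i c) * (\<Sum>a\<in>A. \<Sum>b\<in>B. T a b c l *s (U i a * V j b)))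
     = (\<Sum>b\<in>B. (\<Sum>c\<in>A. T c b c l) *s V j b)" .
  have "(\<Sum>c\<in>A. \<Sum>i\<in>A. star (U i c) * (\<Sum>a\<in>A. \<Sum>b\<in>B. T i j a b *s (U a c * V b l)))
     = (\<Sum>i\<in>A. \<Sum>c\<in>A. star (U i c) * (\<Sum>a\<in>A. \<Sum>b\<in>B. T i j a b *s (U a c * V b l)))"
    by (rule sum.swap)
  also have "\<dots> = (\<Sum>i\<in>A. \<Sum>b\<in>B. \<Sum>a\<in>A. T i j a b *s ((\<Sum>c\<in>A. star (U i c) * U a c) * V b l))"
  proof (intro sum.cong refl)
    fix i
    have "(\<Sum>c\<in>A. star (U i c) * (\<Sum>a\<in>A. \<Sum>b\<in>B. T i j a b *s (U a c * V b l)))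
      = (\<Sum>c\<in>A. \<Sum>b\<in>B. \<Sum>a\<in>A. T i j a b *s (star (U i c) * U a c * V b l))"
      by (simp add: scale_sums, rule sum.cong[OF refl], rule sum.swap)
    also have "\<dots> = (\<Sum>b\<in>B. \<Sum>c\<in>A. \<Sum>a\<in>A. T i j a b *s (star (U i c) * U a c * V b l))"
      by (rule sum.swap)
    also have "\<dots> = (\<Sum>b\<in>B. \<Sum>a\<in>A. T i j a b *s ((\<Sum>c\<in>A. star (U i c) * U a c) * V b l))"
      by (simp add: scale_sums, rule sum.cong[OF refl], rule sum.swap)
    finally show "(\<Sum>c\<in>A. star (U i c) * (\<Sum>a\<in>A. \<Sum>b\<in>B. T i j a b *s (U a c * V b l)))
      = (\<Sum>b\<in>B. \<Sum>a\<in>A. T i j a b *s ((\<Sum>c\<in>A. star (U i c) * U a c) * V b l))" .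
  qed
  also have "\<dots> = (\<Sum>i\<in>A. \<Sum>b\<in>B. T i j i b *s V b l)"
    using bi_unitaryD(2)[OF U] fin by (intro sum.cong refl) (simp add: sum_delta_scale)
  also have "\<dots> = (\<Sum>b\<in>B. (\<Sum>i\<in>A. T i j i b) *s V b l)"
    by (subst sum.swap) (simp add: scale_sums)
  finally show ?thesis using L H jl by simp
qed

text \<open>\<open>star\<close> reverses products, so the right factor becomes the left factor of
  the conjugated identity.\<close>

lemma right_trace:
  assumes V: "bi_unitary B V"
    and H: "\<And>i j c l. i \<in> A \<Longrightarrow> j \<in> B \<Longrightarrow> c \<in> A \<Longrightarrow> l \<in> B \<Longrightarrow>
      (\<Sum>a\<in>A. \<Sum>b\<in>B. T a b c l *s (U i a * V j b)) = (\<Sum>a\<in>A. \<Sum>b\<in>B. T i j a b *s (U a c * V b l))"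
    and ic: "i \<in> A" "c \<in> A"
  shows "(\<Sum>a\<in>A. (\<Sum>l\<in>B. T a l c l) *s U i a) = (\<Sum>a\<in>A. (\<Sum>j\<in>B. T i j a j) *s U a c)"
proof -
  have V': "bi_unitary B (\<lambda>i j. star (V i j))" using V unfolding bi_unitary_def star_star by blast
  have H': "(\<Sum>b\<in>B. \<Sum>a\<in>A. cnj (T a b c l) *s (star (V j b) * star (U i a)))
      = (\<Sum>b\<in>B. \<Sum>a\<in>A. cnj (T i j a b) *s (star (V b l) * star (U a c)))"
    if "i \<in> A" "j \<in> B" "c \<in> A" "l \<in> B" for i j c l
  proof -
    have st: "star (\<Sum>a\<in>A. \<Sum>b\<in>B. F a b *s (G a * K b)) = (\<Sum>b\<in>B. \<Sum>a\<in>A. cnj (F a b) *s (star (K b) * star (G a)))"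
      for F G K
      by (subst sum.swap) (simp add: star_sum star_scale star_mult)
    show ?thesis using arg_cong[OF H[OF that], of star] unfolding st .
  qed
  have "(\<Sum>a\<in>A. (\<Sum>l\<in>B. cnj (T a l c l)) *s star (U i a)) = (\<Sum>a\<in>A. (\<Sum>j\<in>B. cnj (T i j a j)) *s star (U a c))"
    by (rule left_trace[OF V', where T = "\<lambda>b a l c. cnj (T a b c l)" and V = "\<lambda>i j. star (U i j)" and B = A])
       (rule H' ic | assumption)+
  then have "star (\<Sum>a\<in>A. (\<Sum>l\<in>B. T a l c l) *s U i a) = star (\<Sum>a\<in>A. (\<Sum>j\<in>B. T i j a j) *s U a c)"
    by (simp add: star_sum star_scale)
  from arg_cong[OF this, of star] show ?thesis unfolding star_star .
qed

text \<open>\<open>\<zeta>\<close> spans a line on which \<open>M\<close> acts by \<open>g\<close>;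
  the zero vector is excluded separately where needed.\<close>

definition semi_inv :: "'i set \<Rightarrow> ('i \<Rightarrow> 'i \<Rightarrow> 'a) \<Rightarrow> ('i \<Rightarrow> complex) \<Rightarrow> 'a \<Rightarrow> bool" where
  "semi_inv I M \<zeta> g \<longleftrightarrow> (\<forall>i\<in>I. (\<Sum>j\<in>I. \<zeta> j *s M i j) = \<zeta> i *s g)"

text \<open>Comparing the algebra-valued norms of both sides of \<open>M \<zeta> = \<zeta> g\<close>
  gives \<open>star g * g = 1\<close>, since the norm of \<open>\<zeta>\<close> is a nonzero number.
  The coordinate \<open>k\<close> supplies a right inverse through unitarity of the conjugate
  matrix, and a left and a right inverse coincide.\<close>

lemma semi_inv_unitary:
  assumes U: "bi_unitary I M" and e: "semi_inv I M \<zeta> g" and k: "k \<in> I" "\<zeta> k \<noteq> 0"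
  shows "star g * g = 1" "g * star g = 1"
proof -
  note fin = bi_unitary_finite[OF U]
  define n where "n = (\<Sum>i\<in>I. cnj (\<zeta> i) * \<zeta> i)"
  have n: "n = of_real (\<Sum>i\<in>I. (cmod (\<zeta> i))\<^sup>2)"
    unfolding n_def of_real_sum by (intro sum.cong refl) (metis complex_norm_square mult.commute)
  have "(\<Sum>i\<in>I. (cmod (\<zeta> i))\<^sup>2) > 0"
    using k fin by (intro sum_pos2[of _ k]) auto
  then have n0: "n \<noteq> 0" unfolding n of_real_eq_0_iff by simp
  have "(\<Sum>i\<in>I. star (\<zeta> i *s g) * (\<zeta> i *s g)) = n *s (star g * g)"
    by (simp add: n_def star_scale scale_sums mult.commute)
  moreover have "(\<Sum>i\<in>I. star (\<zeta> i *s g) * (\<zeta> i *s g)) =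
     (\<Sum>i\<in>I. star (\<Sum>j\<in>I. \<zeta> j *s M i j) * (\<Sum>j\<in>I. \<zeta> j *s M i j))"
    using e by (intro sum.cong refl) (simp add: semi_inv_def)
  moreover have "\<dots> = (\<Sum>i\<in>I. \<Sum>j\<in>I. \<Sum>k\<in>I. (cnj (\<zeta> j) * \<zeta> k) *s (star (M i j) * M i k))"
    by (simp add: star_sum star_scale scale_sums mult.commute)
       (rule sum.cong[OF refl], rule sum.swap)
  moreover have "\<dots> = (\<Sum>j\<in>I. \<Sum>k\<in>I. (cnj (\<zeta> j) * \<zeta> k) *s (\<Sum>i\<in>I. star (M i j) * M i k))"
    by (subst sum.swap, simp add: scale_sums, rule sum.cong[OF refl], rule sum.swap)
  moreover have "\<dots> = (\<Sum>j\<in>I. \<Sum>k\<in>I. (cnj (\<zeta> j) * \<zeta> k) *s (of_bool (j = k) * 1))"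
    using bi_unitaryD(4)[OF U] by (intro sum.cong refl) simp
  moreover have "\<dots> = n *s 1"
    using fin by (simp add: n_def sum_delta_scale scale_sums del: mult_1_right)
  ultimately have "n *s (star g * g) = n *s 1" by simp
  then show gg: "star g * g = 1" using n0 scale_cancel_left by blast
  have "g * (\<Sum>i\<in>I. \<zeta> i *s star (M i k)) = (\<Sum>i\<in>I. (\<zeta> i *s g) * star (M i k))"
    by (simp add: scale_sums)
  also have "\<dots> = (\<Sum>i\<in>I. (\<Sum>j\<in>I. \<zeta> j *s M i j) * star (M i k))"
    using e by (intro sum.cong refl) (simp add: semi_inv_def)
  also have "\<dots> = (\<Sum>j\<in>I. \<zeta> j *s (\<Sum>i\<in>I. M i j * star (M i k)))"
    by (simp add: scale_sums) (rule sum.swap)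
  also have "\<dots> = (\<Sum>j\<in>I. \<zeta> j *s (of_bool (j = k) * 1))"
    using bi_unitaryD(3)[OF U _ k(1)] by (intro sum.cong refl) simp
  also have "\<dots> = \<zeta> k *s 1"
    using fin k by (simp only: sum_delta_scale)
  finally have "g * ((1 / \<zeta> k) *s (\<Sum>i\<in>I. \<zeta> i *s star (M i k))) = 1"
    using k(2) by (simp add: scale_mult_right)
  with gg show "g * star g = 1" by (metis mult.assoc mult_1_left mult_1_right)
qed

text \<open>Unitarity turns \<open>M \<zeta> = \<zeta> g\<close> into an equation for the adjoint of
  \<open>M\<close>, whose own adjoint says that the conjugate row vector is scaled by the same
  \<open>g\<close>.\<close>

lemma semi_inv_col:
  assumes U: "bi_unitary I M" and e: "semi_inv I M \<zeta> g" and g: "g * star g = 1" and k: "k \<in> I"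
  shows "(\<Sum>l\<in>I. cnj (\<zeta> l) *s M l k) = cnj (\<zeta> k) *s g"
proof -
  note fin = bi_unitary_finite[OF U]
  have e': "(\<Sum>j\<in>I. \<zeta> j *s M l j) = \<zeta> l *s g" if "l \<in> I" for l using e that by (simp add: semi_inv_def)
  have "(\<Sum>l\<in>I. \<zeta> l *s star (M l k)) = (\<Sum>l\<in>I. star (M l k) * (\<zeta> l *s g)) * star g"
    using g by (simp add: scale_sums mult.assoc)
  also have "\<dots> = (\<Sum>l\<in>I. star (M l k) * (\<Sum>j\<in>I. \<zeta> j *s M l j)) * star g"
    using e' by (intro arg_cong2[of _ _ _ _ "(*)"] sum.cong refl) simp
  also have "\<dots> = (\<Sum>j\<in>I. \<zeta> j *s (\<Sum>l\<in>I. star (M l k) * M l j)) * star g"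
    by (intro arg_cong2[of _ _ _ _ "(*)"] refl) (simp add: scale_sums, rule sum.swap)
  also have "\<dots> = (\<Sum>j\<in>I. \<zeta> j *s (of_bool (k = j) * 1)) * star g"
    using bi_unitaryD(4)[OF U k] by (intro arg_cong2[of _ _ _ _ "(*)"] sum.cong refl) simp
  also have "\<dots> = \<zeta> k *s star g" using fin k by (simp add: sum_delta_scale scale_sums del: mult_1_right)
  finally have "star (\<Sum>l\<in>I. \<zeta> l *s star (M l k)) = star (\<zeta> k *s star g)" by simp
  then show ?thesis by (simp add: star_sum star_scale star_star)
qed

lemma semi_inv_endo:
  assumes U: "bi_unitary I M" and e: "semi_inv I M \<zeta> g" and g: "g * star g = 1"
  shows "endo I M (\<lambda>i k. \<zeta> i * cnj (\<zeta> k))"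
  unfolding endo_def
proof (intro ballI)
  fix i k assume ik: "i \<in> I" "k \<in> I"
  have "(\<Sum>j\<in>I. (\<zeta> j * cnj (\<zeta> k)) *s M i j) = cnj (\<zeta> k) *s (\<Sum>j\<in>I. \<zeta> j *s M i j)"
    by (simp add: scale_sums mult.commute)
  also have "\<dots> = \<zeta> i *s (cnj (\<zeta> k) *s g)" using e ik by (simp add: semi_inv_def mult.commute)
  also have "\<dots> = (\<Sum>j\<in>I. (\<zeta> i * cnj (\<zeta> j)) *s M j k)"
    by (simp add: semi_inv_col[OF U e g ik(2), symmetric] scale_sums)
  finally show "(\<Sum>j\<in>I. (\<zeta> j * cnj (\<zeta> k)) *s M i j) = (\<Sum>j\<in>I. (\<zeta> i * cnj (\<zeta> j)) *s M j k)" .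
qed

text \<open>Comparing entries gives \<open>w_l (M w)_i = w_i (w^T M)_l\<close>. Dividing by the
  nonzero \<open>w k\<close> exhibits \<open>h\<close>, the same for rows and for columns.\<close>

lemma rank_one_endo:
  assumes U: "bi_unitary I M" and e: "endo I M (\<lambda>i k. w i * w k)" and k: "k \<in> I" "w k \<noteq> 0"
  obtains h where "star h * h = 1" "h * star h = 1"
    "\<And>i. i \<in> I \<Longrightarrow> (\<Sum>j\<in>I. w j *s M i j) = w i *s h"
    "\<And>i. i \<in> I \<Longrightarrow> (\<Sum>j\<in>I. w j *s M j i) = w i *s h"
proof -
  define h where "h = (1 / w k) *s (\<Sum>j\<in>I. w j *s M j k)"
  have e': "w l *s (\<Sum>j\<in>I. w j *s M i j) = w i *s (\<Sum>j\<in>I. w j *s M j l)" if "i \<in> I" "l \<in> I" for i l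
    using endoD[OF e that] by (simp add: scale_sums mult.commute)
  have 1: "(\<Sum>j\<in>I. w j *s M i j) = w i *s h" if "i \<in> I" for i
  proof -
    have "(\<Sum>j\<in>I. w j *s M i j) = (1 / w k) *s (w k *s (\<Sum>j\<in>I. w j *s M i j))" using k by simp
    also have "\<dots> = w i *s h" using e'[OF that k(1)] by (simp add: h_def mult.commute)
    finally show ?thesis .
  qed
  have 2: "(\<Sum>j\<in>I. w j *s M j i) = w i *s h" if "i \<in> I" for i
  proof -
    have "w k *s (\<Sum>j\<in>I. w j *s M j i) = w i *s (w k *s h)" using e'[OF k(1) that] 1[OF k(1)] by simp
    then have "w k *s (\<Sum>j\<in>I. w j *s M j i) = w k *s (w i *s h)" by (simp add: mult.commute)
    then show ?thesis using k scale_cancel_left by blast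
  qed
  have "semi_inv I M w h" using 1 by (simp add: semi_inv_def)
  from semi_inv_unitary[OF U this k] 1 2 show ?thesis by (intro that) auto
qed

text \<open>\<open>V\<close> intertwines \<open>M\<close> and \<open>M'\<close> up to the invertible element \<open>h\<close>, in both directions:
  \<open>M V\<^sup>T = V\<^sup>T M' h\<close> and \<open>V M = M' h V\<close>, with inverse \<open>hi\<close> of \<open>h\<close>.\<close>

definition contraction :: "'i set \<Rightarrow> ('i \<Rightarrow> 'i \<Rightarrow> 'a) \<Rightarrow> 'j set \<Rightarrow> ('j \<Rightarrow> 'j \<Rightarrow> 'a) \<Rightarrow>
    ('j \<Rightarrow> 'i \<Rightarrow> complex) \<Rightarrow> 'a \<Rightarrow> 'a \<Rightarrow> bool" where
  "contraction I M I' M' V h hi \<longleftrightarrow> finite I \<and> finite I' \<and> h * hi = 1 \<and> hi * h = 1 \<and>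
    (\<forall>i\<in>I. \<forall>k\<in>I'. (\<Sum>j\<in>I. V k j *s M i j) = (\<Sum>j\<in>I'. V j i *s (M' j k * h))) \<and>
    (\<forall>i\<in>I'. \<forall>k\<in>I. (\<Sum>j\<in>I. V i j *s M j k) = (\<Sum>j\<in>I'. V j k *s (M' i j * h)))"

lemma contractionD:
  assumes "contraction I M I' M' V h hi"
  shows "i \<in> I \<Longrightarrow> k \<in> I' \<Longrightarrow> (\<Sum>j\<in>I. V k j *s M i j) = (\<Sum>j\<in>I'. V j i *s M' j k) * h"
    "a \<in> I' \<Longrightarrow> b \<in> I \<Longrightarrow> (\<Sum>j\<in>I. V a j *s M j b) = (\<Sum>j\<in>I'. V j b *s M' a j) * h"
    "i \<in> I \<Longrightarrow> k \<in> I' \<Longrightarrow> (\<Sum>j\<in>I'. V j i *s M' j k) = (\<Sum>j\<in>I. V k j *s M i j) * hi"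
    "a \<in> I' \<Longrightarrow> b \<in> I \<Longrightarrow> (\<Sum>j\<in>I'. V j b *s M' a j) = (\<Sum>j\<in>I. V a j *s M j b) * hi"
  using assms by (auto simp: contraction_def scale_sums)

text \<open>The matrix \<open>V T V^T\<close>; its companion \<open>pull_up\<close> is
  \<open>V^T S V\<close>.\<close>

definition push_down :: "'i set \<Rightarrow> ('j \<Rightarrow> 'i \<Rightarrow> complex) \<Rightarrow> ('i \<Rightarrow> 'i \<Rightarrow> complex) \<Rightarrow> 'j \<Rightarrow> 'j \<Rightarrow> complex" where
  "push_down I V T i k = (\<Sum>a\<in>I. \<Sum>b\<in>I. V i a * T a b * V k b)"

definition pull_up :: "'j set \<Rightarrow> ('j \<Rightarrow> 'i \<Rightarrow> complex) \<Rightarrow> ('j \<Rightarrow> 'j \<Rightarrow> complex) \<Rightarrow> 'i \<Rightarrow> 'i \<Rightarrow> complex" where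
  "pull_up I' V S i k = (\<Sum>a\<in>I'. \<Sum>b\<in>I'. V a i * S a b * V b k)"

text \<open>\<open>M' V T V^T = V M T V^T h^{-1} = V T M V^T h^{-1} = V T V^T M'\<close>, with the
  algebra element written at the right of each entry.\<close>

lemma contraction_push_down:
  assumes c: "contraction I M I' M' V h hi" and T: "endo I M T"
  shows "endo I' M' (push_down I V T)"
  unfolding endo_def
proof (intro ballI)
  fix i k assume ik: "i \<in> I'" "k \<in> I'"
  have "(\<Sum>j\<in>I'. push_down I V T j k *s M' i j)
      = (\<Sum>b\<in>I. V k b *s (\<Sum>a\<in>I. T a b *s (\<Sum>j\<in>I'. V j a *s M' i j)))"
  proof -
    have "(\<Sum>j\<in>I'. push_down I V T j k *s M' i j) = (\<Sum>j\<in>I'. \<Sum>b\<in>I. \<Sum>a\<in>I. (V k b * T a b * V j a) *s M' i j)"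
      by (simp add: push_down_def scale_sums mult.commute mult.left_commute)
         (rule sum.cong[OF refl], rule trans[OF sum.swap], simp only: mult_ac)
    also have "\<dots> = (\<Sum>b\<in>I. \<Sum>j\<in>I'. \<Sum>a\<in>I. (V k b * T a b * V j a) *s M' i j)" by (rule sum.swap)
    also have "\<dots> = (\<Sum>b\<in>I. V k b *s (\<Sum>a\<in>I. T a b *s (\<Sum>j\<in>I'. V j a *s M' i j)))"
      by (simp add: scale_sums mult.assoc, rule sum.cong[OF refl], rule sum.swap)
    finally show ?thesis .
  qed
  also have "\<dots> = (\<Sum>b\<in>I. V k b *s (\<Sum>a\<in>I. T a b *s ((\<Sum>j\<in>I. V i j *s M j a) * hi)))"
    using contractionD(4)[OF c ik(1)] by (intro sum.cong refl arg_cong2[of _ _ _ _ scale]) auto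
  also have "\<dots> = (\<Sum>b\<in>I. V k b *s (\<Sum>j\<in>I. V i j *s ((\<Sum>a\<in>I. T a b *s M j a) * hi)))"
  proof (rule sum.cong[OF refl], rule arg_cong2[of _ _ _ _ scale, OF refl])
    fix b
    show "(\<Sum>a\<in>I. T a b *s ((\<Sum>j\<in>I. V i j *s M j a) * hi)) = (\<Sum>j\<in>I. V i j *s ((\<Sum>a\<in>I. T a b *s M j a) * hi))"
      by (simp add: scale_sums, subst sum.swap, simp add: mult.commute)
  qed
  also have "\<dots> = (\<Sum>b\<in>I. V k b *s (\<Sum>j\<in>I. V i j *s ((\<Sum>a\<in>I. T j a *s M a b) * hi)))"
    by (simp add: endoD[OF T] cong: sum.cong)
  also have "\<dots> = (\<Sum>j\<in>I. V i j *s (\<Sum>a\<in>I. T j a *s ((\<Sum>b\<in>I. V k b *s M a b) * hi)))"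
  proof -
    have "(\<Sum>b\<in>I. V k b *s (\<Sum>j\<in>I. V i j *s ((\<Sum>a\<in>I. T j a *s M a b) * hi)))
      = (\<Sum>b\<in>I. \<Sum>j\<in>I. \<Sum>a\<in>I. (V i j * T j a * V k b) *s (M a b * hi))"
      by (simp add: scale_sums mult.commute mult.left_commute)
    also have "\<dots> = (\<Sum>j\<in>I. \<Sum>b\<in>I. \<Sum>a\<in>I. (V i j * T j a * V k b) *s (M a b * hi))" by (rule sum.swap)
    also have "\<dots> = (\<Sum>j\<in>I. V i j *s (\<Sum>a\<in>I. T j a *s ((\<Sum>b\<in>I. V k b *s M a b) * hi)))"
      by (simp add: scale_sums mult.assoc, rule sum.cong[OF refl], rule sum.swap)
    finally show ?thesis .
  qed
  also have "\<dots> = (\<Sum>j\<in>I. V i j *s (\<Sum>a\<in>I. T j a *s (\<Sum>b\<in>I'. V b a *s M' b k)))"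
    using contractionD(3)[OF c _ ik(2)] by (intro sum.cong refl arg_cong2[of _ _ _ _ scale]) auto
  also have "\<dots> = (\<Sum>b\<in>I'. push_down I V T i b *s M' b k)"
  proof -
    have "(\<Sum>j\<in>I. V i j *s (\<Sum>a\<in>I. T j a *s (\<Sum>b\<in>I'. V b a *s M' b k)))
      = (\<Sum>j\<in>I. \<Sum>b\<in>I'. \<Sum>a\<in>I. (V i j * T j a * V b a) *s M' b k)"
      by (simp add: scale_sums mult.assoc, rule sum.cong[OF refl], rule sum.swap)
    also have "\<dots> = (\<Sum>b\<in>I'. \<Sum>j\<in>I. \<Sum>a\<in>I. (V i j * T j a * V b a) *s M' b k)" by (rule sum.swap)
    finally show ?thesis by (simp add: push_down_def scale_sums)
  qed
  finally show "(\<Sum>j\<in>I'. push_down I V T j k *s M' i j) = (\<Sum>j\<in>I'. push_down I V T i j *s M' j k)" .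
qed

lemma contraction_transpose:
  assumes c: "contraction I M I' M' V h hi"
  shows "contraction I' M' I M (\<lambda>i k. V k i) hi h"
proof -
  have "(\<Sum>j\<in>I'. V j i *s M' j k) = (\<Sum>j\<in>I. V k j *s (M i j * hi))" if "i \<in> I" "k \<in> I'" for i k
    using contractionD(3)[OF c that] by (simp add: scale_sums)
  moreover have "(\<Sum>j\<in>I'. V j k *s M' i j) = (\<Sum>j\<in>I. V i j *s (M j k * hi))" if "i \<in> I'" "k \<in> I" for i k
    using contractionD(4)[OF c that] by (simp add: scale_sums)
  ultimately show ?thesis using c unfolding contraction_def by blast
qed

lemma contraction_pull_up:
  assumes "contraction I M I' M' V h hi" "endo I' M' S"
  shows "endo I M (pull_up I' V S)"
proof -
  have "pull_up I' V S = push_down I' (\<lambda>i k. V k i) S"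
    by (intro ext) (simp add: push_down_def pull_up_def)
  then show ?thesis
    using contraction_push_down[OF contraction_transpose[OF assms(1)] assms(2)] by simp
qed

text \<open>As \<open>V V^T\<close> is \<open>c\<close> times the identity, the two operations
  together only rescale, so no intertwiner of the shorter word is lost by pulling it back.\<close>

lemma push_down_pull_up:
  assumes fin: "finite I" "finite I'"
    and VV: "\<And>i j. i \<in> I' \<Longrightarrow> j \<in> I' \<Longrightarrow> (\<Sum>k\<in>I. V i k * V j k) = of_bool (i = j) * c"
    and ik: "i \<in> I'" "k \<in> I'"
  shows "push_down I V (pull_up I' V S) i k = c * c * S i k"
proof -
  have "push_down I V (pull_up I' V S) i k
    = (\<Sum>a\<in>I. \<Sum>b\<in>I. \<Sum>x\<in>I'. \<Sum>y\<in>I'. (V i a * V x a) * S x y * (V k b * V y b))"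
    unfolding push_down_def pull_up_def sum_distrib_left sum_distrib_right by (simp only: mult_ac)
  also have "\<dots> = (\<Sum>a\<in>I. \<Sum>x\<in>I'. \<Sum>b\<in>I. \<Sum>y\<in>I'. (V i a * V x a) * S x y * (V k b * V y b))"
    by (rule sum.cong[OF refl], rule sum.swap)
  also have "\<dots> = (\<Sum>x\<in>I'. \<Sum>a\<in>I. \<Sum>b\<in>I. \<Sum>y\<in>I'. (V i a * V x a) * S x y * (V k b * V y b))"
    by (rule sum.swap)
  also have "\<dots> = (\<Sum>x\<in>I'. \<Sum>a\<in>I. \<Sum>y\<in>I'. \<Sum>b\<in>I. (V i a * V x a) * S x y * (V k b * V y b))"
    by (rule sum.cong[OF refl], rule sum.cong[OF refl], rule sum.swap)
  also have "\<dots> = (\<Sum>x\<in>I'. \<Sum>y\<in>I'. \<Sum>a\<in>I. \<Sum>b\<in>I. (V i a * V x a) * S x y * (V k b * V y b))"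
    by (rule sum.cong[OF refl], rule sum.swap)
  also have "\<dots> = (\<Sum>x\<in>I'. \<Sum>y\<in>I'. (\<Sum>a\<in>I. V i a * V x a) * S x y * (\<Sum>b\<in>I. V k b * V y b))"
    by (simp add: sum_distrib_left sum_distrib_right)
       (rule sum.cong[OF refl], rule sum.cong[OF refl], rule sum.swap)
  also have "\<dots> = (\<Sum>x\<in>I'. \<Sum>y\<in>I'. (of_bool (i = x) * c) * S x y * (of_bool (k = y) * c))"
    using VV ik by (intro sum.cong refl) simp
  also have "\<dots> = (\<Sum>x\<in>I'. if i = x then c * c * S x k else 0)"
    using fin ik by (intro sum.cong refl) (auto simp: of_bool_def if_distrib[where f = "\<lambda>x. x * _"] if_distrib[where f = "\<lambda>x. _ * x"] mult_ac cong: if_cong)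
  also have "\<dots> = c * c * S i k"
    using fin ik by (simp add: of_bool_def if_distrib[where f = "\<lambda>x. x * _"] if_distrib[where f = "\<lambda>x. _ * x"] mult_ac cong: if_cong)
  finally show ?thesis .
qed

text \<open>Here the factor split off by the contraction is divided out: the shorter word realises
  \<open>g * hi\<close>.\<close>

lemma contraction_vec:
  assumes c: "contraction I M I' M' V h hi" and e: "semi_inv I M \<zeta> g"
  shows "semi_inv I' M' (\<lambda>i. \<Sum>k\<in>I. V i k * \<zeta> k) (g * hi)"
  unfolding semi_inv_def
proof
  fix i assume i: "i \<in> I'"
  have "(\<Sum>j\<in>I'. (\<Sum>k\<in>I. V j k * \<zeta> k) *s M' i j) = (\<Sum>k\<in>I. \<zeta> k *s (\<Sum>j\<in>I'. V j k *s M' i j))"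
    by (simp add: scale_sums, subst sum.swap, simp add: mult.commute)
  also have "\<dots> = (\<Sum>k\<in>I. \<zeta> k *s ((\<Sum>j\<in>I. V i j *s M j k) * hi))"
    using contractionD(4)[OF c i] by (intro sum.cong refl arg_cong2[of _ _ _ _ scale]) auto
  also have "\<dots> = (\<Sum>j\<in>I. V i j *s ((\<Sum>k\<in>I. \<zeta> k *s M j k) * hi))"
    by (simp add: scale_sums, subst sum.swap, simp add: mult.commute)
  also have "\<dots> = (\<Sum>j\<in>I. V i j *s ((\<zeta> j *s g) * hi))"
    using e by (intro sum.cong refl arg_cong2[of _ _ _ _ scale] arg_cong2[of _ _ _ _ "(*)"]) (auto simp: semi_inv_def)
  also have "\<dots> = (\<Sum>k\<in>I. V i k * \<zeta> k) *s (g * hi)" by (simp add: scale_sums)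
  finally show "(\<Sum>j\<in>I'. (\<Sum>k\<in>I. V j k * \<zeta> k) *s M' i j) = (\<Sum>k\<in>I. V i k * \<zeta> k) *s (g * hi)" .
qed

end

section \<open>Words of letters\<close>

text \<open>Matrix entries of the tensor product of the letters, in the order of the word.\<close>

primrec wprod :: "(nat \<Rightarrow> nat \<Rightarrow> 'a::ring_1) list \<Rightarrow> nat list \<Rightarrow> nat list \<Rightarrow> 'a" where
  "wprod [] is js = 1"
| "wprod (U # Us) is js = U (hd is) (hd js) * wprod Us (tl is) (tl js)"

lemma wprod_append:
  assumes "length is = length Us" "length js = length Us"
  shows "wprod (Us @ Vs) (is @ is') (js @ js') = wprod Us is js * wprod Vs is' js'"
  using assms
proof (induction Us arbitrary: "is" js)
  case (Cons U Us)
  then obtain i is1 j js1 where "is = i # is1" "js = j # js1" by (metis length_Suc_conv)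
  then show ?case using Cons by (simp add: mult.assoc)
qed simp

definition conj_letter :: "'a::ring_1 \<Rightarrow> 'a \<Rightarrow> (nat \<Rightarrow> nat \<Rightarrow> 'a) \<Rightarrow> nat \<Rightarrow> nat \<Rightarrow> 'a" where
  "conj_letter h hi U i j = h * U i j * hi"

text \<open>Between consecutive conjugated letters \<open>hi * h\<close> cancels, and only the
  outermost \<open>h\<close> is left.\<close>

lemma wprod_conj:
  assumes "hi * h = 1"
  shows "wprod (map (conj_letter h hi) Us) is js * h = h * wprod Us is js"
proof (induction Us arbitrary: "is" js)
  case (Cons U Us)
  have "wprod (map (conj_letter h hi) (U # Us)) is js * h
      = h * U (hd is) (hd js) * hi * (wprod (map (conj_letter h hi) Us) (tl is) (tl js) * h)"
    by (simp add: conj_letter_def mult.assoc)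
  also have "\<dots> = h * U (hd is) (hd js) * (hi * h) * wprod Us (tl is) (tl js)"
    unfolding Cons.IH by (simp only: mult.assoc)
  finally show ?case using assms by (simp add: mult.assoc)
qed simp

definition sum_at :: "nat \<Rightarrow> nat \<Rightarrow> (nat list \<Rightarrow> complex) \<Rightarrow> nat list \<Rightarrow> complex" where
  "sum_at N p \<phi> zs = (\<Sum>k<N. \<phi> (take p zs @ k # drop p zs))"

definition merge_at :: "nat \<Rightarrow> (nat list \<Rightarrow> complex) \<Rightarrow> nat list \<Rightarrow> complex" where
  "merge_at p \<phi> zs = \<phi> (take p zs @ zs ! p # zs ! p # drop (Suc p) zs)"

lemma nc_multiple_agrees:
  "nc_labelling n f \<Longrightarrow> nc_multiple TYPE('l) N n (\<lambda>zs. of_bool (agrees (f :: nat \<Rightarrow> 'l) zs))"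
  unfolding nc_multiple_def by (intro exI[of _ 1] exI[of _ f]) simp

lemma nc_multiple_cong:
  assumes "\<And>zs. zs \<in> idx N n \<Longrightarrow> \<phi> zs = \<psi> zs"
  shows "nc_multiple TYPE('l) N n \<phi> \<longleftrightarrow> nc_multiple TYPE('l) N n \<psi>"
  unfolding nc_multiple_def using assms by auto

text \<open>\<open>id\<^sup>\<otimes>\<^sup>p \<otimes> v \<otimes> id\<close> for \<open>v\<close> mapping \<open>a\<close> tensor factors to \<open>b\<close> tensor factors.\<close>

definition graft :: "nat \<Rightarrow> nat \<Rightarrow> nat \<Rightarrow> (nat list \<Rightarrow> nat list \<Rightarrow> complex) \<Rightarrow> nat list \<Rightarrow> nat list \<Rightarrow> complex" where
  "graft p a b v r c = of_bool (take p r = take p c \<and> drop (p + b) r = drop (p + a) c) *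
     v (take b (drop p r)) (take a (drop p c))"

lemma graft_append:
  assumes "length r1 = p" "length c1 = p" "length y = b" "length x = a"
  shows "graft p a b v (r1 @ y @ r2) (c1 @ x @ c2) = of_bool (r1 = c1 \<and> r2 = c2) * v y x"
  using assms by (simp add: graft_def)

lemma sum_idx_add3:
  "(\<Sum>j\<in>idx N (p + (a + q)). F j) = (\<Sum>c1\<in>idx N p. \<Sum>x\<in>idx N a. \<Sum>c2\<in>idx N q. F (c1 @ x @ c2))"
  by (simp add: sum_idx_add)

lemma idx_add3E:
  assumes "j \<in> idx N (p + (a + q))"
  obtains c1 x c2 where "j = c1 @ x @ c2" "c1 \<in> idx N p" "x \<in> idx N a" "c2 \<in> idx N q"
  using assms by (metis idx_addE)

lemma idx_append3: "c1 \<in> idx N p \<Longrightarrow> x \<in> idx N a \<Longrightarrow> c2 \<in> idx N q \<Longrightarrow> c1 @ x @ c2 \<in> idx N (p + (a + q))"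
  by (intro idx_append)

text \<open>\<open>\<phi>\<close> is left open so as to cover scalar multiplication in the algebra
  and multiplication of numbers at once.\<close>

lemma sum_graft_col:
  fixes \<phi> :: "complex \<Rightarrow> 'b \<Rightarrow> 'c::comm_monoid_add"
  assumes \<phi>: "\<And>x. \<phi> 0 x = 0" and r: "r1 \<in> idx N p" "y \<in> idx N b" "r2 \<in> idx N q"
  shows "(\<Sum>j\<in>idx N (p + (a + q)). \<phi> (graft p a b v (r1 @ y @ r2) j) (G j))
    = (\<Sum>x\<in>idx N a. \<phi> (v y x) (G (r1 @ x @ r2)))"
proof -
  have "(\<Sum>j\<in>idx N (p + (a + q)). \<phi> (graft p a b v (r1 @ y @ r2) j) (G j))
    = (\<Sum>c1\<in>idx N p. \<Sum>x\<in>idx N a. \<Sum>c2\<in>idx N q.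
         if c2 = r2 then (if c1 = r1 then \<phi> (v y x) (G (c1 @ x @ c2)) else 0) else 0)"
    unfolding sum_idx_add3
    using r \<phi> by (intro sum.cong refl) (auto simp: graft_append idx_length)
  also have "\<dots> = (\<Sum>c1\<in>idx N p. if c1 = r1 then \<Sum>x\<in>idx N a. \<phi> (v y x) (G (c1 @ x @ r2)) else 0)"
    using r by (intro sum.cong refl) simp
  also have "\<dots> = (\<Sum>x\<in>idx N a. \<phi> (v y x) (G (r1 @ x @ r2)))"
    using r by simp
  finally show ?thesis .
qed

lemma sum_graft_row:
  fixes \<phi> :: "complex \<Rightarrow> 'b \<Rightarrow> 'c::comm_monoid_add"
  assumes \<phi>: "\<And>x. \<phi> 0 x = 0" and c: "c1 \<in> idx N p" "x \<in> idx N a" "c2 \<in> idx N q"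
  shows "(\<Sum>j\<in>idx N (p + (b + q)). \<phi> (graft p a b v j (c1 @ x @ c2)) (G j))
    = (\<Sum>y\<in>idx N b. \<phi> (v y x) (G (c1 @ y @ c2)))"
proof -
  have "(\<Sum>j\<in>idx N (p + (b + q)). \<phi> (graft p a b v j (c1 @ x @ c2)) (G j))
    = (\<Sum>r1\<in>idx N p. \<Sum>y\<in>idx N b. \<Sum>r2\<in>idx N q.
         if r2 = c2 then (if r1 = c1 then \<phi> (v y x) (G (r1 @ y @ r2)) else 0) else 0)"
    unfolding sum_idx_add3
    using c \<phi> by (intro sum.cong refl) (auto simp: graft_append idx_length)
  also have "\<dots> = (\<Sum>r1\<in>idx N p. if r1 = c1 then \<Sum>y\<in>idx N b. \<phi> (v y x) (G (r1 @ y @ c2)) else 0)"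
    using c by (intro sum.cong refl) simp
  also have "\<dots> = (\<Sum>y\<in>idx N b. \<phi> (v y x) (G (c1 @ y @ c2)))"
    using c by simp
  finally show ?thesis .
qed

text \<open>A sum of truth values is a natural number, so one true instance excludes
  cancellation.\<close>

lemma sum_of_bool_nonzero:
  assumes "finite A" "finite B" "finite C" "a \<in> A" "b \<in> B" "c \<in> C" "P a b c"
  shows "(\<Sum>x\<in>A. \<Sum>y\<in>B. \<Sum>z\<in>C. of_bool (P x y z) :: complex) \<noteq> 0"
proof -
  have "(\<Sum>x\<in>A. \<Sum>y\<in>B. \<Sum>z\<in>C. of_bool (P x y z) :: complex)
     = of_nat (\<Sum>x\<in>A. \<Sum>y\<in>B. \<Sum>z\<in>C. of_bool (P x y z))" by (simp only: of_nat_sum of_nat_of_bool)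
  moreover have "(\<Sum>x\<in>A. \<Sum>y\<in>B. \<Sum>z\<in>C. of_bool (P x y z)) \<noteq> (0::nat)"
    using assms by (auto simp: sum_eq_0_iff)
  ultimately show ?thesis by (simp only: of_nat_eq_0_iff not_False_eq_True)
qed

context complex_star_algebra
begin

lemma bi_unitary_conj_letter:
  assumes U: "bi_unitary I U" and h: "star h * h = 1" "h * star h = 1"
  shows "bi_unitary I (conj_letter h (star h) U)"
proof -
  have a: "x * star h * (h * y) = x * y" "x * h * (star h * y) = x * y" for x y
    using h by (metis mult.assoc mult_1_right)+
  have s: "star (conj_letter h (star h) U i j) = h * star (U i j) * star h" for i j
    by (simp add: conj_letter_def star_mult star_star mult.assoc)
  have m: "(\<Sum>k\<in>I. h * X k * star h * (h * Y k * star h)) = h * (\<Sum>k\<in>I. X k * Y k) * star h" for X Y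
  proof -
    have "h * X k * star h * (h * Y k * star h) = h * (X k * Y k) * star h" for k
      using a(1)[of "h * X k" "Y k * star h"] by (simp add: mult.assoc)
    then show ?thesis by (simp add: sum_distrib_left sum_distrib_right)
  qed
  show ?thesis
    unfolding bi_unitary_def
  proof (intro conjI ballI bi_unitary_finite[OF U])
    fix i j assume ij: "i \<in> I" "j \<in> I"
    show "(\<Sum>k\<in>I. conj_letter h (star h) U i k * star (conj_letter h (star h) U j k)) = of_bool (i = j)"
      "(\<Sum>k\<in>I. star (conj_letter h (star h) U i k) * conj_letter h (star h) U j k) = of_bool (i = j)"
      "(\<Sum>k\<in>I. conj_letter h (star h) U k i * star (conj_letter h (star h) U k j)) = of_bool (i = j)"
      "(\<Sum>k\<in>I. star (conj_letter h (star h) U k i) * conj_letter h (star h) U k j) = of_bool (i = j)"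
      unfolding s unfolding conj_letter_def m bi_unitaryD[OF U ij] using h by auto
  qed
qed

text \<open>In \<open>wprod * star wprod\<close> the last letters meet in the middle, so the tail is
  summed first. In the opposite order the first letters meet, which is why two of the four cases
  exchange the sums.\<close>

lemma bi_unitary_wprod:
  assumes "\<And>U. U \<in> set Us \<Longrightarrow> bi_unitary {..<N} U"
  shows "bi_unitary (idx N (length Us)) (wprod Us)"
  using assms
proof (induction Us)
  case (Cons U Us)
  have U: "bi_unitary {..<N} U" and W: "bi_unitary (idx N (length Us)) (wprod Us)" using Cons by auto
  let ?J = "idx N (length Us)"
  show ?case
    unfolding bi_unitary_def
  proof (intro conjI ballI)
    show "finite (idx N (length (U # Us)))" by simp
    fix "is" js assume "is \<in> idx N (length (U # Us))" "js \<in> idx N (length (U # Us))"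
    then obtain i is' j js' where *: "is = i # is'" "js = j # js'" "i < N" "j < N" "is' \<in> ?J" "js' \<in> ?J"
      by (metis idx_SucE length_Cons)
    have e: "of_bool (is = js) = (of_bool (i = j) * of_bool (is' = js') :: 'a)" using * by auto
    have "(\<Sum>k\<in>idx N (length (U # Us)). wprod (U # Us) is k * star (wprod (U # Us) js k))
      = (\<Sum>k<N. U i k * (\<Sum>ks\<in>?J. wprod Us is' ks * star (wprod Us js' ks)) * star (U j k))"
      by (simp add: sum_idx_Suc * star_mult sum_distrib_left sum_distrib_right mult.assoc)
    then show "(\<Sum>k\<in>idx N (length (U # Us)). wprod (U # Us) is k * star (wprod (U # Us) js k)) = of_bool (is = js)"
      unfolding bi_unitaryD[OF W *(5,6)] e using bi_unitaryD(1)[OF U, of i j] * by (auto simp: of_bool_def)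
    have "(\<Sum>k\<in>idx N (length (U # Us)). wprod (U # Us) k is * star (wprod (U # Us) k js))
      = (\<Sum>k<N. U k i * (\<Sum>ks\<in>?J. wprod Us ks is' * star (wprod Us ks js')) * star (U k j))"
      by (simp add: sum_idx_Suc * star_mult sum_distrib_left sum_distrib_right mult.assoc)
    then show "(\<Sum>k\<in>idx N (length (U # Us)). wprod (U # Us) k is * star (wprod (U # Us) k js)) = of_bool (is = js)"
      unfolding bi_unitaryD[OF W *(5,6)] e using bi_unitaryD(3)[OF U, of i j] * by (auto simp: of_bool_def)
    have "(\<Sum>k\<in>idx N (length (U # Us)). star (wprod (U # Us) is k) * wprod (U # Us) js k)
      = (\<Sum>ks\<in>?J. star (wprod Us is' ks) * (\<Sum>k<N. star (U i k) * U j k) * wprod Us js' ks)"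
      by (simp add: sum_idx_Suc * star_mult sum_distrib_left sum_distrib_right mult.assoc) (rule sum.swap)
    also have "\<dots> = (\<Sum>ks\<in>?J. of_bool (i = j) * (star (wprod Us is' ks) * wprod Us js' ks))"
      using bi_unitaryD(2)[OF U, of i j] * by simp
    finally show "(\<Sum>k\<in>idx N (length (U # Us)). star (wprod (U # Us) is k) * wprod (U # Us) js k) = of_bool (is = js)"
      unfolding sum_distrib_left[symmetric] bi_unitaryD[OF W *(5,6)] e .
    have "(\<Sum>k\<in>idx N (length (U # Us)). star (wprod (U # Us) k is) * wprod (U # Us) k js)
      = (\<Sum>ks\<in>?J. star (wprod Us ks is') * (\<Sum>k<N. star (U k i) * U k j) * wprod Us ks js')"
      by (simp add: sum_idx_Suc * star_mult sum_distrib_left sum_distrib_right mult.assoc) (rule sum.swap)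
    also have "\<dots> = (\<Sum>ks\<in>?J. of_bool (i = j) * (star (wprod Us ks is') * wprod Us ks js'))"
      using bi_unitaryD(4)[OF U, of i j] * by simp
    finally show "(\<Sum>k\<in>idx N (length (U # Us)). star (wprod (U # Us) k is) * wprod (U # Us) k js) = of_bool (is = js)"
      unfolding sum_distrib_left[symmetric] bi_unitaryD[OF W *(5,6)] e .
  qed
qed (simp add: bi_unitary_def)

text \<open>The vanishing products allow one index to be doubled: the sum over \<open>k\<close>
  equals a double sum over \<open>k\<close> and \<open>l\<close>, in which first the inner and then
  the outer pair is removed by unitarity.\<close>

lemma bi_unitary_merge:
  fixes N :: nat and U W :: "nat \<Rightarrow> nat \<Rightarrow> 'a"
  assumes U: "bi_unitary {..<N} U" and W: "bi_unitary {..<N} W"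
    and z1: "\<And>i j k. i < N \<Longrightarrow> j < N \<Longrightarrow> k < N \<Longrightarrow> i \<noteq> j \<Longrightarrow> U i k * W j k = 0"
    and z2: "\<And>i k l. i < N \<Longrightarrow> k < N \<Longrightarrow> l < N \<Longrightarrow> k \<noteq> l \<Longrightarrow> U i k * W i l = 0"
  shows "bi_unitary {..<N} (\<lambda>i j. U i j * W i j)"
  unfolding bi_unitary_def
proof (intro conjI ballI)
  fix i j assume "i \<in> {..<N}" "j \<in> {..<N}"
  then have ij: "i < N" "j < N" "i \<in> {..<N}" "j \<in> {..<N}" by auto
  have single: "(\<Sum>l<N. X l) = X k" if "k < N" "\<And>l. l < N \<Longrightarrow> l \<noteq> k \<Longrightarrow> X l = 0" for X :: "nat \<Rightarrow> 'a" and k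
    using that by (simp add: sum.remove[of _ k])
  have "(\<Sum>k<N. U i k * W i k * star (U j k * W j k)) = (\<Sum>k<N. \<Sum>l<N. U i k * W i l * (star (W j l) * star (U j k)))"
  proof (rule sum.cong[OF refl])
    fix k assume "k \<in> {..<N}"
    then show "U i k * W i k * star (U j k * W j k) = (\<Sum>l<N. U i k * W i l * (star (W j l) * star (U j k)))"
      using z2[of i k] ij by (subst single[of k]) (auto simp: star_mult)
  qed
  also have "\<dots> = (\<Sum>k<N. U i k * (\<Sum>l<N. W i l * star (W j l)) * star (U j k))"
    by (simp add: scale_sums)
  finally show "(\<Sum>k<N. U i k * W i k * star (U j k * W j k)) = of_bool (i = j)"
    unfolding bi_unitaryD[OF W ij(3,4)] using bi_unitaryD(1)[OF U ij(3,4)] by (auto simp: of_bool_def)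
  have "(\<Sum>k<N. U k i * W k i * star (U k j * W k j)) = (\<Sum>k<N. \<Sum>l<N. U k i * W l i * (star (W l j) * star (U k j)))"
  proof (rule sum.cong[OF refl])
    fix k assume "k \<in> {..<N}"
    then show "U k i * W k i * star (U k j * W k j) = (\<Sum>l<N. U k i * W l i * (star (W l j) * star (U k j)))"
      using z1[of k _ i] ij by (subst single[of k]) (auto simp: star_mult)
  qed
  also have "\<dots> = (\<Sum>k<N. U k i * (\<Sum>l<N. W l i * star (W l j)) * star (U k j))"
    by (simp add: scale_sums)
  finally show "(\<Sum>k<N. U k i * W k i * star (U k j * W k j)) = of_bool (i = j)"
    unfolding bi_unitaryD[OF W ij(3,4)] using bi_unitaryD(3)[OF U ij(3,4)] by (auto simp: of_bool_def)
  have "(\<Sum>k<N. star (U i k * W i k) * (U j k * W j k)) = (\<Sum>k<N. \<Sum>l<N. star (W i k) * (star (U i l) * (U j l * W j k)))"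
  proof (rule sum.cong[OF refl])
    fix k assume "k \<in> {..<N}"
    then show "star (U i k * W i k) * (U j k * W j k) = (\<Sum>l<N. star (W i k) * (star (U i l) * (U j l * W j k)))"
      using z2[of j _ k] ij by (subst single[of k]) (auto simp: star_mult mult.assoc)
  qed
  also have "\<dots> = (\<Sum>k<N. star (W i k) * (\<Sum>l<N. star (U i l) * U j l) * W j k)"
    by (simp add: scale_sums)
  finally show "(\<Sum>k<N. star (U i k * W i k) * (U j k * W j k)) = of_bool (i = j)"
    unfolding bi_unitaryD[OF U ij(3,4)] using bi_unitaryD(2)[OF W ij(3,4)] by (auto simp: of_bool_def)
  have "(\<Sum>k<N. star (U k i * W k i) * (U k j * W k j)) = (\<Sum>k<N. \<Sum>l<N. star (W k i) * (star (U l i) * (U l j * W k j)))"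
  proof (rule sum.cong[OF refl])
    fix k assume "k \<in> {..<N}"
    then show "star (U k i * W k i) * (U k j * W k j) = (\<Sum>l<N. star (W k i) * (star (U l i) * (U l j * W k j)))"
      using z1[of _ k j] ij by (subst single[of k]) (auto simp: star_mult mult.assoc)
  qed
  also have "\<dots> = (\<Sum>k<N. star (W k i) * (\<Sum>l<N. star (U l i) * U l j) * W k j)"
    by (simp add: scale_sums)
  finally show "(\<Sum>k<N. star (U k i * W k i) * (U k j * W k j)) = of_bool (i = j)"
    unfolding bi_unitaryD[OF U ij(3,4)] using bi_unitaryD(4)[OF W ij(3,4)] by (auto simp: of_bool_def)
qed simp

lemma endo_wprod_append:
  assumes e: "endo (idx N (length Us + length Vs)) (wprod (Us @ Vs)) T"
    and "i \<in> idx N (length Us)" "j \<in> idx N (length Vs)" "c \<in> idx N (length Us)" "l \<in> idx N (length Vs)"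
  shows "(\<Sum>a\<in>idx N (length Us). \<Sum>b\<in>idx N (length Vs). T (a @ b) (c @ l) *s (wprod Us i a * wprod Vs j b))
    = (\<Sum>a\<in>idx N (length Us). \<Sum>b\<in>idx N (length Vs). T (i @ j) (a @ b) *s (wprod Us a c * wprod Vs b l))"
proof -
  have "(\<Sum>a\<in>idx N (length Us). \<Sum>b\<in>idx N (length Vs). T (a @ b) (c @ l) *s wprod (Us @ Vs) (i @ j) (a @ b))
    = (\<Sum>a\<in>idx N (length Us). \<Sum>b\<in>idx N (length Vs). T (i @ j) (a @ b) *s wprod (Us @ Vs) (a @ b) (c @ l))"
    using endoD[OF e, of "i @ j" "c @ l"] assms(2-) by (simp add: idx_append sum_idx_add)
  moreover have "wprod (Us @ Vs) (x @ y) (x' @ y') = wprod Us x x' * wprod Vs y y'"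
    if "x \<in> idx N (length Us)" "x' \<in> idx N (length Us)" for x y x' y'
    using that by (intro wprod_append) (auto simp: idx_length)
  ultimately show ?thesis using assms(2-) by simp
qed

text \<open>The letters to the left are traced out first, then those to the right.\<close>

lemma endo_middle:
  assumes bi_unitary: "\<And>U. U \<in> set (Us1 @ Ms @ Us2) \<Longrightarrow> bi_unitary {..<N} U"
    and l: "length Us1 = p" "length Ms = a" "length Us2 = q"
    and e: "endo (idx N (p + (a + q))) (wprod (Us1 @ Ms @ Us2)) T"
  shows "endo (idx N a) (wprod Ms) (\<lambda>x x'. \<Sum>c2\<in>idx N q. \<Sum>c1\<in>idx N p. T (c1 @ x @ c2) (c1 @ x' @ c2))"
proof -
  define T' where "T' r c = (\<Sum>c1\<in>idx N p. T (c1 @ r) (c1 @ c))" for r c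
  have U1: "bi_unitary (idx N p) (wprod Us1)" and U2: "bi_unitary (idx N q) (wprod Us2)"
    using bi_unitary_wprod[of Us1 N] bi_unitary_wprod[of Us2 N] bi_unitary l by auto
  have e': "endo (idx N (a + q)) (wprod (Ms @ Us2)) T'"
    unfolding endo_def T'_def
    using endo_wprod_append[of N Us1 "Ms @ Us2" T] e l
    by (intro ballI left_trace[OF U1, where T = "\<lambda>a b c l. T (a @ b) (c @ l)"]) auto
  have "endo (idx N a) (wprod Ms) (\<lambda>x x'. \<Sum>c2\<in>idx N q. T' (x @ c2) (x' @ c2))"
    unfolding endo_def
    using endo_wprod_append[of N Ms Us2 T'] e' l
    by (intro ballI right_trace[OF U2, where T = "\<lambda>a b c l. T' (a @ b) (c @ l)"]) auto
  then show ?thesis by (simp add: T'_def)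
qed

text \<open>The sum over \<open>s\<close> composes the map with its adjoint. The resulting entries
  are counts of admissible indices, so a trace of them cannot vanish by cancellation.\<close>

lemma endo_part_op_traced:
  assumes bi_unitary: "\<And>U. U \<in> set (Us1 @ Ms @ Us2) \<Longrightarrow> bi_unitary {..<N} U"
    and l: "length Us1 = p" "length Ms = a" "length Us2 = q"
    and e: "endo (idx N (p + (a + q))) (wprod (Us1 @ Ms @ Us2)) (part_op f)"
  shows "endo (idx N a) (wprod Ms) (\<lambda>x x'. \<Sum>c2\<in>idx N q. \<Sum>c1\<in>idx N p. \<Sum>s\<in>idx N (p + (a + q)).
      part_op f s (c1 @ x @ c2) * part_op f s (c1 @ x' @ c2))"
proof (rule endo_middle[OF bi_unitary l])
  have U: "bi_unitary (idx N (p + (a + q))) (wprod (Us1 @ Ms @ Us2))"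
    using bi_unitary_wprod[of "Us1 @ Ms @ Us2" N] bi_unitary l by simp
  have "cnj (part_op f i j) = part_op f i j" for i j by (simp add: part_op_def)
  then show "endo (idx N (p + (a + q))) (wprod (Us1 @ Ms @ Us2))
     (\<lambda>r c. \<Sum>s\<in>idx N (p + (a + q)). part_op f s r * part_op f s c)"
    using endo_mult[OF endo_adjoint[OF U e] e] by simp
qed

text \<open>The hypothesis on the category, recast as a property of one word so that words in other
  letters can inherit it. Each \<open>f\<close> has to give an intertwiner by itself, because the
  reduction works with one partition at a time. The type argument fixes the type of labels
  throughout an induction.\<close>

definition spanned :: "'l itself \<Rightarrow> nat \<Rightarrow> (nat \<Rightarrow> nat \<Rightarrow> 'a) list \<Rightarrow> bool" where
  "spanned _ N Us \<longleftrightarrow> (\<forall>T. endo (idx N (length Us)) (wprod Us) T \<longrightarrow>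
     (\<exists>qs :: (complex \<times> (nat \<Rightarrow> 'l)) list.
        (\<forall>(\<kappa>, f)\<in>set qs. nc_labelling (2 * length Us) f \<and> endo (idx N (length Us)) (wprod Us) (part_op f)) \<and>
        (\<forall>r\<in>idx N (length Us). \<forall>c\<in>idx N (length Us). T r c = (\<Sum>(\<kappa>, f)\<leftarrow>qs. \<kappa> * part_op f r c))))"

lemma spannedE:
  assumes "spanned TYPE('l) N Us" "endo (idx N (length Us)) (wprod Us) T"
  obtains qs :: "(complex \<times> (nat \<Rightarrow> 'l)) list" where
    "\<And>\<kappa> f. (\<kappa>, f) \<in> set qs \<Longrightarrow> nc_labelling (2 * length Us) f"
    "\<And>\<kappa> f. (\<kappa>, f) \<in> set qs \<Longrightarrow> endo (idx N (length Us)) (wprod Us) (part_op f)"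
    "\<And>r c. r \<in> idx N (length Us) \<Longrightarrow> c \<in> idx N (length Us) \<Longrightarrow> T r c = (\<Sum>(\<kappa>, f)\<leftarrow>qs. \<kappa> * part_op f r c)"
proof -
  obtain qs :: "(complex \<times> (nat \<Rightarrow> 'l)) list" where
    A: "\<forall>(\<kappa>, f)\<in>set qs. nc_labelling (2 * length Us) f \<and> endo (idx N (length Us)) (wprod Us) (part_op f)"
    and B: "\<forall>r\<in>idx N (length Us). \<forall>c\<in>idx N (length Us). T r c = (\<Sum>(\<kappa>, f)\<leftarrow>qs. \<kappa> * part_op f r c)"
    using assms unfolding spanned_def by blast
  show thesis by (rule that[of qs]) (use A B in auto)
qed

lemma push_down_sum_list:
  "push_down I V (\<lambda>r c. \<Sum>(\<kappa>, f)\<leftarrow>qs. \<kappa> * P f r c) i k = (\<Sum>(\<kappa>, f)\<leftarrow>qs. \<kappa> * push_down I V (P f) i k)"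
proof (induction qs)
  case (Cons q qs)
  obtain \<kappa> f where q: "q = (\<kappa>, f)" by (cases q)
  have "push_down I V (\<lambda>r c. \<kappa> * P f r c + X r c) i k = \<kappa> * push_down I V (P f) i k + push_down I V X i k" for X
    by (simp add: push_down_def algebra_simps sum.distrib sum_distrib_left)
  then show ?case using Cons by (simp add: q)
qed (simp add: push_down_def)

text \<open>Expand the pulled back \<open>S\<close> and push every term down again; this recovers
  \<open>c * c\<close> times \<open>S\<close>. A partition map pushed down is a nonzero multiple of
  a partition map, so the latter is again an intertwiner.\<close>

lemma spanned_contraction:
  assumes c: "contraction (idx N (length Us)) (wprod Us) (idx N (length Us')) (wprod Us') V h hi"
    and VV: "\<And>i j. i \<in> idx N (length Us') \<Longrightarrow> j \<in> idx N (length Us') \<Longrightarrow>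
        (\<Sum>k\<in>idx N (length Us). V i k * V j k) = of_bool (i = j) * c" and c0: "c \<noteq> 0"
    and nc: "\<And>f :: nat \<Rightarrow> 'l. nc_labelling (2 * length Us) f \<Longrightarrow> nc_multiple TYPE('l) N (2 * length Us')
        (\<lambda>zs. push_down (idx N (length Us)) V (part_op f) (rev (drop (length Us') zs)) (take (length Us') zs))"
    and sp: "spanned TYPE('l) N Us"
  shows "spanned TYPE('l) N Us'"
  unfolding spanned_def
proof (intro allI impI)
  let ?I = "idx N (length Us)" and ?J = "idx N (length Us')"
  fix S assume S: "endo ?J (wprod Us') S"
  have "endo ?I (wprod Us) (pull_up ?J V S)" by (rule contraction_pull_up[OF c S])
  then obtain qs :: "(complex \<times> (nat \<Rightarrow> 'l)) list" where
    qs1: "\<And>\<kappa> f. (\<kappa>, f) \<in> set qs \<Longrightarrow> nc_labelling (2 * length Us) f"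
    and qs2: "\<And>\<kappa> f. (\<kappa>, f) \<in> set qs \<Longrightarrow> endo ?I (wprod Us) (part_op f)"
    and sum: "\<And>r c. r \<in> ?I \<Longrightarrow> c \<in> ?I \<Longrightarrow> pull_up ?J V S r c = (\<Sum>(\<kappa>, f)\<leftarrow>qs. \<kappa> * part_op f r c)"
    using spannedE[OF sp] by blast
  have qs: "nc_labelling (2 * length Us) f \<and> endo ?I (wprod Us) (part_op f)" if "(\<kappa>, f) \<in> set qs" for \<kappa> f
    using qs1 qs2 that by blast
  have ex: "\<exists>q. fst q \<noteq> 0 \<and> nc_labelling (2 * length Us') (snd q) \<and>
     (\<forall>r\<in>?J. \<forall>c\<in>?J. push_down ?I V (part_op f) r c = fst q * part_op (snd q :: nat \<Rightarrow> 'l) r c)"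
    if f: "nc_labelling (2 * length Us) f" for f :: "nat \<Rightarrow> 'l"
  proof -
    obtain \<kappa>' and f' :: "nat \<Rightarrow> 'l" where f': "\<kappa>' \<noteq> 0" "nc_labelling (2 * length Us') f'"
      "\<And>zs. zs \<in> idx N (2 * length Us') \<Longrightarrow>
        push_down ?I V (part_op f) (rev (drop (length Us') zs)) (take (length Us') zs) = \<kappa>' * of_bool (agrees f' zs)"
      using nc[OF f] by (auto simp: nc_multiple_def)
    have "push_down ?I V (part_op f) r c = \<kappa>' * part_op f' r c" if "r \<in> ?J" "c \<in> ?J" for r c
      using f'(3)[of "c @ rev r"] idx_append[OF that(2) idx_rev[OF that(1)]] that
      by (simp add: idx_length part_op_def mult_2)
    with f' show ?thesis by (intro exI[of _ "(\<kappa>', f')"]) simp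
  qed
  have "\<forall>f :: nat \<Rightarrow> 'l. \<exists>q. nc_labelling (2 * length Us) f \<longrightarrow> fst q \<noteq> 0 \<and> nc_labelling (2 * length Us') (snd q) \<and>
     (\<forall>r\<in>?J. \<forall>c\<in>?J. push_down ?I V (part_op f) r c = fst q * part_op (snd q :: nat \<Rightarrow> 'l) r c)"
    using ex by blast
  then have "\<exists>G. \<forall>f :: nat \<Rightarrow> 'l. nc_labelling (2 * length Us) f \<longrightarrow> fst (G f) \<noteq> 0 \<and> nc_labelling (2 * length Us') (snd (G f)) \<and>
     (\<forall>r\<in>?J. \<forall>c\<in>?J. push_down ?I V (part_op f) r c = fst (G f) * part_op (snd (G f) :: nat \<Rightarrow> 'l) r c)"
    by (rule choice)
  then obtain G where G: "\<forall>f :: nat \<Rightarrow> 'l. nc_labelling (2 * length Us) f \<longrightarrow> fst (G f) \<noteq> 0 \<and> nc_labelling (2 * length Us') (snd (G f)) \<and>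
     (\<forall>r\<in>?J. \<forall>c\<in>?J. push_down ?I V (part_op f) r c = fst (G f) * part_op (snd (G f) :: nat \<Rightarrow> 'l) r c)"
    by (rule exE)
  define \<mu> F where "\<mu> f = fst (G f)" and "F f = snd (G f)" for f
  have F: "\<mu> f \<noteq> 0" "nc_labelling (2 * length Us') (F f)"
     "r \<in> ?J \<Longrightarrow> k \<in> ?J \<Longrightarrow> push_down ?I V (part_op f) r k = \<mu> f * part_op (F f) r k"
    if "nc_labelling (2 * length Us) f" for f r k
    using G that by (simp_all add: \<mu>_def F_def)
  \<comment> \<open>\<open>\<mu> f\<close> is the factor arising when \<open>f\<close> is pushed
    down, and \<open>c * c\<close> comes from pushing down what was pulled up.\<close>
  define qs' where "qs' = map (\<lambda>(\<kappa>, f). (\<kappa> * \<mu> f / (c * c), F f)) qs"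
  show "\<exists>qs :: (complex \<times> (nat \<Rightarrow> 'l)) list.
        (\<forall>(\<kappa>, f)\<in>set qs. nc_labelling (2 * length Us') f \<and> endo ?J (wprod Us') (part_op f)) \<and>
        (\<forall>r\<in>?J. \<forall>c\<in>?J. S r c = (\<Sum>(\<kappa>, f)\<leftarrow>qs. \<kappa> * part_op f r c))"
  proof (intro exI[of _ qs'] conjI ballI)
    fix q assume "q \<in> set qs'"
    then obtain \<kappa> f where f: "(\<kappa>, f) \<in> set qs" "q = (\<kappa> * \<mu> f / (c * c), F f)"
      by (auto simp: qs'_def)
    have "endo ?J (wprod Us') (push_down ?I V (part_op f))"
      using contraction_push_down[OF c] qs[OF f(1)] by blast
    then have "endo ?J (wprod Us') (\<lambda>r c. \<mu> f * part_op (F f) r c)"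
      using F qs[OF f(1)] by (subst endo_cong[where T = "push_down ?I V (part_op f)"]) auto
    then have "endo ?J (wprod Us') (part_op (F f))"
      using endo_scale F qs[OF f(1)] by blast
    then show "case q of (\<kappa>, f) \<Rightarrow> nc_labelling (2 * length Us') f \<and> endo ?J (wprod Us') (part_op f)"
      using F qs[OF f(1)] f by simp
  next
    fix r k assume rk: "r \<in> ?J" "k \<in> ?J"
    have "c * c * S r k = push_down ?I V (pull_up ?J V S) r k"
      using push_down_pull_up[of ?I ?J V c r k S] VV rk by simp
    also have "\<dots> = push_down ?I V (\<lambda>r c. \<Sum>(\<kappa>, f)\<leftarrow>qs. \<kappa> * part_op f r c) r k"
      unfolding push_down_def by (intro sum.cong refl) (simp add: sum)
    also have "\<dots> = (\<Sum>(\<kappa>, f)\<leftarrow>qs. \<kappa> * push_down ?I V (part_op f) r k)" by (rule push_down_sum_list)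
    also have "\<dots> = (\<Sum>(\<kappa>, f)\<leftarrow>qs. (c * c) * (\<kappa> * \<mu> f / (c * c) * part_op (F f) r k))"
    proof (rule arg_cong[of _ _ sum_list], rule map_cong[OF refl], clarify)
      fix \<kappa> f assume "(\<kappa>, f) \<in> set qs"
      then show "\<kappa> * push_down ?I V (part_op f) r k = (c * c) * (\<kappa> * \<mu> f / (c * c) * part_op (F f) r k)"
        using F[of f] qs[of \<kappa> f] rk c0 by simp
    qed
    also have "\<dots> = (c * c) * (\<Sum>(\<kappa>, f)\<leftarrow>qs'. \<kappa> * part_op f r k)"
      unfolding qs'_def by (simp add: sum_list_const_mult[symmetric] comp_def case_prod_unfold)
    finally show "S r k = (\<Sum>(\<kappa>, f)\<leftarrow>qs'. \<kappa> * part_op f r k)" using c0 by simp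
  qed
qed

text \<open>The element \<open>h\<close> split off in the middle of the word has to pass the letters to its right, which
  conjugates them.\<close>

lemma contraction_wprod:
  assumes l: "length Us1 = p" "length Ms = a" "length Us2 = q" "length Ms' = b"
    and h: "h * hi = 1" "hi * h = 1"
    and lM: "\<And>x y. x \<in> idx N a \<Longrightarrow> y \<in> idx N b \<Longrightarrow>
      (\<Sum>x'\<in>idx N a. v y x' *s wprod Ms x x') = (\<Sum>y'\<in>idx N b. v y' x *s (wprod Ms' y' y * h))"
    and lN: "\<And>x y. x \<in> idx N a \<Longrightarrow> y \<in> idx N b \<Longrightarrow>
      (\<Sum>x'\<in>idx N a. v y x' *s wprod Ms x' x) = (\<Sum>y'\<in>idx N b. v y' x *s (wprod Ms' y y' * h))"
  shows "contraction (idx N (p + (a + q))) (wprod (Us1 @ Ms @ Us2))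
    (idx N (p + (b + q))) (wprod (Us1 @ Ms' @ map (conj_letter h hi) Us2)) (graft p a b v) h hi"
proof -
  have w: "wprod (Us1 @ Ms @ Us2) (c1 @ x @ c2) (d1 @ y @ d2) = wprod Us1 c1 d1 * wprod Ms x y * wprod Us2 c2 d2"
    if "c1 \<in> idx N p" "d1 \<in> idx N p" "x \<in> idx N a" "y \<in> idx N a" for c1 d1 x y c2 d2
    using that l by (simp add: wprod_append idx_length mult.assoc)
  have w': "wprod (Us1 @ Ms' @ map (conj_letter h hi) Us2) (c1 @ x @ c2) (d1 @ y @ d2) * h
     = wprod Us1 c1 d1 * (wprod Ms' x y * h) * wprod Us2 c2 d2"
    if "c1 \<in> idx N p" "d1 \<in> idx N p" "x \<in> idx N b" "y \<in> idx N b" for c1 d1 x y c2 d2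
    using that l wprod_conj[OF h(2), of Us2 c2 d2] by (simp add: wprod_append idx_length mult.assoc)
  show ?thesis
    unfolding contraction_def
  proof (intro conjI ballI h)
    fix i k assume "i \<in> idx N (p + (a + q))" "k \<in> idx N (p + (b + q))"
    then obtain c1 x c2 d1 y d2 where *: "i = c1 @ x @ c2" "c1 \<in> idx N p" "x \<in> idx N a" "c2 \<in> idx N q"
      "k = d1 @ y @ d2" "d1 \<in> idx N p" "y \<in> idx N b" "d2 \<in> idx N q"
      by (metis idx_add3E)
    have "(\<Sum>j\<in>idx N (p + (a + q)). graft p a b v k j *s wprod (Us1 @ Ms @ Us2) i j)
      = (\<Sum>x'\<in>idx N a. v y x' *s (wprod Us1 c1 d1 * wprod Ms x x' * wprod Us2 c2 d2))"
      using * by (simp add: sum_graft_col[where \<phi> = scale] w)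
    also have "\<dots> = wprod Us1 c1 d1 * (\<Sum>x'\<in>idx N a. v y x' *s wprod Ms x x') * wprod Us2 c2 d2"
      by (simp add: scale_sums)
    also have "\<dots> = (\<Sum>y'\<in>idx N b. v y' x *s (wprod Us1 c1 d1 * (wprod Ms' y' y * h) * wprod Us2 c2 d2))"
      unfolding lM[OF *(3,7)] by (simp add: scale_sums)
    also have "\<dots> = (\<Sum>j\<in>idx N (p + (b + q)). graft p a b v j i *s (wprod (Us1 @ Ms' @ map (conj_letter h hi) Us2) j k * h))"
      using * by (simp add: sum_graft_row[where \<phi> = scale] w')
    finally show "(\<Sum>j\<in>idx N (p + (a + q)). graft p a b v k j *s wprod (Us1 @ Ms @ Us2) i j) = \<dots>" .
  next
    fix k i assume "i \<in> idx N (p + (a + q))" "k \<in> idx N (p + (b + q))"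
    then obtain c1 x c2 d1 y d2 where *: "i = c1 @ x @ c2" "c1 \<in> idx N p" "x \<in> idx N a" "c2 \<in> idx N q"
      "k = d1 @ y @ d2" "d1 \<in> idx N p" "y \<in> idx N b" "d2 \<in> idx N q"
      by (metis idx_add3E)
    have "(\<Sum>j\<in>idx N (p + (a + q)). graft p a b v k j *s wprod (Us1 @ Ms @ Us2) j i)
      = (\<Sum>x'\<in>idx N a. v y x' *s (wprod Us1 d1 c1 * wprod Ms x' x * wprod Us2 d2 c2))"
      using * by (simp add: sum_graft_col[where \<phi> = scale] w)
    also have "\<dots> = wprod Us1 d1 c1 * (\<Sum>x'\<in>idx N a. v y x' *s wprod Ms x' x) * wprod Us2 d2 c2"
      by (simp add: scale_sums)
    also have "\<dots> = (\<Sum>y'\<in>idx N b. v y' x *s (wprod Us1 d1 c1 * (wprod Ms' y y' * h) * wprod Us2 d2 c2))"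
      unfolding lN[OF *(3,7)] by (simp add: scale_sums)
    also have "\<dots> = (\<Sum>j\<in>idx N (p + (b + q)). graft p a b v j i *s (wprod (Us1 @ Ms' @ map (conj_letter h hi) Us2) k j * h))"
      using * by (simp add: sum_graft_row[where \<phi> = scale] w')
    finally show "(\<Sum>j\<in>idx N (p + (a + q)). graft p a b v k j *s wprod (Us1 @ Ms @ Us2) j i) = \<dots>" .
  qed auto
qed

lemma push_down_graft:
  fixes T :: "nat list \<Rightarrow> nat list \<Rightarrow> complex"
  assumes "r1 \<in> idx N p" "y \<in> idx N b" "r2 \<in> idx N q" "c1 \<in> idx N p" "y' \<in> idx N b" "c2 \<in> idx N q"
  shows "push_down (idx N (p + (a + q))) (graft p a b v) T (r1 @ y @ r2) (c1 @ y' @ c2)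
    = (\<Sum>x\<in>idx N a. \<Sum>x'\<in>idx N a. v y x * T (r1 @ x @ r2) (c1 @ x' @ c2) * v y' x')"
proof -
  have "push_down (idx N (p + (a + q))) (graft p a b v) T (r1 @ y @ r2) (c1 @ y' @ c2)
    = (\<Sum>i\<in>idx N (p + (a + q)). graft p a b v (r1 @ y @ r2) i *
        (\<Sum>j\<in>idx N (p + (a + q)). graft p a b v (c1 @ y' @ c2) j * T i j))"
    by (simp add: push_down_def sum_distrib_left mult_ac)
  also have "\<dots> = (\<Sum>x\<in>idx N a. v y x * (\<Sum>x'\<in>idx N a. v y' x' * T (r1 @ x @ r2) (c1 @ x' @ c2)))"
    using assms by (simp add: sum_graft_col[where \<phi> = "(*)"])
  finally show ?thesis by (simp add: sum_distrib_left mult_ac)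
qed

end

section \<open>Local contractions of noncrossing diagrams\<close>

lemma sum_at_append: "length xs = p \<Longrightarrow> sum_at N p \<phi> (xs @ ys) = (\<Sum>k<N. \<phi> (xs @ k # ys))"
  by (simp add: sum_at_def)

lemma merge_at_append: "length xs = p \<Longrightarrow> merge_at p \<phi> (xs @ k # ys) = \<phi> (xs @ k # k # ys)"
  by (simp add: merge_at_def nth_append)

lemma nc_multiple_sum_at:
  assumes "N > 0" "nc_multiple TYPE('l) N (Suc n) \<phi>" "p \<le> n"
  shows "nc_multiple TYPE('l) N n (sum_at N p \<phi>)"
  using nc_multiple_sum[of N p "n - p" \<phi> "sum_at N p \<phi>"] assms
  by (simp add: sum_at_append idx_length)

lemma nc_multiple_merge_at:
  assumes "nc_multiple TYPE('l) N (Suc n) \<phi>" "p < n"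
  shows "nc_multiple TYPE('l) N n (merge_at p \<phi>)"
  using nc_multiple_merge[of N p "n - Suc p" \<phi> "merge_at p \<phi>"] assms
  by (simp add: merge_at_append idx_length)

lemma cnj_part_op: "cnj (part_op f r c) = part_op f r c"
  by (simp add: part_op_def)

lemma idx_double_addE:
  assumes "zs \<in> idx N (2 * (p + (b + q)))"
  obtains c1 y c2 r1 y' r2 where "zs = (c1 @ y @ c2) @ rev (r1 @ y' @ r2)"
    "c1 \<in> idx N p" "y \<in> idx N b" "c2 \<in> idx N q" "r1 \<in> idx N p" "y' \<in> idx N b" "r2 \<in> idx N q"
proof -
  obtain c r where cr: "zs = c @ r" "c \<in> idx N (p + (b + q))" "r \<in> idx N (p + (b + q))"
    using assms idx_addE[of zs N "p + (b + q)" "p + (b + q)"] by (metis mult_2)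
  obtain c1 y c2 where c: "c = c1 @ y @ c2" "c1 \<in> idx N p" "y \<in> idx N b" "c2 \<in> idx N q"
    using idx_add3E[OF cr(2)] .
  obtain r1 y' r2 where r: "rev r = r1 @ y' @ r2" "r1 \<in> idx N p" "y' \<in> idx N b" "r2 \<in> idx N q"
    using idx_add3E[OF idx_rev[OF cr(3)]] .
  have "zs = (c1 @ y @ c2) @ rev (r1 @ y' @ r2)" using cr(1) c(1) r(1) by (metis rev_rev_ident)
  then show thesis using that c r by blast
qed

lemma sum_idx_1: "(\<Sum>x\<in>idx N (Suc 0). G x) = (\<Sum>k<N. G [k])"
  by (simp add: sum_idx_Suc)

lemma sum_idx_2: "(\<Sum>x\<in>idx N (Suc (Suc 0)). G x) = (\<Sum>k<N. \<Sum>l<N. G [k, l])"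
  by (simp add: sum_idx_Suc)

lemma sum_idx_diag:
  fixes \<phi> :: "complex \<Rightarrow> 'b \<Rightarrow> 'c::comm_monoid_add"
  assumes "\<And>x. \<phi> 0 x = 0"
  shows "(\<Sum>x\<in>idx N (Suc (Suc 0)). \<phi> (of_bool (x ! 0 = x ! 1)) (G x)) = (\<Sum>k<N. \<phi> 1 (G [k, k]))"
proof -
  have "(\<Sum>l<N. \<phi> (of_bool ([k, l] ! 0 = [k, l] ! 1)) (G [k, l])) = \<phi> 1 (G [k, k])" if "k < N" for k
  proof -
    have "(\<Sum>l<N. \<phi> (of_bool ([k, l] ! 0 = [k, l] ! 1)) (G [k, l])) = (\<Sum>l<N. if l = k then \<phi> 1 (G [k, l]) else 0)"
      using assms by (intro sum.cong refl) auto
    then show ?thesis using that by simp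
  qed
  then show ?thesis by (simp add: sum_idx_2)
qed

lemma sum_idx_point:
  fixes \<phi> :: "complex \<Rightarrow> 'b \<Rightarrow> 'c::comm_monoid_add"
  assumes "\<And>x. \<phi> 0 x = 0" "z \<in> idx N a"
  shows "(\<Sum>x\<in>idx N a. \<phi> (of_bool (x = z)) (G x)) = \<phi> 1 (G z)"
proof -
  have "(\<Sum>x\<in>idx N a. \<phi> (of_bool (x = z)) (G x)) = (\<Sum>x\<in>idx N a. if x = z then \<phi> 1 (G x) else 0)"
    using assms by (intro sum.cong refl) auto
  then show ?thesis using assms by simp
qed

context complex_star_algebra
begin

text \<open>Contracting a factor with the constant vector on both sides sums out one upper and one
  lower boundary point.\<close>

lemma nc_delete_one:
  fixes f :: "nat \<Rightarrow> 'l"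
  assumes N: "N > 0" and f: "nc_labelling (2 * (p + (Suc 0 + q))) f"
  shows "nc_multiple TYPE('l) N (2 * (p + (0 + q))) (\<lambda>zs.
    push_down (idx N (p + (Suc 0 + q))) (graft p (Suc 0) 0 (\<lambda>_ _. 1)) (part_op f)
      (rev (drop (p + (0 + q)) zs)) (take (p + (0 + q)) zs))"
proof -
  let ?\<phi> = "\<lambda>zs. of_bool (agrees f zs) :: complex"
  have "nc_multiple TYPE('l) N (Suc (Suc (2 * (p + (0 + q))))) ?\<phi>"
    using nc_multiple_agrees[OF f, of N] by simp
  then have "nc_multiple TYPE('l) N (Suc (2 * (p + (0 + q)))) (sum_at N p ?\<phi>)"
    by (rule nc_multiple_sum_at[OF N]) simp
  \<comment> \<open>Once the upper point is gone, the lower one is preceded on the walk by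
    \<open>p + q\<close> upper points and by the \<open>q\<close> lower points to its right.\<close>
  then have "nc_multiple TYPE('l) N (2 * (p + (0 + q))) (sum_at N (p + (q + q)) (sum_at N p ?\<phi>))"
    by (rule nc_multiple_sum_at[OF N]) simp
  moreover have "sum_at N (p + (q + q)) (sum_at N p ?\<phi>) zs =
    push_down (idx N (p + (Suc 0 + q))) (graft p (Suc 0) 0 (\<lambda>_ _. 1)) (part_op f)
      (rev (drop (p + (0 + q)) zs)) (take (p + (0 + q)) zs)" if zs: "zs \<in> idx N (2 * (p + (0 + q)))" for zs
  proof -
    obtain c1 y c2 r1 y' r2 where z: "zs = (c1 @ y @ c2) @ rev (r1 @ y' @ r2)"
      "c1 \<in> idx N p" "y \<in> idx N 0" "c2 \<in> idx N q" "r1 \<in> idx N p" "y' \<in> idx N 0" "r2 \<in> idx N q"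
      using idx_double_addE[OF zs] .
    then have l: "length c1 = p" "y = []" "length c2 = q" "length r1 = p" "y' = []" "length r2 = q"
      by (auto simp: idx_length)
    have "sum_at N (p + (q + q)) (sum_at N p ?\<phi>) zs = (\<Sum>k<N. \<Sum>l<N. ?\<phi> (c1 @ l # c2 @ rev r2 @ k # rev r1))"
      using sum_at_append[of "c1 @ c2 @ rev r2" "p + (q + q)" N _ "rev r1"] sum_at_append[of c1 p N]
      by (simp add: z(1) l)
    also have "\<dots> = push_down (idx N (p + (Suc 0 + q))) (graft p (Suc 0) 0 (\<lambda>_ _. 1)) (part_op f) (r1 @ y' @ r2) (c1 @ y @ c2)"
      unfolding push_down_graft[OF z(5-7,2-4)] by (simp only: sum_idx_1) (simp add: part_op_def)
    also have "r1 @ y' @ r2 = rev (drop (p + (0 + q)) zs)" by (simp add: z(1) l)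
    also have "c1 @ y @ c2 = take (p + (0 + q)) zs" by (simp add: z(1) l)
    finally show ?thesis .
  qed
  ultimately show ?thesis by (subst nc_multiple_cong[symmetric]) auto
qed

text \<open>In each row the pair vector first identifies two neighbouring indices and then sums over
  their common value.\<close>

lemma nc_delete_pair:
  fixes f :: "nat \<Rightarrow> 'l"
  assumes N: "N > 0" and f: "nc_labelling (2 * (p + (Suc (Suc 0) + q))) f"
  shows "nc_multiple TYPE('l) N (2 * (p + (0 + q))) (\<lambda>zs.
    push_down (idx N (p + (Suc (Suc 0) + q))) (graft p (Suc (Suc 0)) 0 (\<lambda>_ x. of_bool (x ! 0 = x ! 1))) (part_op f)
      (rev (drop (p + (0 + q)) zs)) (take (p + (0 + q)) zs))"
proof -
  let ?\<phi> = "\<lambda>zs. of_bool (agrees f zs) :: complex"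
  let ?S1 = "sum_at N p (merge_at p ?\<phi>)"
  have "nc_multiple TYPE('l) N (Suc (Suc (Suc (Suc (2 * (p + (0 + q))))))) ?\<phi>"
    using nc_multiple_agrees[OF f, of N] by simp
  then have "nc_multiple TYPE('l) N (Suc (Suc (Suc (2 * (p + (0 + q)))))) (merge_at p ?\<phi>)"
    by (rule nc_multiple_merge_at) simp
  then have "nc_multiple TYPE('l) N (Suc (Suc (2 * (p + (0 + q))))) ?S1"
    by (rule nc_multiple_sum_at[OF N]) simp
  then have "nc_multiple TYPE('l) N (Suc (2 * (p + (0 + q)))) (merge_at (p + (q + q)) ?S1)"
    by (rule nc_multiple_merge_at) simp
  then have "nc_multiple TYPE('l) N (2 * (p + (0 + q))) (sum_at N (p + (q + q)) (merge_at (p + (q + q)) ?S1))"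
    by (rule nc_multiple_sum_at[OF N]) simp
  moreover have "sum_at N (p + (q + q)) (merge_at (p + (q + q)) ?S1) zs =
    push_down (idx N (p + (Suc (Suc 0) + q))) (graft p (Suc (Suc 0)) 0 (\<lambda>_ x. of_bool (x ! 0 = x ! 1))) (part_op f)
      (rev (drop (p + (0 + q)) zs)) (take (p + (0 + q)) zs)" if zs: "zs \<in> idx N (2 * (p + (0 + q)))" for zs
  proof -
    obtain c1 y c2 r1 y' r2 where z: "zs = (c1 @ y @ c2) @ rev (r1 @ y' @ r2)"
      "c1 \<in> idx N p" "y \<in> idx N 0" "c2 \<in> idx N q" "r1 \<in> idx N p" "y' \<in> idx N 0" "r2 \<in> idx N q"
      using idx_double_addE[OF zs] .
    then have l: "length c1 = p" "y = []" "length c2 = q" "length r1 = p" "y' = []" "length r2 = q"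
      by (auto simp: idx_length)
    have "sum_at N (p + (q + q)) (merge_at (p + (q + q)) ?S1) zs
       = (\<Sum>k<N. merge_at (p + (q + q)) ?S1 ((c1 @ c2 @ rev r2) @ k # rev r1))"
      using sum_at_append[of "c1 @ c2 @ rev r2" "p + (q + q)" N _ "rev r1"] by (simp add: z(1) l)
    also have "\<dots> = (\<Sum>k<N. ?S1 (c1 @ (c2 @ rev r2 @ k # k # rev r1)))"
      using merge_at_append[of "c1 @ c2 @ rev r2" "p + (q + q)" _ _ "rev r1"] by (simp add: l)
    also have "\<dots> = (\<Sum>k<N. \<Sum>l<N. ?\<phi> (c1 @ l # l # c2 @ rev r2 @ k # k # rev r1))"
      using sum_at_append[of c1 p N] merge_at_append[of c1 p] by (simp add: l)
    also have "\<dots> = push_down (idx N (p + (Suc (Suc 0) + q))) (graft p (Suc (Suc 0)) 0 (\<lambda>_ x. of_bool (x ! 0 = x ! 1))) (part_op f) (r1 @ y' @ r2) (c1 @ y @ c2)"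
    proof -
      have "(\<Sum>x\<in>idx N (Suc (Suc 0)). \<Sum>x'\<in>idx N (Suc (Suc 0)). of_bool (x ! 0 = x ! 1) * part_op f (r1 @ x @ r2) (c1 @ x' @ c2) * of_bool (x' ! 0 = x' ! 1))
        = (\<Sum>x\<in>idx N (Suc (Suc 0)). of_bool (x ! 0 = x ! 1) * (\<Sum>x'\<in>idx N (Suc (Suc 0)). of_bool (x' ! 0 = x' ! 1) * part_op f (r1 @ x @ r2) (c1 @ x' @ c2)))"
        by (simp only: sum_distrib_left mult_ac)
      then show ?thesis
        unfolding push_down_graft[OF z(5-7,2-4)] sum_idx_diag[where \<phi> = "(*)", OF mult_zero_left]
        by (simp add: part_op_def)
    qed
    also have "r1 @ y' @ r2 = rev (drop (p + (0 + q)) zs)" by (simp add: z(1) l)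
    also have "c1 @ y @ c2 = take (p + (0 + q)) zs" by (simp add: z(1) l)
    finally show ?thesis .
  qed
  ultimately show ?thesis by (subst nc_multiple_cong[symmetric]) auto
qed

text \<open>In each row two neighbouring indices are identified; no point is summed out.\<close>

lemma nc_merge_pair:
  fixes f :: "nat \<Rightarrow> 'l"
  assumes f: "nc_labelling (2 * (p + (Suc (Suc 0) + q))) f"
  shows "nc_multiple TYPE('l) N (2 * (p + (Suc 0 + q))) (\<lambda>zs.
    push_down (idx N (p + (Suc (Suc 0) + q))) (graft p (Suc (Suc 0)) (Suc 0) (\<lambda>y x. of_bool (x = [hd y, hd y]))) (part_op f)
      (rev (drop (p + (Suc 0 + q)) zs)) (take (p + (Suc 0 + q)) zs))"
proof -
  let ?\<phi> = "\<lambda>zs. of_bool (agrees f zs) :: complex"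
  have "nc_multiple TYPE('l) N (Suc (Suc (2 * (p + (Suc 0 + q))))) ?\<phi>"
    using nc_multiple_agrees[OF f, of N] by simp
  then have "nc_multiple TYPE('l) N (Suc (2 * (p + (Suc 0 + q)))) (merge_at p ?\<phi>)"
    by (rule nc_multiple_merge_at) simp
  \<comment> \<open>The upper row has \<open>p + 1 + q\<close> points left, and \<open>q\<close>
    lower points precede the lower pair.\<close>
  then have "nc_multiple TYPE('l) N (2 * (p + (Suc 0 + q))) (merge_at (p + Suc (q + q)) (merge_at p ?\<phi>))"
    by (rule nc_multiple_merge_at) simp
  moreover have "merge_at (p + Suc (q + q)) (merge_at p ?\<phi>) zs =
    push_down (idx N (p + (Suc (Suc 0) + q))) (graft p (Suc (Suc 0)) (Suc 0) (\<lambda>y x. of_bool (x = [hd y, hd y]))) (part_op f)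
      (rev (drop (p + (Suc 0 + q)) zs)) (take (p + (Suc 0 + q)) zs)" if zs: "zs \<in> idx N (2 * (p + (Suc 0 + q)))" for zs
  proof -
    obtain c1 y c2 r1 y' r2 where z: "zs = (c1 @ y @ c2) @ rev (r1 @ y' @ r2)"
      "c1 \<in> idx N p" "y \<in> idx N (Suc 0)" "c2 \<in> idx N q" "r1 \<in> idx N p" "y' \<in> idx N (Suc 0)" "r2 \<in> idx N q"
      using idx_double_addE[OF zs] .
    obtain k where k: "y' = [k]" "k < N" using z(6) by (metis idx_SucE idx_0 singletonD)
    obtain l where l0: "y = [l]" "l < N" using z(3) by (metis idx_SucE idx_0 singletonD)
    have l: "length c1 = p" "length c2 = q" "length r1 = p" "length r2 = q"
      using z by (auto simp: idx_length)
    have "merge_at (p + Suc (q + q)) (merge_at p ?\<phi>) zs = ?\<phi> (c1 @ l # l # c2 @ rev r2 @ k # k # rev r1)"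
      using merge_at_append[of "c1 @ l # c2 @ rev r2" "p + Suc (q + q)" _ _ "rev r1"]
        merge_at_append[of c1 p] by (simp add: z(1) k l0 l)
    also have "\<dots> = push_down (idx N (p + (Suc (Suc 0) + q))) (graft p (Suc (Suc 0)) (Suc 0) (\<lambda>y x. of_bool (x = [hd y, hd y]))) (part_op f) (r1 @ y' @ r2) (c1 @ y @ c2)"
    proof -
      have kk: "[hd y', hd y'] \<in> idx N (Suc (Suc 0))" "[hd y, hd y] \<in> idx N (Suc (Suc 0))"
        using k l0 by auto
      have "(\<Sum>x\<in>idx N (Suc (Suc 0)). \<Sum>x'\<in>idx N (Suc (Suc 0)). of_bool (x = [hd y', hd y']) * part_op f (r1 @ x @ r2) (c1 @ x' @ c2) * of_bool (x' = [hd y, hd y]))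
        = (\<Sum>x\<in>idx N (Suc (Suc 0)). of_bool (x = [hd y', hd y']) * (\<Sum>x'\<in>idx N (Suc (Suc 0)). of_bool (x' = [hd y, hd y]) * part_op f (r1 @ x @ r2) (c1 @ x' @ c2)))"
        by (simp only: sum_distrib_left mult_ac)
      then show ?thesis
        unfolding push_down_graft[OF z(5-7,2-4)] sum_idx_point[where \<phi> = "(*)", OF mult_zero_left kk(1)]
          sum_idx_point[where \<phi> = "(*)", OF mult_zero_left kk(2)]
        by (simp add: part_op_def k l0)
    qed
    also have "r1 @ y' @ r2 = rev (drop (p + (Suc 0 + q)) zs)" by (simp add: z(1) l k l0)
    also have "c1 @ y @ c2 = take (p + (Suc 0 + q)) zs" by (simp add: z(1) l k l0)
    finally show ?thesis .
  qed
  ultimately show ?thesis by (subst nc_multiple_cong[symmetric]) auto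
qed

end

text \<open>The letters \<open>L\<close> are stable under the operations of the reduction, and the one-dimensional
  representations split off by it lie in \<open>Gam\<close>.\<close>

locale letter_system = complex_star_algebra scale star
  for scale :: "complex \<Rightarrow> 'a::ring_1 \<Rightarrow> 'a" (infixr \<open>*s\<close> 75) and star :: "'a \<Rightarrow> 'a" +
  fixes N :: nat and L :: "(nat \<Rightarrow> nat \<Rightarrow> 'a) \<Rightarrow> bool" and Gam :: "'a set"
  assumes N4: "N \<ge> 4"
    and letter_uni: "L U \<Longrightarrow> bi_unitary {..<N} U"
    and Gam_one: "1 \<in> Gam"
    and Gam_mult: "g \<in> Gam \<Longrightarrow> h \<in> Gam \<Longrightarrow> g * h \<in> Gam"
    and Gam_row: "L U \<Longrightarrow> (\<And>j. j < N \<Longrightarrow> (\<Sum>k<N. U j k) = g) \<Longrightarrow> g \<in> Gam"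
    and Gam_pair: "L U \<Longrightarrow> L W \<Longrightarrow> (\<And>i j. i < N \<Longrightarrow> j < N \<Longrightarrow> (\<Sum>k<N. U i k * W j k) = of_bool (i = j) * g) \<Longrightarrow> g \<in> Gam"
    and letter_conj: "L U \<Longrightarrow> h \<in> Gam \<Longrightarrow> star h * h = 1 \<Longrightarrow> h * star h = 1 \<Longrightarrow> L (conj_letter h (star h) U)"
    and letter_merge: "L U \<Longrightarrow> L W \<Longrightarrow>
      (\<And>i j k. i < N \<Longrightarrow> j < N \<Longrightarrow> k < N \<Longrightarrow> i \<noteq> j \<Longrightarrow> U i k * W j k = 0) \<Longrightarrow>
      (\<And>i k l. i < N \<Longrightarrow> k < N \<Longrightarrow> l < N \<Longrightarrow> k \<noteq> l \<Longrightarrow> U i k * W i l = 0) \<Longrightarrow>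
      L (\<lambda>i k. U i k * W i k)"
begin

section \<open>Shortening a word\<close>

definition reducible_to where
  "reducible_to TL Us \<zeta> \<longleftrightarrow> (\<exists>Us' V h. length Us' < length Us \<and> (\<forall>U\<in>set Us'. L U) \<and> spanned TL N Us' \<and>
     h \<in> Gam \<and> star h * h = 1 \<and> h * star h = 1 \<and>
     contraction (idx N (length Us)) (wprod Us) (idx N (length Us')) (wprod Us') V h (star h) \<and>
     (\<exists>i\<in>idx N (length Us'). (\<Sum>k\<in>idx N (length Us). V i k * \<zeta> k) \<noteq> 0))"

text \<open>By \<open>fac\<close>, row \<open>r\<close> of the partition map is a combination of
  rows of the contraction. Hence the contraction cannot annihilate a vector that this row does not
  annihilate, and the reduced vector is nonzero.\<close>

lemma local_step:
  fixes f :: "nat \<Rightarrow> 'l"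
  assumes L: "\<And>U. U \<in> set (Us1 @ Ms @ Us2) \<Longrightarrow> L U" "\<And>U. U \<in> set Ms' \<Longrightarrow> L U"
    and l: "length Us1 = p" "length Ms = a" "length Us2 = q" "length Ms' = b" and ba: "b < a"
    and h: "h \<in> Gam" "star h * h = 1" "h * star h = 1"
    and lM: "\<And>x y. x \<in> idx N a \<Longrightarrow> y \<in> idx N b \<Longrightarrow>
      (\<Sum>x'\<in>idx N a. v y x' *s wprod Ms x x') = (\<Sum>y'\<in>idx N b. v y' x *s (wprod Ms' y' y * h))"
    and lN: "\<And>x y. x \<in> idx N a \<Longrightarrow> y \<in> idx N b \<Longrightarrow>
      (\<Sum>x'\<in>idx N a. v y x' *s wprod Ms x' x) = (\<Sum>y'\<in>idx N b. v y' x *s (wprod Ms' y y' * h))"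
    and vv: "\<And>y y'. y \<in> idx N b \<Longrightarrow> y' \<in> idx N b \<Longrightarrow> (\<Sum>x\<in>idx N a. v y x * v y' x) = of_bool (y = y') * c"
    and c0: "c \<noteq> 0"
    and nc: "\<And>f :: nat \<Rightarrow> 'l. nc_labelling (2 * (p + (a + q))) f \<Longrightarrow> nc_multiple TYPE('l) N (2 * (p + (b + q)))
        (\<lambda>zs. push_down (idx N (p + (a + q))) (graft p a b v) (part_op f) (rev (drop (p + (b + q)) zs)) (take (p + (b + q)) zs))"
    and sp: "spanned TYPE('l) N (Us1 @ Ms @ Us2)"
    and fac: "\<And>c1 x c2. c1 \<in> idx N p \<Longrightarrow> x \<in> idx N a \<Longrightarrow> c2 \<in> idx N q \<Longrightarrow> part_op f r (c1 @ x @ c2) = (\<Sum>y\<in>idx N b. Y c1 y c2 * v y x)"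
    and nz: "(\<Sum>c\<in>idx N (p + (a + q)). part_op f r c * \<zeta> c) \<noteq> 0"
  shows "reducible_to TYPE('l) (Us1 @ Ms @ Us2) \<zeta>"
proof -
  let ?I = "idx N (p + (a + q))" and ?J = "idx N (p + (b + q))" and ?V = "graft p a b v"
  let ?Us = "Us1 @ Ms @ Us2" and ?Us' = "Us1 @ Ms' @ map (conj_letter h (star h)) Us2"
  have c: "contraction ?I (wprod ?Us) ?J (wprod ?Us') ?V h (star h)"
    by (rule contraction_wprod[OF l h(3,2) lM lN])
  have ll: "length ?Us = p + (a + q)" "length ?Us' = p + (b + q)" using l by auto
  have "spanned TYPE('l) N ?Us'"
  proof (rule spanned_contraction[where Us = ?Us and V = ?V and h = h and hi = "star h" and c = c])
    show "contraction (idx N (length ?Us)) (wprod ?Us) (idx N (length ?Us')) (wprod ?Us') ?V h (star h)"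
      unfolding ll by (rule c)
    fix i j assume "i \<in> idx N (length ?Us')" "j \<in> idx N (length ?Us')"
    then obtain r1 y r2 s1 y' s2 where *: "i = r1 @ y @ r2" "r1 \<in> idx N p" "y \<in> idx N b" "r2 \<in> idx N q"
      "j = s1 @ y' @ s2" "s1 \<in> idx N p" "y' \<in> idx N b" "s2 \<in> idx N q"
      unfolding ll by (metis idx_add3E)
    have e: "i = j \<longleftrightarrow> s1 = r1 \<and> s2 = r2 \<and> y = y'"
      using * by (auto simp: idx_length)
    have "(\<Sum>k\<in>?I. ?V i k * ?V j k) = (\<Sum>x\<in>idx N a. v y x * ?V j (r1 @ x @ r2))"
      unfolding *(1) using * by (intro sum_graft_col[where \<phi> = "(*)"]) auto
    also have "\<dots> = (\<Sum>x\<in>idx N a. of_bool (s1 = r1 \<and> s2 = r2) * (v y x * v y' x))"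
      using * by (intro sum.cong refl) (simp add: graft_append idx_length)
    also have "\<dots> = of_bool (i = j) * c" using vv[of y y'] * unfolding e
      by (simp add: sum_distrib_left[symmetric])
    finally show "(\<Sum>k\<in>idx N (length ?Us). ?V i k * ?V j k) = of_bool (i = j) * c" unfolding ll .
  next
    show "nc_multiple TYPE('l) N (2 * length ?Us') (\<lambda>zs. push_down (idx N (length ?Us)) ?V (part_op f)
        (rev (drop (length ?Us') zs)) (take (length ?Us') zs))" if "nc_labelling (2 * length ?Us) f" for f :: "nat \<Rightarrow> 'l"
      using nc that unfolding ll by blast
  qed (use sp c0 in auto)
  moreover have "\<exists>i\<in>?J. (\<Sum>k\<in>?I. ?V i k * \<zeta> k) \<noteq> 0"
  proof (rule ccontr)
    assume "\<not> ?thesis"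
    then have z: "(\<Sum>k\<in>?I. ?V (c1 @ y @ c2) k * \<zeta> k) = 0" if "c1 \<in> idx N p" "y \<in> idx N b" "c2 \<in> idx N q" for c1 y c2
      using idx_append3[OF that] by blast
    have z': "(\<Sum>x\<in>idx N a. v y x * \<zeta> (c1 @ x @ c2)) = 0" if "c1 \<in> idx N p" "y \<in> idx N b" "c2 \<in> idx N q" for c1 y c2
      using z[OF that] sum_graft_col[where \<phi> = "(*)", OF mult_zero_left that] by simp
    have "(\<Sum>c\<in>?I. part_op f r c * \<zeta> c) = (\<Sum>c1\<in>idx N p. \<Sum>x\<in>idx N a. \<Sum>c2\<in>idx N q. part_op f r (c1 @ x @ c2) * \<zeta> (c1 @ x @ c2))"
      by (rule sum_idx_add3)
    also have "\<dots> = (\<Sum>c1\<in>idx N p. \<Sum>x\<in>idx N a. \<Sum>c2\<in>idx N q. \<Sum>y\<in>idx N b. Y c1 y c2 * (v y x * \<zeta> (c1 @ x @ c2)))"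
      by (intro sum.cong refl) (simp add: fac sum_distrib_right mult.assoc)
    also have "\<dots> = (\<Sum>c1\<in>idx N p. \<Sum>c2\<in>idx N q. \<Sum>x\<in>idx N a. \<Sum>y\<in>idx N b. Y c1 y c2 * (v y x * \<zeta> (c1 @ x @ c2)))"
      by (rule sum.cong[OF refl], rule sum.swap)
    also have "\<dots> = (\<Sum>c1\<in>idx N p. \<Sum>c2\<in>idx N q. \<Sum>y\<in>idx N b. \<Sum>x\<in>idx N a. Y c1 y c2 * (v y x * \<zeta> (c1 @ x @ c2)))"
      by (rule sum.cong[OF refl], rule sum.cong[OF refl], rule sum.swap)
    also have "\<dots> = 0" using z' by (simp add: sum_distrib_left[symmetric])
    finally show False using nz by simp
  qed
  moreover have "\<forall>U\<in>set ?Us'. L U" using L h letter_conj by auto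
  ultimately show ?thesis
    unfolding reducible_to_def
    by (intro exI[of _ ?Us'] exI[of _ ?V] exI[of _ h]) (use c ll h ba in auto)
qed

text \<open>By \<open>fac\<close> the traced map is \<open>\<kappa>\<close> times
  \<open>w w^T\<close>, where \<open>\<kappa>\<close> counts admissible indices. So the letters
  \<open>Ms\<close> contain a one-dimensional representation \<open>h\<close> spanned by
  \<open>w\<close>, which can be contracted away.\<close>

lemma delete_step:
  fixes f :: "nat \<Rightarrow> 'l" and w :: "nat list \<Rightarrow> complex"
  assumes L: "\<And>U. U \<in> set (Us1 @ Ms @ Us2) \<Longrightarrow> L U"
    and l: "length Us1 = p" "length Ms = a" "length Us2 = q" and a0: "0 < a"
    and x0: "w x0 = 1" "x0 = replicate a 0"
    and c0: "(\<Sum>x\<in>idx N a. w x * w x) \<noteq> 0"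
    and Gamh: "\<And>h. (\<And>x. x \<in> idx N a \<Longrightarrow> (\<Sum>x'\<in>idx N a. w x' *s wprod Ms x x') = w x *s h) \<Longrightarrow> h \<in> Gam"
    and nc: "\<And>f :: nat \<Rightarrow> 'l. nc_labelling (2 * (p + (a + q))) f \<Longrightarrow> nc_multiple TYPE('l) N (2 * (p + (0 + q)))
        (\<lambda>zs. push_down (idx N (p + (a + q))) (graft p a 0 (\<lambda>_. w)) (part_op f) (rev (drop (p + (0 + q)) zs)) (take (p + (0 + q)) zs))"
    and sp: "spanned TYPE('l) N (Us1 @ Ms @ Us2)"
    and e: "endo (idx N (p + (a + q))) (wprod (Us1 @ Ms @ Us2)) (part_op f)"
    and fac: "\<And>s c1 x c2. s \<in> idx N (p + (a + q)) \<Longrightarrow> c1 \<in> idx N p \<Longrightarrow> x \<in> idx N a \<Longrightarrow> c2 \<in> idx N q \<Longrightarrow>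
        part_op f s (c1 @ x @ c2) = part_op f s (c1 @ x0 @ c2) * w x"
    and r: "r \<in> idx N (p + (a + q))" and nz: "(\<Sum>c\<in>idx N (p + (a + q)). part_op f r c * \<zeta> c) \<noteq> 0"
  shows "reducible_to TYPE('l) (Us1 @ Ms @ Us2) \<zeta>"
proof -
  have N0: "0 < N" using N4 by simp
  have x0i: "x0 \<in> idx N a" using x0 N0 by (simp add: idx_replicate)
  define \<kappa> where "\<kappa> = (\<Sum>c2\<in>idx N q. \<Sum>c1\<in>idx N p. \<Sum>s\<in>idx N (p + (a + q)). of_bool (agrees f ((c1 @ x0 @ c2) @ rev s)) :: complex)"
  \<comment> \<open>Constant indices agree with every labelling, so the count is positive.\<close>
  have "agrees f ((replicate p 0 @ x0 @ replicate q 0) @ rev (replicate (p + (a + q)) 0))"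
    using agrees_replicate[of f "2 * (p + (a + q))" 0] by (simp add: x0 replicate_add[symmetric] mult_2 add_ac)
  then have \<kappa>: "\<kappa> \<noteq> 0" unfolding \<kappa>_def
    using N0 by (intro sum_of_bool_nonzero) (auto intro: idx_replicate)
  have bi_unitary: "\<And>U. U \<in> set (Us1 @ Ms @ Us2) \<Longrightarrow> bi_unitary {..<N} U" using L letter_uni by blast
  have tr: "(\<Sum>c2\<in>idx N q. \<Sum>c1\<in>idx N p. \<Sum>s\<in>idx N (p + (a + q)).
      part_op f s (c1 @ x @ c2) * part_op f s (c1 @ x' @ c2)) = \<kappa> * (w x * w x')"
    if "x \<in> idx N a" "x' \<in> idx N a" for x x'
  proof -
    have "part_op f s (c1 @ x @ c2) * part_op f s (c1 @ x' @ c2) = of_bool (agrees f ((c1 @ x0 @ c2) @ rev s)) * (w x * w x')"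
      if "c1 \<in> idx N p" "c2 \<in> idx N q" "s \<in> idx N (p + (a + q))" for c1 c2 s
    proof -
      have part_op_sq: "of_bool (agrees f ((c1 @ x0 @ c2) @ rev s)) = part_op f s (c1 @ x0 @ c2) * part_op f s (c1 @ x0 @ c2)"
        by (simp add: part_op_def)
      show ?thesis
        unfolding fac[OF that(3,1) \<open>x \<in> idx N a\<close> that(2)] fac[OF that(3,1) \<open>x' \<in> idx N a\<close> that(2)]
        unfolding part_op_sq by (simp only: mult_ac)
    qed
    then show ?thesis unfolding \<kappa>_def sum_distrib_right by (intro sum.cong refl) blast
  qed
  have "endo (idx N a) (wprod Ms) (\<lambda>x x'. \<Sum>c2\<in>idx N q. \<Sum>c1\<in>idx N p. \<Sum>s\<in>idx N (p + (a + q)).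
      part_op f s (c1 @ x @ c2) * part_op f s (c1 @ x' @ c2))"
    using endo_part_op_traced[OF _ l e] bi_unitary by blast
  then have "endo (idx N a) (wprod Ms) (\<lambda>x x'. \<kappa> * (w x * w x'))"
    by (rule endo_cong[THEN iffD1, rotated]) (rule tr)
  then have ew: "endo (idx N a) (wprod Ms) (\<lambda>x x'. w x * w x')" using endo_scale[OF \<kappa>] by blast
  have U: "bi_unitary (idx N a) (wprod Ms)" using bi_unitary_wprod[of Ms N] bi_unitary l by auto
  obtain h where h: "star h * h = 1" "h * star h = 1"
    and hr: "\<And>x. x \<in> idx N a \<Longrightarrow> (\<Sum>x'\<in>idx N a. w x' *s wprod Ms x x') = w x *s h"
    and hc: "\<And>x. x \<in> idx N a \<Longrightarrow> (\<Sum>x'\<in>idx N a. w x' *s wprod Ms x' x) = w x *s h"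
    using rank_one_endo[OF U ew x0i] x0(1) by auto
  have hG: "h \<in> Gam" using Gamh hr by blast
  show ?thesis
  proof (rule local_step[where Ms' = "[]" and b = 0 and h = h and v = "\<lambda>_. w" and c = "\<Sum>x\<in>idx N a. w x * w x"
        and Y = "\<lambda>c1 y c2. part_op f r (c1 @ x0 @ c2)" and r = r and f = f])
    show "part_op f r (c1 @ x @ c2) = (\<Sum>y\<in>idx N 0. part_op f r (c1 @ x0 @ c2) * w x)"
      if "c1 \<in> idx N p" "x \<in> idx N a" "c2 \<in> idx N q" for c1 x c2
      using fac[OF r that] by simp
  qed (use L l a0 h hG hr hc c0 nc sp nz in auto)
qed

text \<open>A singleton is deleted, and so is a pair of neighbours that forms a whole block. A pair
  connected to further points does not split off a one-dimensional representation in this way; there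
  the two letters are merged instead.\<close>

lemma reduce_step:
  fixes f :: "nat \<Rightarrow> 'l"
  assumes L: "\<And>U. U \<in> set Us \<Longrightarrow> L U" and t: "length Us = t"
    and sp: "spanned TYPE('l) N Us"
    and e: "endo (idx N t) (wprod Us) (part_op f)"
    and red: "reducible_at t f p"
    and r: "r \<in> idx N t" and nz: "(\<Sum>c\<in>idx N t. part_op f r c * \<zeta> c) \<noteq> 0"
  shows "reducible_to TYPE('l) Us \<zeta>"
proof -
  have N0: "0 < N" using N4 by simp
  have p: "p < t" using red by (simp add: reducible_at_def)
  show ?thesis
  proof (cases "\<forall>y<2 * t. f y = f p \<longrightarrow> y = p")
    case True
    define Us1 U Us2 q where "Us1 = take p Us" "U = Us ! p" "Us2 = drop (Suc p) Us" "q = t - Suc p"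
    note d = this
    have Us: "Us = Us1 @ [U] @ Us2" using id_take_nth_drop[of p Us] p t by (simp add: d)
    have l: "length Us1 = p" "length [U] = Suc 0" "length Us2 = q" using p t by (auto simp: d)
    have tq: "t = p + (Suc 0 + q)" using p by (simp add: d)
    have LU: "L U" using L Us by auto
    have indep: "part_op f s (c1 @ x @ c2) = part_op f s (c1 @ [0] @ c2)"
      if "s \<in> idx N (p + (Suc 0 + q))" "c1 \<in> idx N p" "x \<in> idx N (Suc 0)" "c2 \<in> idx N q" for s c1 x c2
    proof -
      from that(3) obtain k where "x = [k]" by (metis idx_SucE idx_0 singletonD)
      then show ?thesis
        using agrees_singleton_indep[OF True, of c1 "c2 @ rev s" k 0] that tq
        by (simp add: part_op_def idx_length)
    qed
    show ?thesis unfolding Us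
    proof (rule delete_step[OF _ l, where w = "\<lambda>_. 1" and f = f and r = r and ?x0.0 = "[0]"])
      show "h \<in> Gam" if "\<And>x. x \<in> idx N (Suc 0) \<Longrightarrow> (\<Sum>x'\<in>idx N (Suc 0). 1 *s wprod [U] x x') = 1 *s h" for h
      proof (rule Gam_row[OF LU])
        fix j assume "j < N"
        then show "(\<Sum>k<N. U j k) = h" using that[of "[j]"] by (simp add: sum_idx_1)
      qed
      show "(\<Sum>x\<in>idx N (Suc 0). 1 * 1) \<noteq> (0 :: complex)" using N0 by (simp only: sum_idx_1) simp
    qed (use L Us N0 nc_delete_one[OF N0] sp e tq indep r nz in auto)
  next
    case False
    then have p1: "Suc p < t" and fp: "f p = f (Suc p)" using red by (auto simp: reducible_at_def)
    define Us1 U W Us2 q where "Us1 = take p Us" "U = Us ! p" "W = Us ! Suc p" "Us2 = drop (Suc (Suc p)) Us" "q = t - Suc (Suc p)"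
    note d = this
    have Us: "Us = Us1 @ [U, W] @ Us2" using id_take_nth_drop[of p Us] Cons_nth_drop_Suc[of "Suc p" Us] p1 t by (simp add: d)
    have l: "length Us1 = p" "length [U, W] = Suc (Suc 0)" "length Us2 = q" using p1 t by (auto simp: d)
    have tq: "t = p + (Suc (Suc 0) + q)" using p1 by (simp add: d)
    have LU: "L U" "L W" using L Us by auto
    have pair: "\<exists>k l. x = [k, l] \<and> k < N \<and> l < N" if "x \<in> idx N (Suc (Suc 0))" for x
      using that by (metis idx_SucE idx_0 singletonD)
    have off: "part_op f s (c1 @ [k, l] @ c2) = 0"
      if "c1 \<in> idx N p" "k \<noteq> l" for s c1 k l c2
      using agrees_pair[of f c1 k l "c2 @ rev s" p] that fp by (auto simp: part_op_def idx_length)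
    have m: "agrees f (c1 @ k # k # zs) \<longleftrightarrow> agrees (merge_label p f) (c1 @ k # zs)"
      if "c1 \<in> idx N p" for c1 k zs
      using agrees_merge[of c1 p f k zs] that by (simp add: idx_length)
    \<comment> \<open>The number of boundary points other than the pair,
      \<open>2 * t - 2\<close>.\<close>
    let ?n = "p + (q + (p + (Suc (Suc 0) + q)))"
    show ?thesis
    proof (cases "\<exists>x<?n. merge_label p f (skip p x) = merge_label p f p")
      case False
      have indep: "part_op f s (c1 @ x @ c2) = part_op f s (c1 @ [0, 0] @ c2) * of_bool (x ! 0 = x ! 1)"
        if "s \<in> idx N (p + (Suc (Suc 0) + q))" "c1 \<in> idx N p" "x \<in> idx N (Suc (Suc 0))" "c2 \<in> idx N q" for s c1 x c2
      proof -
        from pair[OF that(3)] obtain k l where x: "x = [k, l]" by blast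
        show ?thesis
        proof (cases "k = l")
          case True
          have "agrees (merge_label p f) (c1 @ k # (c2 @ rev s)) \<longleftrightarrow> agrees (merge_label p f) (c1 @ 0 # (c2 @ rev s))"
            using agrees_insert[of c1 p "merge_label p f" _ "c2 @ rev s"] False that
            by (simp add: idx_length)
          then show ?thesis using that m True x by (simp add: part_op_def)
        next
          case False
          then show ?thesis using off that x by simp
        qed
      qed
      show ?thesis unfolding Us
      proof (rule delete_step[OF _ l, where w = "\<lambda>x. of_bool (x ! 0 = x ! 1)" and f = f and r = r and ?x0.0 = "[0, 0]"])
        show "h \<in> Gam" if H: "\<And>x. x \<in> idx N (Suc (Suc 0)) \<Longrightarrow>
          (\<Sum>x'\<in>idx N (Suc (Suc 0)). of_bool (x' ! 0 = x' ! 1) *s wprod [U, W] x x') = of_bool (x ! 0 = x ! 1) *s h" for h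
        proof (rule Gam_pair[OF LU])
          fix i j assume "i < N" "j < N"
          then show "(\<Sum>k<N. U i k * W j k) = of_bool (i = j) * h"
            using H[of "[i, j]"] sum_idx_diag[where \<phi> = scale and N = N and G = "wprod [U, W] [i, j]"]
            by (cases "i = j") simp_all
        qed
        show "(\<Sum>x\<in>idx N (Suc (Suc 0)). of_bool (x ! 0 = x ! 1) * of_bool (x ! 0 = x ! 1)) \<noteq> (0 :: complex)"
          unfolding sum_idx_diag[where \<phi> = "(*)" and G = "\<lambda>x. of_bool (x ! 0 = x ! 1)", OF mult_zero_left] using N0 by simp
      qed (use L Us N0 nc_delete_pair[OF N0] sp e tq indep r nz in auto)
    next
      case True
      then obtain x0 where x0: "x0 < ?n" "merge_label p f (skip p x0) = merge_label p f p" by blast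
      \<comment> \<open>The further point \<open>x0\<close> of the block forces the common index of
        the pair. So the traced map is diagonal, with entries \<open>\<kappa> k\<close> at
        \<open>[k, k]\<close> and zero elsewhere.\<close>
      have det: "k = l" if "agrees f (c1 @ k # k # c2 @ rev s)" "agrees f (c1 @ l # l # c2 @ rev s)"
        "c1 \<in> idx N p" "c2 \<in> idx N q" "s \<in> idx N (p + (Suc (Suc 0) + q))" for k l c1 c2 s
        using that x0 agrees_insert[of c1 p "merge_label p f" _ "c2 @ rev s"] m by (auto simp: idx_length)
      have bi_unitary: "\<And>V. V \<in> set (Us1 @ [U, W] @ Us2) \<Longrightarrow> bi_unitary {..<N} V" using L Us letter_uni by blast
      define \<kappa> where "\<kappa> k = (\<Sum>c2\<in>idx N q. \<Sum>c1\<in>idx N p. \<Sum>s\<in>idx N (p + (Suc (Suc 0) + q)). of_bool (agrees f ((c1 @ [k, k] @ c2) @ rev s)) :: complex)" for k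
      have \<kappa>: "\<kappa> k \<noteq> 0" if "k < N" for k
      proof -
        have "agrees f ((replicate p k @ [k, k] @ replicate q k) @ rev (replicate (p + (Suc (Suc 0) + q)) k))"
        proof -
          have "(replicate p k @ [k, k] @ replicate q k) @ rev (replicate (p + (Suc (Suc 0) + q)) k)
            = replicate (2 * (p + (Suc (Suc 0) + q))) k"
            by (rule replicate_eqI) (auto split: if_splits)
          then show ?thesis by (simp only: agrees_replicate)
        qed
        then show ?thesis unfolding \<kappa>_def
          using that by (intro sum_of_bool_nonzero) (auto intro: idx_replicate)
      qed
      define E where "E x x' = (of_bool (x ! 0 = x ! 1 \<and> x' = x) * \<kappa> (x ! 0))" for x x'
      have tr: "(\<Sum>c2\<in>idx N q. \<Sum>c1\<in>idx N p. \<Sum>s\<in>idx N (p + (Suc (Suc 0) + q)).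
        part_op f s (c1 @ x @ c2) * part_op f s (c1 @ x' @ c2)) = E x x'"
        if "x \<in> idx N (Suc (Suc 0))" "x' \<in> idx N (Suc (Suc 0))" for x x'
      proof -
        from pair[OF that(1)] pair[OF that(2)] obtain k l k' l' where x: "x = [k, l]" "x' = [k', l']" by blast
        show ?thesis
        proof (cases "k = l \<and> k' = l' \<and> k = k'")
          case True
          then have kl: "l = k" "k' = k" "l' = k" by auto
          have "(\<Sum>c2\<in>idx N q. \<Sum>c1\<in>idx N p. \<Sum>s\<in>idx N (p + (Suc (Suc 0) + q)).
            part_op f s (c1 @ x @ c2) * part_op f s (c1 @ x' @ c2)) = \<kappa> k"
            unfolding \<kappa>_def by (intro sum.cong refl) (simp add: x kl part_op_def)
          then show ?thesis by (simp add: x kl E_def)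
        next
          case False
          have "part_op f s (c1 @ x @ c2) * part_op f s (c1 @ x' @ c2) = 0"
            if "c2 \<in> idx N q" "c1 \<in> idx N p" "s \<in> idx N (p + (Suc (Suc 0) + q))" for c1 c2 s
          proof (cases "k = l \<and> k' = l'")
            case True
            then show ?thesis using det[of c1 k c2 s k'] that False by (auto simp: x part_op_def)
          next
            case False
            then show ?thesis using off[OF that(2)] by (auto simp: x)
          qed
          then have "(\<Sum>c2\<in>idx N q. \<Sum>c1\<in>idx N p. \<Sum>s\<in>idx N (p + (Suc (Suc 0) + q)).
            part_op f s (c1 @ x @ c2) * part_op f s (c1 @ x' @ c2)) = 0"
            by (intro sum.neutral ballI) blast
          moreover have "E x x' = 0" using False by (auto simp: E_def x)
          ultimately show ?thesis by simp
        qed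
      qed
      have e': "endo (idx N (p + (Suc (Suc 0) + q))) (wprod (Us1 @ [U, W] @ Us2)) (part_op f)"
        using e tq Us by simp
      have "endo (idx N (Suc (Suc 0))) (wprod [U, W]) (\<lambda>x x'. \<Sum>c2\<in>idx N q. \<Sum>c1\<in>idx N p. \<Sum>s\<in>idx N (p + (Suc (Suc 0) + q)).
          part_op f s (c1 @ x @ c2) * part_op f s (c1 @ x' @ c2))"
        using endo_part_op_traced[OF _ l e'] bi_unitary by blast
      then have E: "endo (idx N (Suc (Suc 0))) (wprod [U, W]) E"
        by (rule endo_cong[THEN iffD1, rotated]) (rule tr)
      \<comment> \<open>Commuting with a diagonal matrix can be tested on single products:
        \<open>U i k * W j l\<close> survives only if \<open>i = j\<close> and \<open>k = l\<close>
        hold together or fail together.\<close>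
      have rel: "(of_bool (k = l) * \<kappa> k) *s (U i k * W j l) = (of_bool (i = j) * \<kappa> i) *s (U i k * W j l)"
        if "i < N" "j < N" "k < N" "l < N" for i j k l
      proof -
        have kl: "[k, l] \<in> idx N (Suc (Suc 0))" "[i, j] \<in> idx N (Suc (Suc 0))" using that by auto
        have 1: "(\<Sum>x\<in>idx N (Suc (Suc 0)). E x [k, l] *s wprod [U, W] [i, j] x) = (of_bool (k = l) * \<kappa> k) *s (U i k * W j l)"
        proof -
          have "(\<Sum>x\<in>idx N (Suc (Suc 0)). E x [k, l] *s wprod [U, W] [i, j] x)
            = (\<Sum>x\<in>idx N (Suc (Suc 0)). (of_bool (x = [k, l])) *s ((of_bool (k = l) * \<kappa> k) *s wprod [U, W] [i, j] x))"
            by (intro sum.cong refl) (auto simp: E_def)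
          also have "\<dots> = 1 *s ((of_bool (k = l) * \<kappa> k) *s wprod [U, W] [i, j] [k, l])"
            by (rule sum_idx_point[where \<phi> = scale, OF scale_zero_left kl(1)])
          finally show ?thesis by simp
        qed
        have 2: "(\<Sum>x\<in>idx N (Suc (Suc 0)). E [i, j] x *s wprod [U, W] x [k, l]) = (of_bool (i = j) * \<kappa> i) *s (U i k * W j l)"
        proof -
          have "(\<Sum>x\<in>idx N (Suc (Suc 0)). E [i, j] x *s wprod [U, W] x [k, l])
            = (\<Sum>x\<in>idx N (Suc (Suc 0)). (of_bool (x = [i, j])) *s ((of_bool (i = j) * \<kappa> i) *s wprod [U, W] x [k, l]))"
            by (intro sum.cong refl) (auto simp: E_def)
          also have "\<dots> = 1 *s ((of_bool (i = j) * \<kappa> i) *s wprod [U, W] [i, j] [k, l])"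
            by (rule sum_idx_point[where \<phi> = scale, OF scale_zero_left kl(2)])
          finally show ?thesis by simp
        qed
        show ?thesis using endoD[OF E kl(2) kl(1)] unfolding 1 2 .
      qed
      have z1: "U i k * W j k = 0" if "i < N" "j < N" "k < N" "i \<noteq> j" for i j k
        using rel[of i j k k] \<kappa>[of k] that by simp
      have z2: "U i k * W i l = 0" if "i < N" "k < N" "l < N" "k \<noteq> l" for i k l
        using rel[of i i k l] \<kappa>[of i] that by simp
      have LM: "L (\<lambda>i k. U i k * W i k)" by (rule letter_merge[OF LU z1 z2])
      show ?thesis unfolding Us
      \<comment> \<open>Merging splits nothing off, hence \<open>h = 1\<close>. The map
        \<open>v\<close> sends the basis vector \<open>[k, k]\<close> to \<open>[k]\<close> and
        annihilates the other ones.\<close>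
      proof (rule local_step[where Ms' = "[\<lambda>i k. U i k * W i k]" and b = "Suc 0" and h = 1 and v = "\<lambda>y x. of_bool (x = [hd y, hd y])"
            and c = 1 and Y = "\<lambda>c1 y c2. part_op f r (c1 @ [hd y, hd y] @ c2)" and r = r and f = f, OF _ _ l])
        fix x y assume xy: "x \<in> idx N (Suc (Suc 0))" "y \<in> idx N (Suc 0)"
        obtain i j where x: "x = [i, j]" "i < N" "j < N" using pair[OF xy(1)] by blast
        obtain k where y: "y = [k]" "k < N" using xy(2) by (metis idx_SucE idx_0 singletonD)
        have kk: "[hd y, hd y] \<in> idx N (Suc (Suc 0))" using y by simp
        have s: "(\<Sum>y'\<in>idx N (Suc 0). of_bool (x = [hd y', hd y']) *s F y') = (if i = j then F [i] else 0)" for F :: "nat list \<Rightarrow> 'a"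
        proof -
          have "(\<Sum>y'\<in>idx N (Suc 0). of_bool (x = [hd y', hd y']) *s F y') = (\<Sum>k<N. if k = i then (if i = j then F [k] else 0) else 0)"
            unfolding sum_idx_1 by (intro sum.cong refl) (auto simp: x)
          then show ?thesis using x by simp
        qed
        show "(\<Sum>x'\<in>idx N (Suc (Suc 0)). of_bool (x' = [hd y, hd y]) *s wprod [U, W] x x') =
          (\<Sum>y'\<in>idx N (Suc 0). of_bool (x = [hd y', hd y']) *s (wprod [\<lambda>i k. U i k * W i k] y' y * 1))"
          unfolding s using sum_idx_point[where \<phi> = scale, OF _ kk] z1 x y by simp
        show "(\<Sum>x'\<in>idx N (Suc (Suc 0)). of_bool (x' = [hd y, hd y]) *s wprod [U, W] x' x) =
          (\<Sum>y'\<in>idx N (Suc 0). of_bool (x = [hd y', hd y']) *s (wprod [\<lambda>i k. U i k * W i k] y y' * 1))"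
          unfolding s using sum_idx_point[where \<phi> = scale, OF _ kk] z2 x y by simp
      next
        fix y y' assume "y \<in> idx N (Suc 0)" "y' \<in> idx N (Suc 0)"
        then obtain k l where y: "y = [k]" "k < N" "y' = [l]" "l < N" by (metis idx_SucE idx_0 singletonD)
        have kk: "[hd y, hd y] \<in> idx N (Suc (Suc 0))" using y by simp
        show "(\<Sum>x\<in>idx N (Suc (Suc 0)). of_bool (x = [hd y, hd y]) * of_bool (x = [hd y', hd y'])) = of_bool (y = y') * (1 :: complex)"
          using sum_idx_point[where \<phi> = "(*)", OF mult_zero_left kk, of "\<lambda>x. of_bool (x = [hd y', hd y'])"] y by simp
      next
        fix c1 x c2 assume *: "c1 \<in> idx N p" "x \<in> idx N (Suc (Suc 0))" "c2 \<in> idx N q"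
        obtain i j where x: "x = [i, j]" "i < N" "j < N" using pair[OF *(2)] by blast
        have "(\<Sum>y\<in>idx N (Suc 0). part_op f r (c1 @ [hd y, hd y] @ c2) * of_bool (x = [hd y, hd y]))
           = (\<Sum>k<N. if k = i then (if i = j then part_op f r (c1 @ [k, k] @ c2) else 0) else 0)"
          unfolding sum_idx_1 by (intro sum.cong refl) (auto simp: x)
        then show "part_op f r (c1 @ x @ c2) = (\<Sum>y\<in>idx N (Suc 0). part_op f r (c1 @ [hd y, hd y] @ c2) * of_bool (x = [hd y, hd y]))"
          using x off[OF *(1)] by auto
      qed (use L Us LM Gam_one nc_merge_pair sp tq nz in auto)
    qed
  qed
qed

theorem semi_inv_in_Gam:
  assumes "\<And>U. U \<in> set Us \<Longrightarrow> L U" "spanned TYPE('l) N Us"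
    and "i \<in> idx N (length Us)" "\<zeta> i \<noteq> 0"
    and "semi_inv (idx N (length Us)) (wprod Us) \<zeta> g"
  shows "g \<in> Gam"
  using assms
proof (induction "length Us" arbitrary: Us \<zeta> g i rule: less_induct)
  case less
  define t where "t = length Us"
  note L = less.prems(1) and sp = less.prems(2) and i = less.prems(3,4) and si = less.prems(5)
  show ?case
  proof (cases "t = 0")
    case True
    then have "\<zeta> [] *s 1 = \<zeta> [] *s g" "\<zeta> [] \<noteq> 0" using si i by (auto simp: semi_inv_def t_def)
    then have "g = 1" by (metis scale_cancel_left)
    then show ?thesis using Gam_one by simp
  next
    case False
    have U: "bi_unitary (idx N t) (wprod Us)" using bi_unitary_wprod[of Us N] L letter_uni by (auto simp: t_def)
    have gg: "g * star g = 1" using semi_inv_unitary(2)[OF U si[folded t_def] i[folded t_def]] .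
    have ez: "endo (idx N t) (wprod Us) (\<lambda>r c. \<zeta> r * cnj (\<zeta> c))"
      by (rule semi_inv_endo[OF U si[folded t_def] gg])
    obtain qs :: "(complex \<times> (nat \<Rightarrow> 'l)) list" where
      nc: "\<And>\<kappa> f. (\<kappa>, f) \<in> set qs \<Longrightarrow> nc_labelling (2 * t) f"
      and en: "\<And>\<kappa> f. (\<kappa>, f) \<in> set qs \<Longrightarrow> endo (idx N t) (wprod Us) (part_op f)"
      and qs: "\<And>r c. r \<in> idx N t \<Longrightarrow> c \<in> idx N t \<Longrightarrow> \<zeta> r * cnj (\<zeta> c) = (\<Sum>(\<kappa>, f)\<leftarrow>qs. \<kappa> * part_op f r c)"
      using spannedE[OF sp ez[unfolded t_def]] unfolding t_def by blast
    define rain where "rain f \<longleftrightarrow> (\<forall>p. \<not> reducible_at t f p) \<and> (\<forall>p. \<not> reducible_at t (rev_label (2 * t) f) p)"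
      for f :: "nat \<Rightarrow> 'l"
    define Q where "Q f x y = (\<Sum>r\<in>idx N t. \<Sum>c\<in>idx N t. x r * part_op f r c * y c)" for f :: "nat \<Rightarrow> 'l" and x y
    \<comment> \<open>The total coefficient of the identity map, which several labellings in the
      expansion may represent.\<close>
    define C where "C = (\<Sum>(\<kappa>, f)\<leftarrow>qs. \<kappa> * of_bool (rain f))"
    have quad: "(\<Sum>r\<in>idx N t. x r * \<zeta> r) * (\<Sum>c\<in>idx N t. cnj (\<zeta> c) * y c) = (\<Sum>(\<kappa>, f)\<leftarrow>qs. \<kappa> * Q f x y)" for x y
    proof -
      have "(\<Sum>r\<in>idx N t. x r * \<zeta> r) * (\<Sum>c\<in>idx N t. cnj (\<zeta> c) * y c)
        = (\<Sum>r\<in>idx N t. \<Sum>c\<in>idx N t. x r * (\<zeta> r * cnj (\<zeta> c)) * y c)"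
        by (simp add: sum_product mult.assoc)
      also have "\<dots> = (\<Sum>r\<in>idx N t. \<Sum>c\<in>idx N t. x r * (\<Sum>(\<kappa>, f)\<leftarrow>qs. \<kappa> * part_op f r c) * y c)"
        by (intro sum.cong refl) (simp add: qs)
      also have "\<dots> = (\<Sum>(\<kappa>, f)\<leftarrow>qs. \<kappa> * Q f x y)"
      proof (induction qs)
        case (Cons q qs)
        obtain \<kappa> f where "q = (\<kappa>, f)" by (cases q)
        then show ?case using Cons by (simp add: algebra_simps sum.distrib Q_def sum_distrib_left)
      qed simp
      finally show ?thesis .
    qed
    have Q_rain: "Q f x y = (\<Sum>r\<in>idx N t. x r * y r)" if "rain f" "(\<kappa>, f) \<in> set qs" for f x y \<kappa>
    proof -
      have "Q f x y = (\<Sum>r\<in>idx N t. \<Sum>c\<in>idx N t. if c = r then x r * y c else 0)"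
        unfolding Q_def
        using part_op_rainbow[OF nc[OF that(2)]] that(1)
        by (intro sum.cong refl) (auto simp: rain_def idx_length)
      then show ?thesis by simp
    qed
    have Q_rev: "Q f x y = (\<Sum>c\<in>idx N t. y c * (\<Sum>r\<in>idx N t. part_op (rev_label (2 * t) f) c r * x r))" for f x y
    proof -
      have "Q f x y = (\<Sum>c\<in>idx N t. \<Sum>r\<in>idx N t. x r * part_op f r c * y c)"
        unfolding Q_def by (rule sum.swap)
      also have "\<dots> = (\<Sum>c\<in>idx N t. \<Sum>r\<in>idx N t. y c * (part_op (rev_label (2 * t) f) c r * x r))"
        by (intro sum.cong refl) (simp add: part_op_rev_label idx_length)
      finally show ?thesis by (simp add: sum_distrib_left)
    qed
    have Q_fwd: "Q f x y = (\<Sum>r\<in>idx N t. x r * (\<Sum>c\<in>idx N t. part_op f r c * y c))" for f x y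
      by (simp add: Q_def sum_distrib_left mult.assoc)
    have Q_alt: "Q f (alternating s) (alternating s') = 0" if nr: "\<not> rain f" for f s s'
    proof -
      consider p where "reducible_at t f p" | p where "reducible_at t (rev_label (2 * t) f) p"
        using nr by (auto simp: rain_def)
      then show ?thesis
      proof cases
        case 1
        then show ?thesis unfolding Q_fwd using reducible_test[OF N4 1] by (simp add: mult.commute)
      next
        case 2
        then show ?thesis unfolding Q_rev using reducible_test[OF N4 2] by (simp add: mult.commute)
      qed
    qed
    \<comment> \<open>For vectors to which the other labellings contribute nothing, only the
      identity part of the expansion is left.\<close>
    have total: "(\<Sum>r\<in>idx N t. x r * \<zeta> r) * (\<Sum>c\<in>idx N t. cnj (\<zeta> c) * y c) = C * (\<Sum>r\<in>idx N t. x r * y r)"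
      if "\<And>\<kappa> f. (\<kappa>, f) \<in> set qs \<Longrightarrow> \<not> rain f \<Longrightarrow> Q f x y = 0" for x y
    proof -
      have "(\<Sum>(\<kappa>, f)\<leftarrow>qs. \<kappa> * Q f x y) = (\<Sum>(\<kappa>, f)\<leftarrow>qs. \<kappa> * of_bool (rain f) * (\<Sum>r\<in>idx N t. x r * y r))"
      proof (rule arg_cong[of _ _ sum_list], rule map_cong[OF refl], clarify)
        fix \<kappa> f assume "(\<kappa>, f) \<in> set qs"
        then show "\<kappa> * Q f x y = \<kappa> * of_bool (rain f) * (\<Sum>r\<in>idx N t. x r * y r)"
          using that Q_rain by (cases "rain f") auto
      qed
      also have "\<dots> = C * (\<Sum>r\<in>idx N t. x r * y r)"
        unfolding C_def by (simp add: sum_list_mult_const[symmetric] case_prod_unfold)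
      finally show ?thesis unfolding quad .
    qed
    have C0: "C = 0"
    proof -
      let ?z = "\<lambda>s. (\<Sum>r\<in>idx N t. alternating s r * \<zeta> r)"
      let ?w = "\<lambda>s. (\<Sum>c\<in>idx N t. cnj (\<zeta> c) * alternating s c)"
      have 1: "?z s * ?w s' = C * (\<Sum>r\<in>idx N t. alternating s r * alternating s' r)" for s s'
        by (rule total) (rule Q_alt)
      have "(\<Sum>r\<in>idx N t. alternating True r * alternating False r) = 0"
        using False by (intro sum.neutral ballI alternating_orthogonal) (auto simp: idx_def)
      then have a: "?z True * ?w False = 0" using 1[of True False] by simp
      have b: "?z s * ?w s = C * 2 ^ t" for s
        using 1[of s s] sum_alternating_square[OF N4] by simp
      \<comment> \<open>A matrix of rank one has determinant zero: the product of the diagonal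
        values equals that of the off-diagonal ones, one of which vanishes by orthogonality.\<close>
      have "(C * 2 ^ t) * (C * 2 ^ t) = (?z True * ?w True) * (?z False * ?w False)" by (simp only: b)
      also have "\<dots> = (?z True * ?w False) * (?w True * ?z False)" by (simp only: mult_ac)
      also have "\<dots> = 0" by (simp only: a mult_zero_left)
      finally have "(C * 2 ^ t) * (C * 2 ^ t) = 0" .
      then show "C = 0" by simp
    qed
    define n where "n = (\<Sum>r\<in>idx N t. cnj (\<zeta> r) * \<zeta> r)"
    have "(\<Sum>r\<in>idx N t. (cmod (\<zeta> r))\<^sup>2) > 0"
      using i by (intro sum_pos2[of _ i]) (auto simp: t_def)
    moreover have "n = of_real (\<Sum>r\<in>idx N t. (cmod (\<zeta> r))\<^sup>2)"
      unfolding n_def of_real_sum by (intro sum.cong refl) (metis complex_norm_square mult.commute)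
    ultimately have n0: "n \<noteq> 0" by (metis less_irrefl of_real_eq_0_iff)
    \<comment> \<open>At \<open>\<zeta>\<close> itself the form takes the value
      \<open>n * n\<close>, which the identity, having total coefficient \<open>0\<close>, cannot
      produce.\<close>
    have "\<exists>\<kappa> f. (\<kappa>, f) \<in> set qs \<and> \<not> rain f \<and> Q f (\<lambda>r. cnj (\<zeta> r)) \<zeta> \<noteq> 0"
    proof (rule ccontr)
      assume "\<not> ?thesis"
      then have "n * n = C * n"
        unfolding n_def by (intro total) auto
      then show False using n0 C0 by simp
    qed
    then obtain \<kappa> f where f: "(\<kappa>, f) \<in> set qs" "\<not> rain f" "Q f (\<lambda>r. cnj (\<zeta> r)) \<zeta> \<noteq> 0" by blast
    have "reducible_to TYPE('l) Us \<zeta>"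
    proof -
      consider p where "reducible_at t f p" | p where "reducible_at t (rev_label (2 * t) f) p"
        using f(2) by (auto simp: rain_def)
      then show ?thesis
      proof cases
        case 1
        obtain r where "r \<in> idx N t" "(\<Sum>c\<in>idx N t. part_op f r c * \<zeta> c) \<noteq> 0"
          using f(3) unfolding Q_fwd by (metis (no_types, lifting) mult_zero_right sum.neutral)
        then show ?thesis
          using reduce_step[OF L _ sp en[OF f(1)] 1] t_def by blast
      next
        case 2
        \<comment> \<open>A reducible point of the lower row becomes one of the upper row for the
          adjoint. Entries of partition maps are real, so conjugation shows that the reversed map
          does not annihilate \<open>\<zeta>\<close>.\<close>
        let ?f = "rev_label (2 * t) f"
        obtain r where r: "r \<in> idx N t" "(\<Sum>c\<in>idx N t. part_op ?f r c * cnj (\<zeta> c)) \<noteq> 0"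
          using f(3) unfolding Q_rev by (metis (no_types, lifting) mult_zero_right sum.neutral)
        have "cnj (\<Sum>c\<in>idx N t. part_op ?f r c * \<zeta> c) = (\<Sum>c\<in>idx N t. part_op ?f r c * cnj (\<zeta> c))"
          by (simp add: part_op_def)
        then have nz: "(\<Sum>c\<in>idx N t. part_op ?f r c * \<zeta> c) \<noteq> 0" using r by (metis complex_cnj_zero)
        have "endo (idx N t) (wprod Us) (\<lambda>r c. cnj (part_op f c r))"
          by (rule endo_adjoint[OF U en[OF f(1)]])
        then have "endo (idx N t) (wprod Us) (part_op ?f)"
          by (rule endo_cong[THEN iffD1, rotated]) (simp add: part_op_rev_label idx_length cnj_part_op)
        then show ?thesis
          using reduce_step[OF L _ sp _ 2 r(1) nz] t_def by blast
      qed
    qed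
    then obtain Us' V h where s: "length Us' < length Us" "\<forall>U\<in>set Us'. L U" "spanned TYPE('l) N Us'"
      "h \<in> Gam" "star h * h = 1" "h * star h = 1"
      and c: "contraction (idx N (length Us)) (wprod Us) (idx N (length Us')) (wprod Us') V h (star h)"
      and nz: "\<exists>i\<in>idx N (length Us'). (\<Sum>k\<in>idx N (length Us). V i k * \<zeta> k) \<noteq> 0"
      unfolding reducible_to_def by blast
    obtain i' where i': "i' \<in> idx N (length Us')" "(\<Sum>k\<in>idx N (length Us). V i' k * \<zeta> k) \<noteq> 0" using nz by blast
    \<comment> \<open>The induction hypothesis is applied to the shorter word; the split-off factor
      is put back afterwards.\<close>
    have "g * star h \<in> Gam"
      using less.hyps[OF s(1) _ s(3) i' contraction_vec[OF c si]] s(2) by blast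
    then have "g * star h * h \<in> Gam" using Gam_mult s(4) by blast
    then show ?thesis using s(5) by (simp add: mult.assoc)
  qed
qed

end

section \<open>The representations spanned by block vectors\<close>

lemma replicate_snoc: "replicate (Suc n) x = replicate n x @ [x]"
  by (simp add: replicate_append_same)

context complex_star_algebra
begin

section \<open>Integer powers of a unitary and adjoints of words\<close>

definition zpow :: "'a \<Rightarrow> int \<Rightarrow> 'a" where
  "zpow \<gamma> n = (if n \<ge> 0 then \<gamma> ^ nat n else star \<gamma> ^ nat (- n))"

lemma zpow_0 [simp]: "zpow \<gamma> 0 = 1" and zpow_1 [simp]: "zpow \<gamma> 1 = \<gamma>" and zpow_m1 [simp]: "zpow \<gamma> (-1) = star \<gamma>"
  by (simp_all add: zpow_def)

lemma zpow_Suc: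
  assumes "\<gamma> * star \<gamma> = 1"
  shows "zpow \<gamma> (n + 1) = \<gamma> * zpow \<gamma> n"
proof (cases "n \<ge> 0")
  case True
  then show ?thesis by (simp add: zpow_def nat_add_distrib)
next
  case False
  define m where "m = nat (- n - 1)"
  have n: "n = - int m - 1" using False by (simp add: m_def)
  have "zpow \<gamma> n = star \<gamma> ^ Suc m" using n by (simp add: zpow_def nat_add_distrib)
  moreover have "zpow \<gamma> (n + 1) = star \<gamma> ^ m" using n by (simp add: zpow_def)
  ultimately show ?thesis using assms by (simp add: mult.assoc[symmetric])
qed

lemma zpow_pred:
  assumes "star \<gamma> * \<gamma> = 1" "\<gamma> * star \<gamma> = 1"
  shows "zpow \<gamma> (n - 1) = star \<gamma> * zpow \<gamma> n"
  using zpow_Suc[OF assms(2), of "n - 1"] assms(1) by (simp add: mult.assoc[symmetric])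

lemma zpow_add:
  assumes g: "star \<gamma> * \<gamma> = 1" "\<gamma> * star \<gamma> = 1"
  shows "zpow \<gamma> (m + n) = zpow \<gamma> m * zpow \<gamma> n"
proof (induction m rule: int_induct[of _ 0])
  case (step1 i)
  then show ?case using zpow_Suc[OF g(2), of i] zpow_Suc[OF g(2), of "i + n"] by (simp add: add_ac mult.assoc)
next
  case (step2 i)
  then show ?case using zpow_pred[OF g, of i] zpow_pred[OF g, of "i + n"] by (simp add: algebra_simps)
qed simp

lemma star_power: "star (x ^ n) = star x ^ n"
  by (induction n) (simp_all add: star_mult power_commutes)

lemma star_zpow: "star (zpow \<gamma> n) = zpow \<gamma> (- n)"
  by (auto simp: zpow_def star_power star_star)

lemma commute_zpow:
  assumes "x * \<gamma> = \<gamma> * x" "x * star \<gamma> = star \<gamma> * x"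
  shows "x * zpow \<gamma> n = zpow \<gamma> n * x"
  using assms by (simp add: zpow_def power_commuting_commutes)

lemma star_wprod:
  assumes "length is = length Us" "length js = length Us"
  shows "star (wprod Us is js) = wprod (rev (map (\<lambda>U i j. star (U i j)) Us)) (rev is) (rev js)"
  using assms
proof (induction Us arbitrary: "is" js)
  case (Cons U Us)
  obtain i is' j js' where *: "is = i # is'" "js = j # js'" using Cons.prems by (metis length_Suc_conv)
  then show ?case using Cons by (simp add: star_mult wprod_append)
qed simp

definition coloured_entry :: "(nat \<Rightarrow> nat \<Rightarrow> 'a) \<Rightarrow> colour \<Rightarrow> nat \<Rightarrow> nat \<Rightarrow> 'a" where
  "coloured_entry v c = (case c of White \<Rightarrow> v | Black \<Rightarrow> \<lambda>i j. star (v i j))"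

lemma wprod_replicate: "wprod (replicate n U) (replicate n i) (replicate n j) = U i j ^ n"
  by (induction n) simp_all

end

section \<open>Block relations between the entries of \<open>u\<close>\<close>

locale biunitary_matrix = complex_star_algebra scale star
  for scale :: "complex \<Rightarrow> 'a::ring_1 \<Rightarrow> 'a" (infixr \<open>*s\<close> 75) and star :: "'a \<Rightarrow> 'a" +
  fixes N :: nat and u :: "nat \<Rightarrow> nat \<Rightarrow> 'a"
  assumes u_uni: "bi_unitary {..<N} u" and N4: "N \<ge> 4"
begin

abbreviation colour_letter :: "colour \<Rightarrow> nat \<Rightarrow> nat \<Rightarrow> 'a" where
  "colour_letter \<equiv> coloured_entry u"

abbreviation word :: "colour list \<Rightarrow> nat list \<Rightarrow> nat list \<Rightarrow> 'a" where
  "word w \<equiv> wprod (map colour_letter w)"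

lemma bi_unitary_colour_letter: "bi_unitary {..<N} (colour_letter c)"
  using u_uni by (cases c) (auto simp: coloured_entry_def bi_unitary_def star_star)

lemma bi_unitary_word: "bi_unitary (idx N (length w)) (word w)"
  using bi_unitary_wprod[of "map colour_letter w" N] bi_unitary_colour_letter by auto

lemma colour_letter_flip: "colour_letter (flip c) i j = star (colour_letter c i j)"
  by (cases c) (auto simp: coloured_entry_def star_star)

lemma star_word:
  assumes "length is = length w" "length js = length w"
  shows "star (word w is js) = word (rev (map flip w)) (rev is) (rev js)"
proof -
  have "colour_letter (flip c) = (\<lambda>i j. star (colour_letter c i j))" for c
    by (intro ext colour_letter_flip)
  then have "rev (map (\<lambda>U i j. star (U i j)) (map colour_letter w)) = map colour_letter (rev (map flip w))"
    by (simp add: rev_map comp_def)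
  then show ?thesis using star_wprod[of "is" "map colour_letter w" js] assms by simp
qed

lemma word_append:
  assumes "length is = length w" "length js = length w"
  shows "word (w @ w') (is @ is') (js @ js') = word w is js * word w' is' js'"
  using wprod_append[of "is" "map colour_letter w" js "map colour_letter w'"] assms by simp

definition all_equal :: "nat list \<Rightarrow> bool" where
  "all_equal is \<longleftrightarrow> is = replicate (length is) (hd is)"

lemma all_equal_replicate [simp]: "all_equal (replicate n k)"
  by (cases n) (auto simp: all_equal_def)

lemma all_equalE: "all_equal is \<Longrightarrow> is \<in> idx N n \<Longrightarrow> n > 0 \<Longrightarrow> (\<And>k. k < N \<Longrightarrow> is = replicate n k \<Longrightarrow> thesis) \<Longrightarrow> thesis"
proof -
  assume *: "all_equal is" "is \<in> idx N n" "n > 0" "\<And>k. k < N \<Longrightarrow> is = replicate n k \<Longrightarrow> thesis"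
  have "hd is \<in> set is" using *(2,3) by (intro hd_in_set) (auto simp: idx_def)
  then have "hd is < N" using *(2) by (auto simp: idx_def)
  then show thesis using *(1,2) by (intro *(4)[of "hd is"]) (auto simp: all_equal_def idx_def)
qed

lemma all_equal_iff_nth: "all_equal is \<longleftrightarrow> (\<forall>x\<in>set is. x = hd is)"
  unfolding all_equal_def by (metis replicate_eqI in_set_replicate)

lemma all_equal_rev: "all_equal (rev is) \<longleftrightarrow> all_equal is"
proof (cases "is = []")
  case False
  show ?thesis
  proof
    assume "all_equal is" then show "all_equal (rev is)" by (metis all_equal_def all_equal_replicate rev_replicate)
  next
    assume "all_equal (rev is)" then show "all_equal is" by (metis all_equal_def all_equal_replicate rev_replicate rev_rev_ident)
  qed
qed simp

text \<open>The block vector \<open>\<Sum>\<^sub>k e\<^sub>k \<otimes> \<dots> \<otimes> e\<^sub>k\<close> in the word \<open>w\<close> spans the one-dimensional representation \<open>g\<close>.\<close>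

definition block_rel :: "colour list \<Rightarrow> 'a \<Rightarrow> bool" where
  "block_rel w g \<longleftrightarrow> w \<noteq> [] \<and>
     (\<forall>is\<in>idx N (length w). (\<Sum>k<N. word w is (replicate (length w) k)) = of_bool (all_equal is) * g)"

lemma block_relD: "block_rel w g \<Longrightarrow> is \<in> idx N (length w) \<Longrightarrow>
    (\<Sum>k<N. word w is (replicate (length w) k)) = of_bool (all_equal is) * g"
  by (simp add: block_rel_def)

lemma sum_all_equal:
  assumes "n > 0"
  shows "(\<Sum>x\<in>idx N n. of_bool (all_equal x) *s F x) = (\<Sum>k<N. F (replicate n k))"
proof -
  have "(\<Sum>x\<in>idx N n. of_bool (all_equal x) *s F x) = (\<Sum>x\<in>(\<lambda>k. replicate n k) ` {..<N}. of_bool (all_equal x) *s F x)"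
  proof (rule sum.mono_neutral_right)
    show "\<forall>x\<in>idx N n - (\<lambda>k. replicate n k) ` {..<N}. of_bool (all_equal x) *s F x = 0"
    proof
      fix x assume x: "x \<in> idx N n - (\<lambda>k. replicate n k) ` {..<N}"
      have "\<not> all_equal x" using x assms by (auto elim!: all_equalE)
      then show "of_bool (all_equal x) *s F x = 0" by simp
    qed
  qed (auto intro: idx_replicate)
  also have "\<dots> = (\<Sum>k<N. F (replicate n k))"
    using assms by (subst sum.reindex) (auto simp: inj_on_def replicate_eq_replicate)
  finally show ?thesis .
qed

lemma block_rel_semi_inv:
  assumes "block_rel w g"
  shows "semi_inv (idx N (length w)) (word w) (\<lambda>x. of_bool (all_equal x)) g"
  unfolding semi_inv_def
proof
  fix i assume "i \<in> idx N (length w)"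
  then show "(\<Sum>j\<in>idx N (length w). of_bool (all_equal j) *s word w i j) = of_bool (all_equal i) *s g"
    using assms sum_all_equal[of "length w"] by (auto simp: block_rel_def)
qed

lemma block_rel_unitary:
  assumes "block_rel w g"
  shows "star g * g = 1" "g * star g = 1"
proof -
  have "replicate (length w) 0 \<in> idx N (length w)" using N4 by (auto intro: idx_replicate)
  from semi_inv_unitary[OF bi_unitary_word block_rel_semi_inv[OF assms] this]
  show "star g * g = 1" "g * star g = 1" by auto
qed

text \<open>The block vector is real, so \<open>semi_inv_col\<close> turns the row relation into a
  column relation with the same \<open>g\<close>.\<close>

lemma block_rel_col:
  assumes "block_rel w g" "i \<in> idx N (length w)"
  shows "(\<Sum>k<N. word w (replicate (length w) k) i) = of_bool (all_equal i) * g"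
proof -
  have cnj: "cnj (of_bool P) = of_bool P" for P by (cases P) simp_all
  have "length w > 0" using assms by (auto simp: block_rel_def)
  moreover have "(\<Sum>x\<in>idx N (length w). of_bool (all_equal x) *s word w x i) = of_bool (all_equal i) *s g"
    using semi_inv_col[OF bi_unitary_word block_rel_semi_inv[OF assms(1)] block_rel_unitary(2)[OF assms(1)] assms(2)]
    unfolding cnj by auto
  ultimately show ?thesis using sum_all_equal[of "length w" "\<lambda>x. word w x i"] by (auto simp: of_bool_def)
qed

lemma block_rel_unique:
  assumes "block_rel w g" "block_rel w h"
  shows "g = h"
proof -
  have "replicate (length w) 0 \<in> idx N (length w)" using N4 by (auto intro: idx_replicate)
  then show ?thesis using block_relD[OF assms(1)] block_relD[OF assms(2)] by fastforce
qed

text \<open>Give the two letters of opposite colours a common row index and sum over it. Unitarity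
  removes them on one side, while on the other side a single value is compatible with the remaining
  indices. If no other letters remain, both sides consist of \<open>N\<close> equal terms, whence
  \<open>g = 1\<close>.\<close>

lemma block_rel_cancel:
  assumes rel: "block_rel (v1 @ [c, flip c] @ v2) g"
  shows "v1 @ v2 = [] \<and> g = 1 \<or> block_rel (v1 @ v2) g"
proof -
  have W: "(\<Sum>j<N. \<Sum>k<N. word (v1 @ [c, flip c] @ v2) (i1 @ [j, j] @ i2) (replicate (length (v1 @ [c, flip c] @ v2)) k))
    = (\<Sum>k<N. word (v1 @ v2) (i1 @ i2) (replicate (length (v1 @ v2)) k))"
    if i: "i1 \<in> idx N (length v1)" "i2 \<in> idx N (length v2)" for i1 i2
  proof -
    have r: "replicate (length (v1 @ [c, flip c] @ v2)) k = replicate (length v1) k @ [k, k] @ replicate (length v2) k" for k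
      by (rule replicate_eqI[symmetric]) auto
    have r': "replicate (length (v1 @ v2)) k = replicate (length v1) k @ replicate (length v2) k" for k :: nat
      by (simp add: replicate_add)
    have "word (v1 @ [c, flip c] @ v2) (i1 @ [j, j] @ i2) (replicate (length (v1 @ [c, flip c] @ v2)) k)
      = word v1 i1 (replicate (length v1) k) * (colour_letter c j k * star (colour_letter c j k)) * word v2 i2 (replicate (length v2) k)" for j k
      using i unfolding r
      by (subst word_append[of i1 v1 "replicate (length v1) k"]) (simp_all add: idx_length colour_letter_flip mult.assoc)
    then have "(\<Sum>j<N. \<Sum>k<N. word (v1 @ [c, flip c] @ v2) (i1 @ [j, j] @ i2) (replicate (length (v1 @ [c, flip c] @ v2)) k))
      = (\<Sum>j<N. \<Sum>k<N. word v1 i1 (replicate (length v1) k) * (colour_letter c j k * star (colour_letter c j k)) * word v2 i2 (replicate (length v2) k))"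
      by simp
    also have "\<dots> = (\<Sum>k<N. word v1 i1 (replicate (length v1) k) * (\<Sum>j<N. colour_letter c j k * star (colour_letter c j k)) * word v2 i2 (replicate (length v2) k))"
      by (subst sum.swap) (simp add: sum_distrib_left sum_distrib_right)
    also have "\<dots> = (\<Sum>k<N. word (v1 @ v2) (i1 @ i2) (replicate (length (v1 @ v2)) k))"
      using i bi_unitaryD(3)[OF bi_unitary_colour_letter[of c]] unfolding r'
      by (intro sum.cong refl) (simp add: wprod_append idx_length)
    finally show ?thesis .
  qed
  have R: "(\<Sum>j<N. \<Sum>k<N. word (v1 @ [c, flip c] @ v2) (i1 @ [j, j] @ i2) (replicate (length (v1 @ [c, flip c] @ v2)) k))
    = (\<Sum>j<N. of_bool (all_equal (i1 @ [j, j] @ i2)) * g)"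
    if i: "i1 \<in> idx N (length v1)" "i2 \<in> idx N (length v2)" for i1 i2
  proof (rule sum.cong[OF refl])
    fix j assume "j \<in> {..<N}"
    then have "i1 @ [j, j] @ i2 \<in> idx N (length (v1 @ [c, flip c] @ v2))"
      using i by (auto simp: idx_def)
    then show "(\<Sum>k<N. word (v1 @ [c, flip c] @ v2) (i1 @ [j, j] @ i2) (replicate (length (v1 @ [c, flip c] @ v2)) k))
      = of_bool (all_equal (i1 @ [j, j] @ i2)) * g"
      by (rule block_relD[OF rel])
  qed
  show ?thesis
  proof (cases "v1 @ v2 = []")
    case True
    have "(\<Sum>j<N. of_bool (all_equal [j, j]) * g) = (\<Sum>k<N. 1)"
      using W[of "[]" "[]"] R[of "[]" "[]"] True by simp
    moreover have "all_equal [j, j]" for j by (simp add: all_equal_def)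
    ultimately have "of_nat N *s g = of_nat N *s 1"
      using sum_constant_scale[of g "{..<N}"] sum_constant_scale[of 1 "{..<N}"] by simp
    then have "g = 1" using N4 scale_cancel_left by auto
    then show ?thesis using True by simp
  next
    case False
    have "block_rel (v1 @ v2) g"
      unfolding block_rel_def
    proof (intro conjI ballI False)
      fix i assume "i \<in> idx N (length (v1 @ v2))"
      then obtain i1 i2 where i: "i = i1 @ i2" "i1 \<in> idx N (length v1)" "i2 \<in> idx N (length v2)"
        by (metis idx_addE length_append)
      have ne: "i1 @ i2 \<noteq> []" using i False by (auto simp: idx_def)
      define m where "m = hd (i1 @ i2)"
      have m: "m < N" using hd_in_set[OF ne] i by (auto simp: m_def idx_def)
      have "all_equal (i1 @ [j, j] @ i2) \<longleftrightarrow> j = m \<and> all_equal (i1 @ i2)" for j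
        using ne unfolding all_equal_iff_nth m_def by (cases i1; cases i2) auto
      then have "(\<Sum>j<N. of_bool (all_equal (i1 @ [j, j] @ i2)) * g) = (\<Sum>j<N. if j = m then of_bool (all_equal (i1 @ i2)) * g else 0)"
        by (intro sum.cong refl) auto
      then show "(\<Sum>k<N. word (v1 @ v2) i (replicate (length (v1 @ v2)) k)) = of_bool (all_equal i) * g"
        using W[OF i(2,3)] R[OF i(2,3)] m by (simp add: i(1))
    qed
    then show ?thesis ..
  qed
qed

lemma colour_list_cases:
  fixes w :: "colour list"
  assumes "w \<noteq> []"
  obtains c where "w = replicate (length w) c" | v1 c v2 where "w = v1 @ [c, flip c] @ v2"
  using assms
proof (induction w arbitrary: thesis)
  case (Cons a w)
  show ?case
  proof (cases "w = []")
    case True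
    then show ?thesis using Cons.prems(1)[of a] by simp
  next
    case False
    show ?thesis
    proof (rule Cons.IH[OF _ _ False])
      fix c assume c: "w = replicate (length w) c"
      show thesis
      proof (cases "c = a")
        case True
        then show ?thesis using Cons.prems(1)[of a] c by simp
      next
        case ca: False
        obtain w' where "w = c # w'" using c False by (metis length_0_conv replicate_Suc not0_implies_Suc)
        moreover have "c = flip a" using ca by (cases a; cases c) auto
        ultimately show ?thesis using Cons.prems(2)[of "[]" a w'] by simp
      qed
    next
      fix v1 c v2 assume "w = v1 @ [c, flip c] @ v2"
      then show thesis using Cons.prems(2)[of "a # v1" c v2] by simp
    qed
  qed
qed simp

text \<open>Neighbouring letters of opposite colours are cancelled until one colour remains or the
  word is used up.\<close>

lemma block_rel_monochrome:
  assumes "block_rel w g"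
  shows "g = 1 \<or> (\<exists>c n. n > 0 \<and> block_rel (replicate n c) g)"
  using assms
proof (induction "length w" arbitrary: w rule: less_induct)
  case less
  have "w \<noteq> []" using less.prems by (simp add: block_rel_def)
  then show ?case
  proof (cases rule: colour_list_cases)
    case (1 c)
    then show ?thesis using less.prems \<open>w \<noteq> []\<close> by (metis length_greater_0_conv)
  next
    case (2 v1 c v2)
    then consider "g = 1" | "block_rel (v1 @ v2) g" using block_rel_cancel less.prems by blast
    then show ?thesis using less.hyps[of "v1 @ v2"] 2 by cases auto
  qed
qed

lemma block_rel_star:
  assumes "block_rel w g"
  shows "block_rel (rev (map flip w)) (star g)"
  unfolding block_rel_def
proof (intro conjI ballI)
  show "rev (map flip w) \<noteq> []" using assms by (simp add: block_rel_def)
  fix i assume i: "i \<in> idx N (length (rev (map flip w)))"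
  then have ri: "rev i \<in> idx N (length w)" using idx_rev by fastforce
  have li: "length i = length w" using i by (simp add: idx_length)
  have "star (\<Sum>k<N. word w (rev i) (replicate (length w) k)) = star (of_bool (all_equal i) * g)"
    using block_relD[OF assms ri] by (simp add: all_equal_rev)
  then show "(\<Sum>k<N. word (rev (map flip w)) i (replicate (length (rev (map flip w))) k)) = of_bool (all_equal i) * star g"
    using li by (simp add: star_sum star_word of_bool_def if_distrib cong: if_cong)
qed

lemma block_rel_Black:
  assumes "block_rel (replicate n Black) g"
  shows "block_rel (replicate n White) (star g)"
  using block_rel_star[OF assms] by simp

text \<open>Identify the last \<open>e\<close> row indices in the longer relation and sum over them.\<close>

lemma block_rel_diff:
  assumes d: "block_rel (replicate d c) g" and e: "block_rel (replicate e c) h" and ed: "e < d"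
  shows "block_rel (replicate (d - e) c) (g * star h)"
  unfolding block_rel_def
proof (intro conjI ballI)
  show "replicate (d - e) c \<noteq> []" using ed by simp
  have e0: "e > 0" using e by (auto simp: block_rel_def)
  fix i assume "i \<in> idx N (length (replicate (d - e) c))"
  then have i: "i \<in> idx N (d - e)" by simp
  define m where "m = hd i"
  have ne: "i \<noteq> []" using i ed by (auto simp: idx_def)
  have m: "m < N" using hd_in_set[OF ne] i by (auto simp: m_def idx_def)
  have "d - e + e = d" using ed by simp
  note rd = replicate_add[of "d - e" e, unfolded this]
  have "(\<Sum>j<N. \<Sum>k<N. word (replicate d c) (i @ replicate e j) (replicate d k)) = (\<Sum>j<N. of_bool (all_equal (i @ replicate e j)) * g)"
  proof (rule sum.cong[OF refl])
    fix j assume "j \<in> {..<N}"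
    then have "i @ replicate e j \<in> idx N d" using i ed idx_append[OF i idx_replicate[of j N e]] by simp
    then show "(\<Sum>k<N. word (replicate d c) (i @ replicate e j) (replicate d k)) = of_bool (all_equal (i @ replicate e j)) * g"
      using block_relD[OF d] by simp
  qed
  also have "\<dots> = (\<Sum>j<N. if j = m then of_bool (all_equal i) * g else 0)"
  proof (intro sum.cong refl)
    fix j
    have "all_equal (i @ replicate e j) \<longleftrightarrow> j = m \<and> all_equal i"
      using ne e0 unfolding all_equal_iff_nth m_def by (cases i) auto
    then show "of_bool (all_equal (i @ replicate e j)) * g = (if j = m then of_bool (all_equal i) * g else 0)" by simp
  qed
  also have "\<dots> = of_bool (all_equal i) * g" using m by simp
  finally have 1: "(\<Sum>j<N. \<Sum>k<N. word (replicate d c) (i @ replicate e j) (replicate d k)) = of_bool (all_equal i) * g" .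
  have "(\<Sum>j<N. \<Sum>k<N. word (replicate d c) (i @ replicate e j) (replicate d k))
    = (\<Sum>j<N. \<Sum>k<N. word (replicate (d - e) c) i (replicate (d - e) k) * word (replicate e c) (replicate e j) (replicate e k))"
    using i unfolding rd by (intro sum.cong refl) (simp add: wprod_append idx_length)
  also have "\<dots> = (\<Sum>k<N. word (replicate (d - e) c) i (replicate (d - e) k) * (\<Sum>j<N. word (replicate e c) (replicate e j) (replicate e k)))"
    by (subst sum.swap) (simp add: sum_distrib_left)
  \<comment> \<open>Column form of the shorter relation at a constant index: the powers in column
    \<open>k\<close> add up to \<open>h\<close>.\<close>
  also have "\<dots> = (\<Sum>k<N. word (replicate (d - e) c) i (replicate (d - e) k) * h)"
  proof (intro sum.cong refl)
    fix k assume "k \<in> {..<N}"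
    then show "word (replicate (d - e) c) i (replicate (d - e) k) * (\<Sum>j<N. word (replicate e c) (replicate e j) (replicate e k))
      = word (replicate (d - e) c) i (replicate (d - e) k) * h"
      using block_rel_col[OF e, of "replicate e k"] by (simp add: idx_replicate)
  qed
  finally have "(\<Sum>k<N. word (replicate (d - e) c) i (replicate (d - e) k)) * h = of_bool (all_equal i) * g"
    using 1 by (simp add: sum_distrib_right)
  then have "(\<Sum>k<N. word (replicate (d - e) c) i (replicate (d - e) k)) * (h * star h) = of_bool (all_equal i) * (g * star h)"
    by (simp add: mult.assoc[symmetric])
  then show "(\<Sum>k<N. word (replicate (d - e) c) i (replicate (length (replicate (d - e) c)) k)) = of_bool (all_equal i) * (g * star h)"
    using block_rel_unitary[OF e] by simp
qed

text \<open>Multiplying the relation by the adjoint of its last, respectively first factor and summing expresses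
  both \<open>g u\<^sub>j\<^sub>l\<^sup>*\<close> and \<open>u\<^sub>j\<^sub>l\<^sup>* g\<close> as the same power of \<open>u\<^sub>j\<^sub>l\<close>.\<close>

lemma block_rel_central:
  assumes rel: "block_rel (replicate (Suc (Suc n)) White) g" and jl: "j < N" "l < N"
  shows "u j l * g = g * u j l"
proof -
  have b: "of_bool (all_equal (replicate (Suc n) j @ [i])) = of_bool (i = j)" "of_bool (all_equal (i # replicate (Suc n) j)) = of_bool (i = j)" for i
    by (auto simp: all_equal_iff_nth)
  have L: "(\<Sum>k<N. u j k ^ Suc n * u i k) = of_bool (i = j) * g" if "i < N" for i
  proof -
    have "word (replicate (Suc (Suc n)) White) (replicate (Suc n) j @ [i]) (replicate (Suc (Suc n)) k) = u j k ^ Suc n * u i k" for k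
    proof -
      have "word (replicate (Suc (Suc n)) White) (replicate (Suc n) j @ [i]) (replicate (Suc (Suc n)) k)
        = word (replicate (Suc n) White @ [White]) (replicate (Suc n) j @ [i]) (replicate (Suc n) k @ [k])"
        by (simp only: replicate_snoc[of "Suc n"])
      also have "\<dots> = u j k ^ Suc n * u i k"
        by (subst word_append) (simp_all add: wprod_replicate coloured_entry_def del: replicate_Suc power_Suc)
      finally show ?thesis .
    qed
    moreover have "replicate (Suc n) j @ [i] \<in> idx N (length (replicate (Suc (Suc n)) White))"
      using that jl idx_append[OF idx_replicate[of j N "Suc n"], of "[i]" 1] by (simp add: idx_def)
    ultimately show ?thesis using block_relD[OF rel, of "replicate (Suc n) j @ [i]", unfolded b] by simp
  qed
  have R: "(\<Sum>k<N. u i k * u j k ^ Suc n) = of_bool (i = j) * g" if "i < N" for i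
  proof -
    have "word (replicate (Suc (Suc n)) White) (i # replicate (Suc n) j) (replicate (Suc (Suc n)) k) = u i k * u j k ^ Suc n" for k
      using wprod_replicate[of "Suc n" u j k] by (simp add: coloured_entry_def)
    moreover have "i # replicate (Suc n) j \<in> idx N (length (replicate (Suc (Suc n)) White))"
      using that jl idx_replicate[of j N "Suc n"] by simp
    ultimately show ?thesis using block_relD[OF rel, of "i # replicate (Suc n) j", unfolded b] by simp
  qed
  have "g * star (u j l) = (\<Sum>i<N. of_bool (i = j) * g * star (u i l))"
    using jl by (simp add: of_bool_def if_distrib[where f = "\<lambda>x. x * _"] cong: if_cong)
  also have "\<dots> = (\<Sum>i<N. (\<Sum>k<N. u j k ^ Suc n * u i k) * star (u i l))" using L by simp
  also have "\<dots> = (\<Sum>k<N. u j k ^ Suc n * (\<Sum>i<N. u i k * star (u i l)))"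
    by (simp add: sum_distrib_left sum_distrib_right mult.assoc del: power_Suc) (rule sum.swap)
  also have "\<dots> = (\<Sum>k<N. u j k ^ Suc n * of_bool (k = l))"
    using bi_unitaryD(3)[OF u_uni] jl by (intro sum.cong refl) simp
  also have "\<dots> = u j l ^ Suc n" using jl by (simp add: of_bool_def if_distrib[where f = "\<lambda>x. _ * x"] cong: if_cong)
  finally have 1: "g * star (u j l) = u j l ^ Suc n" .
  have "star (u j l) * g = (\<Sum>i<N. star (u i l) * (of_bool (i = j) * g))"
    using jl by (simp add: of_bool_def if_distrib[where f = "\<lambda>x. x * _"] if_distrib[where f = "\<lambda>x. _ * x"] cong: if_cong)
  also have "\<dots> = (\<Sum>i<N. star (u i l) * (\<Sum>k<N. u i k * u j k ^ Suc n))" using R by simp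
  also have "\<dots> = (\<Sum>k<N. (\<Sum>i<N. star (u i l) * u i k) * u j k ^ Suc n)"
    by (simp add: sum_distrib_left sum_distrib_right mult.assoc del: power_Suc) (rule sum.swap)
  also have "\<dots> = (\<Sum>k<N. of_bool (l = k) * u j k ^ Suc n)"
    using bi_unitaryD(4)[OF u_uni] jl by (intro sum.cong refl) simp
  also have "\<dots> = u j l ^ Suc n" using jl by (simp add: of_bool_def if_distrib[where f = "\<lambda>x. x * _"] cong: if_cong)
  finally have "g * star (u j l) = star (u j l) * g" using 1 by simp
  \<comment> \<open>Adjoints turn commutation of \<open>g\<close> with \<open>star (u j l)\<close>
    into commutation of \<open>star g\<close> with \<open>u j l\<close>; multiplying by
    \<open>g\<close> on both sides replaces \<open>star g\<close> by \<open>g\<close>.\<close>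
  then have "star (g * star (u j l)) = star (star (u j l) * g)" by simp
  then have s: "u j l * star g = star g * u j l" by (simp add: star_mult star_star)
  note gg = block_rel_unitary[OF rel]
  have "u j l * g = g * star g * u j l * g" using gg by simp
  also have "\<dots> = g * (star g * u j l) * g" by (simp add: mult.assoc)
  also have "\<dots> = g * (u j l * star g) * g" by (simp only: s)
  also have "\<dots> = g * u j l * (star g * g)" by (simp add: mult.assoc)
  finally show ?thesis using gg by simp
qed

text \<open>Repeatedly subtracting the minimal length \<open>d0\<close> from the length of a white
  relation ends exactly at \<open>d0\<close>, since no relation is shorter. Each subtraction splits
  off one factor \<open>\<gamma>\<close>, and black relations are adjoints of white ones.\<close>

lemma block_rel_generator:
  obtains \<gamma> where "star \<gamma> * \<gamma> = 1" "\<gamma> * star \<gamma> = 1" "\<And>w g. block_rel w g \<Longrightarrow> g \<in> range (zpow \<gamma>)"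
    "(\<forall>i<N. \<forall>j<N. u i j * \<gamma> = \<gamma> * u i j) \<or> block_rel [White] \<gamma>"
proof -
  define D where "D d \<longleftrightarrow> d > 0 \<and> (\<exists>g. block_rel (replicate d White) g)" for d
  have mono: "g = 1 \<or> (\<exists>n. D n \<and> (block_rel (replicate n White) g \<or> block_rel (replicate n White) (star g)))"
    if w: "block_rel w g" for w g
  proof -
    from block_rel_monochrome[OF w] consider "g = 1" | c n where "n > 0" "block_rel (replicate n c) g" by blast
    then show ?thesis
    proof cases
      case (2 c n)
      then show ?thesis using block_rel_Black[of n g] unfolding D_def by (cases c) blast+
    qed simp
  qed
  show thesis
  proof (cases "\<exists>d. D d")
    case False
    \<comment> \<open>Without any white relation, reduction to one colour leaves only
      \<open>g = 1\<close>.\<close>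
    show ?thesis
    proof (rule that[of 1])
      fix w g assume "block_rel w g"
      then have "g = zpow 1 0" using mono False by auto
      then show "g \<in> range (zpow 1)" by blast
    qed auto
  next
    case True
    define d0 where "d0 = (LEAST d. D d)"
    have d0: "D d0" and least: "\<And>d. D d \<Longrightarrow> d0 \<le> d"
      unfolding d0_def using True by (auto intro: LeastI_ex Least_le)
    obtain \<gamma> where \<gamma>: "block_rel (replicate d0 White) \<gamma>" using d0 by (auto simp: D_def)
    note u = block_rel_unitary[OF \<gamma>]
    have gen: "g \<in> range (zpow \<gamma>)" if "block_rel (replicate d White) g" "d > 0" for d g
      using that
    proof (induction d arbitrary: g rule: less_induct)
      case (less d)
      have "d0 \<le> d" using less.prems least[of d] by (auto simp: D_def)
      then consider "d = d0" | "d0 < d" by linarith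
      then show ?case
      proof cases
        case 1
        then have "g = zpow \<gamma> 1" using block_rel_unique[OF \<gamma>] less.prems by auto
        then show ?thesis by blast
      next
        case 2
        have "g * star \<gamma> \<in> range (zpow \<gamma>)"
          using less.IH[OF _ block_rel_diff[OF less.prems(1) \<gamma> 2]] 2 d0 by (auto simp: D_def)
        then obtain k where k: "g * star \<gamma> = zpow \<gamma> k" by blast
        have "g = g * star \<gamma> * \<gamma>" using u by (simp add: mult.assoc)
        also have "\<dots> = zpow \<gamma> (k + 1)" unfolding k using zpow_add[OF u, of k 1] by simp
        finally show ?thesis by blast
      qed
    qed
    show ?thesis
    proof (rule that[OF u])
      fix w g assume "block_rel w g"
      from mono[OF this] consider "g = 1" | "g \<in> range (zpow \<gamma>)" | "star g \<in> range (zpow \<gamma>)"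
        using gen by (auto simp: D_def)
      then show "g \<in> range (zpow \<gamma>)"
      proof cases
        case 1
        then have "g = zpow \<gamma> 0" by simp
        then show ?thesis by blast
      next
        case 3
        then obtain k where "star g = zpow \<gamma> k" by blast
        then have "star (star g) = zpow \<gamma> (- k)" by (simp add: star_zpow)
        then show ?thesis by (simp add: star_star)
      qed
    next
      show "(\<forall>i<N. \<forall>j<N. u i j * \<gamma> = \<gamma> * u i j) \<or> block_rel [White] \<gamma>"
      proof (cases d0)
        case 0
        then show ?thesis using d0 by (simp add: D_def)
      next
        case (Suc n)
        then show ?thesis using \<gamma> block_rel_central by (cases n) auto
      qed
    qed
  qed
qed

section \<open>The two letter systems\<close>

lemma zpow_range_closed:
  assumes "star \<gamma> * \<gamma> = 1" "\<gamma> * star \<gamma> = 1" "g \<in> range (zpow \<gamma>)" "h \<in> range (zpow \<gamma>)"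
  shows "g * h \<in> range (zpow \<gamma>)"
proof -
  obtain m n where "g = zpow \<gamma> m" "h = zpow \<gamma> n" using assms(3,4) by blast
  then have "g * h = zpow \<gamma> (m + n)" using zpow_add[OF assms(1,2)] by simp
  then show ?thesis by blast
qed

lemma scale_N_cancel: "of_nat N *s x = of_nat N *s y \<Longrightarrow> x = y"
  using N4 scale_cancel_left by auto

lemma scale_of_nat: "of_nat n *s x = of_nat n * x"
  using sum_constant_scale[of x "{..<n}"] by simp

text \<open>Column sums that are powers of \<open>\<gamma>\<close> multiply when letters are
  multiplied. Adding up all instances of a relation therefore identifies \<open>N\<close> times the
  split-off element with \<open>N\<close> times a power of \<open>\<gamma>\<close>.\<close>

lemma letter_system_row:
  assumes u: "star \<gamma> * \<gamma> = 1" "\<gamma> * star \<gamma> = 1" and rel: "block_rel [White] \<gamma>"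
  shows "letter_system scale star N (\<lambda>U. bi_unitary {..<N} U \<and> (\<exists>n. \<forall>k<N. (\<Sum>j<N. U j k) = zpow \<gamma> n)) (range (zpow \<gamma>))"
proof
  let ?L = "\<lambda>U. bi_unitary {..<N} U \<and> (\<exists>n. \<forall>k<N. (\<Sum>j<N. U j k) = zpow \<gamma> n)"
  show "4 \<le> N" by (rule N4)
  show "1 \<in> range (zpow \<gamma>)" by (metis rangeI zpow_0)
  show "g * h \<in> range (zpow \<gamma>)" if "g \<in> range (zpow \<gamma>)" "h \<in> range (zpow \<gamma>)" for g h
    using zpow_range_closed[OF u that] .
  show "bi_unitary {..<N} U" if "?L U" for U using that by blast
  show "g \<in> range (zpow \<gamma>)" if U: "?L U" and g: "\<And>j. j < N \<Longrightarrow> (\<Sum>k<N. U j k) = g" for U g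
  proof -
    obtain n where n: "\<And>k. k < N \<Longrightarrow> (\<Sum>j<N. U j k) = zpow \<gamma> n" using U by blast
    have "of_nat N *s g = (\<Sum>j<N. \<Sum>k<N. U j k)" using g by (simp add: scale_of_nat)
    also have "\<dots> = (\<Sum>k<N. \<Sum>j<N. U j k)" by (rule sum.swap)
    also have "\<dots> = of_nat N *s zpow \<gamma> n" using n by (simp add: scale_of_nat)
    finally show ?thesis using scale_N_cancel by blast
  qed
  have prod: "(\<Sum>i<N. \<Sum>j<N. U i k * W j k) = zpow \<gamma> (n + m)"
    if "(\<Sum>j<N. U j k) = zpow \<gamma> n" "(\<Sum>j<N. W j k) = zpow \<gamma> m" for U W n m k
    using that zpow_add[OF u, of n m] by (simp add: sum_product[symmetric])
  show "g \<in> range (zpow \<gamma>)" if U: "?L U" and W: "?L W"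
    and g: "\<And>i j. i < N \<Longrightarrow> j < N \<Longrightarrow> (\<Sum>k<N. U i k * W j k) = of_bool (i = j) * g" for U W g
  proof -
    obtain n where n: "\<And>k. k < N \<Longrightarrow> (\<Sum>j<N. U j k) = zpow \<gamma> n" using U by blast
    obtain m where m: "\<And>k. k < N \<Longrightarrow> (\<Sum>j<N. W j k) = zpow \<gamma> m" using W by blast
    have "of_nat N *s g = (\<Sum>i<N. \<Sum>j<N. of_bool (i = j) * g)"
      by (simp add: scale_of_nat of_bool_def if_distrib[where f = "\<lambda>x. x * _"] cong: if_cong)
    also have "\<dots> = (\<Sum>i<N. \<Sum>j<N. \<Sum>k<N. U i k * W j k)" using g by simp
    also have "\<dots> = (\<Sum>i<N. \<Sum>k<N. \<Sum>j<N. U i k * W j k)" by (rule sum.cong[OF refl], rule sum.swap)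
    also have "\<dots> = (\<Sum>k<N. \<Sum>i<N. \<Sum>j<N. U i k * W j k)" by (rule sum.swap)
    also have "\<dots> = (\<Sum>k<N. zpow \<gamma> (n + m))"
      using n m by (intro sum.cong refl prod) auto
    also have "\<dots> = of_nat N *s zpow \<gamma> (n + m)" by (simp add: scale_of_nat)
    finally show ?thesis using scale_N_cancel by blast
  qed
  show "?L (conj_letter h (star h) U)" if U: "?L U" and h: "h \<in> range (zpow \<gamma>)" "star h * h = 1" "h * star h = 1" for U h
  proof
    show "bi_unitary {..<N} (conj_letter h (star h) U)" using bi_unitary_conj_letter U h by blast
    obtain n where n: "\<And>k. k < N \<Longrightarrow> (\<Sum>j<N. U j k) = zpow \<gamma> n" using U by blast
    obtain m where m: "h = zpow \<gamma> m" using h by blast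
    have "(\<Sum>j<N. conj_letter h (star h) U j k) = h * (\<Sum>j<N. U j k) * star h" for k
      by (simp add: conj_letter_def sum_distrib_left sum_distrib_right)
    then have "(\<Sum>j<N. conj_letter h (star h) U j k) = zpow \<gamma> (m + n + - m)" if "k < N" for k
      using n[OF that] zpow_add[OF u] by (simp only: m star_zpow)
    then show "\<exists>n. \<forall>k<N. (\<Sum>j<N. conj_letter h (star h) U j k) = zpow \<gamma> n" by blast
  qed
  show "?L (\<lambda>i k. U i k * W i k)" if U: "?L U" and W: "?L W"
    and z1: "\<And>i j k. i < N \<Longrightarrow> j < N \<Longrightarrow> k < N \<Longrightarrow> i \<noteq> j \<Longrightarrow> U i k * W j k = 0"
    and z2: "\<And>i k l. i < N \<Longrightarrow> k < N \<Longrightarrow> l < N \<Longrightarrow> k \<noteq> l \<Longrightarrow> U i k * W i l = 0" for U W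
  proof
    show "bi_unitary {..<N} (\<lambda>i k. U i k * W i k)" using bi_unitary_merge U W z1 z2 by blast
    obtain n where n: "\<And>k. k < N \<Longrightarrow> (\<Sum>j<N. U j k) = zpow \<gamma> n" using U by blast
    obtain m where m: "\<And>k. k < N \<Longrightarrow> (\<Sum>j<N. W j k) = zpow \<gamma> m" using W by blast
    have "(\<Sum>j<N. U j k * W j k) = zpow \<gamma> (n + m)" if k: "k < N" for k
    proof -
      \<comment> \<open>By \<open>z1\<close> the off-diagonal products vanish, so the full double
        sum, which factorises, is already the diagonal one.\<close>
      have "(\<Sum>i<N. \<Sum>j<N. U i k * W j k) = (\<Sum>i<N. \<Sum>j<N. if j = i then U i k * W j k else 0)"
        using z1 k by (intro sum.cong refl) auto
      also have "\<dots> = (\<Sum>i<N. U i k * W i k)" by simp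
      finally show ?thesis unfolding prod[of U k n W m, OF n[OF k] m[OF k]] by (rule sym)
    qed
    then show "\<exists>n. \<forall>k<N. (\<Sum>j<N. U j k * W j k) = zpow \<gamma> n" by blast
  qed
qed

text \<open>\<open>U\<close> is the subrepresentation of the word \<open>w\<close> on the span of the vectors \<open>e\<^sub>k \<otimes> \<dots> \<otimes> e\<^sub>k\<close>.\<close>

definition merged_word :: "colour list \<Rightarrow> (nat \<Rightarrow> nat \<Rightarrow> 'a) \<Rightarrow> bool" where
  "merged_word w U \<longleftrightarrow> w \<noteq> [] \<and> (\<forall>is\<in>idx N (length w). \<forall>k<N.
     word w is (replicate (length w) k) = of_bool (all_equal is) * U (hd is) k)"

lemma merged_wordD: "merged_word w U \<Longrightarrow> is \<in> idx N (length w) \<Longrightarrow> k < N \<Longrightarrow>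
    word w is (replicate (length w) k) = of_bool (all_equal is) * U (hd is) k"
  by (simp add: merged_word_def)

lemma all_equal_append: "is \<noteq> [] \<Longrightarrow> is' \<noteq> [] \<Longrightarrow> all_equal (is @ is') \<longleftrightarrow> all_equal is \<and> all_equal is' \<and> hd is = hd is'"
  unfolding all_equal_iff_nth by (cases "is"; cases is') auto

lemma merged_word_append:
  assumes w: "merged_word w U" and w': "merged_word w' W"
    and i: "i \<in> idx N (length w)" "i' \<in> idx N (length w')"
  shows "hd i < N" "hd i' < N" "hd (i @ i') = hd i"
    "all_equal (i @ i') \<longleftrightarrow> all_equal i \<and> all_equal i' \<and> hd i = hd i'"
    "k < N \<Longrightarrow> word (w @ w') (i @ i') (replicate (length (w @ w')) k) = of_bool (all_equal i \<and> all_equal i') * (U (hd i) k * W (hd i') k)"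
proof -
  have ne: "i \<noteq> []" "i' \<noteq> []" using i w w' by (auto simp: idx_def merged_word_def)
  show "hd i < N" "hd i' < N" using hd_in_set[OF ne(1)] hd_in_set[OF ne(2)] i by (auto simp: idx_def)
  show "hd (i @ i') = hd i" using ne by simp
  show "all_equal (i @ i') \<longleftrightarrow> all_equal i \<and> all_equal i' \<and> hd i = hd i'" by (rule all_equal_append[OF ne])
  assume k: "k < N"
  have "word (w @ w') (i @ i') (replicate (length (w @ w')) k) = word w i (replicate (length w) k) * word w' i' (replicate (length w') k)"
    using i by (simp add: replicate_add wprod_append idx_length)
  then show "word (w @ w') (i @ i') (replicate (length (w @ w')) k) = of_bool (all_equal i \<and> all_equal i') * (U (hd i) k * W (hd i') k)"
    using merged_wordD[OF w i(1) k] merged_wordD[OF w' i(2) k] by auto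
qed

text \<open>Entries of letters are entries of words in \<open>u\<close> and its conjugate, so they
  commute with the powers of \<open>\<gamma>\<close> and conjugation changes nothing. Relations
  between letters unfold into block relations of the underlying words, to which \<open>rel\<close>
  applies.\<close>

lemma letter_system_central:
  assumes u: "star \<gamma> * \<gamma> = 1" "\<gamma> * star \<gamma> = 1" and rel: "\<And>w g. block_rel w g \<Longrightarrow> g \<in> range (zpow \<gamma>)"
    and central: "\<forall>i<N. \<forall>j<N. u i j * \<gamma> = \<gamma> * u i j"
  shows "letter_system scale star N (\<lambda>U. bi_unitary {..<N} U \<and> (\<exists>w. merged_word w U)) (range (zpow \<gamma>))"
proof
  let ?L = "\<lambda>U. bi_unitary {..<N} U \<and> (\<exists>w. merged_word w U)"
  show "4 \<le> N" by (rule N4)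
  show "1 \<in> range (zpow \<gamma>)" by (metis rangeI zpow_0)
  show "g * h \<in> range (zpow \<gamma>)" if "g \<in> range (zpow \<gamma>)" "h \<in> range (zpow \<gamma>)" for g h
    using zpow_range_closed[OF u that] .
  show "bi_unitary {..<N} U" if "?L U" for U using that by blast
  show "g \<in> range (zpow \<gamma>)" if U: "?L U" and g: "\<And>j. j < N \<Longrightarrow> (\<Sum>k<N. U j k) = g" for U g
  proof -
    obtain w where w: "merged_word w U" using U by blast
    have "block_rel w g"
      unfolding block_rel_def
    proof (intro conjI ballI)
      show "w \<noteq> []" using w by (simp add: merged_word_def)
      fix i assume i: "i \<in> idx N (length w)"
      have "i \<noteq> []" using i w by (auto simp: idx_def merged_word_def)
      from hd_in_set[OF this] have "hd i < N" using i by (auto simp: idx_def)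
      then show "(\<Sum>k<N. word w i (replicate (length w) k)) = of_bool (all_equal i) * g"
        using merged_wordD[OF w i] g by (simp add: sum_distrib_left[symmetric])
    qed
    then show ?thesis by (rule rel)
  qed
  show "g \<in> range (zpow \<gamma>)" if U: "?L U" and W: "?L W"
    and g: "\<And>i j. i < N \<Longrightarrow> j < N \<Longrightarrow> (\<Sum>k<N. U i k * W j k) = of_bool (i = j) * g" for U W g
  proof -
    obtain w where w: "merged_word w U" using U by blast
    obtain w' where w': "merged_word w' W" using W by blast
    have "block_rel (w @ w') g"
      unfolding block_rel_def
    proof (intro conjI ballI)
      show "w @ w' \<noteq> []" using w by (simp add: merged_word_def)
      fix "is" assume "is \<in> idx N (length (w @ w'))"
      then obtain i i' where ii: "is = i @ i'" "i \<in> idx N (length w)" "i' \<in> idx N (length w')"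
        by (metis idx_addE length_append)
      note m = merged_word_append[OF w w' ii(2,3)]
      have "(\<Sum>k<N. word (w @ w') is (replicate (length (w @ w')) k))
        = (\<Sum>k<N. of_bool (all_equal i \<and> all_equal i') * (U (hd i) k * W (hd i') k))"
        unfolding ii(1) by (intro sum.cong refl m(5)) simp
      also have "\<dots> = of_bool (all_equal i \<and> all_equal i') * (of_bool (hd i = hd i') * g)"
        by (simp only: g[OF m(1,2)] sum_distrib_left[symmetric])
      finally show "(\<Sum>k<N. word (w @ w') is (replicate (length (w @ w')) k)) = of_bool (all_equal is) * g"
        unfolding ii(1) m(4) by auto
    qed
    then show ?thesis by (rule rel)
  qed
  \<comment> \<open>Commutation passes to the inverse \<open>star \<gamma>\<close> by multiplying
    with it on both sides, and adjoints give it for the conjugate entries.\<close>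
  have su: "star (u i j) * \<gamma> = \<gamma> * star (u i j)" "u i j * star \<gamma> = star \<gamma> * u i j" if ij: "i < N" "j < N" for i j
  proof -
    have c: "u i j * \<gamma> = \<gamma> * u i j" using central ij by blast
    have a: "star \<gamma> * (\<gamma> * x) = x" "x * \<gamma> * star \<gamma> = x" for x using u by (simp_all add: mult.assoc[symmetric], simp add: mult.assoc u)
    have "star \<gamma> * (u i j * \<gamma>) * star \<gamma> = star \<gamma> * (\<gamma> * u i j) * star \<gamma>" using c by simp
    then show d: "u i j * star \<gamma> = star \<gamma> * u i j" using a by (metis mult.assoc)
    have "star (star \<gamma> * u i j) = star (u i j * star \<gamma>)" using d by simp
    then show "star (u i j) * \<gamma> = \<gamma> * star (u i j)" by (simp add: star_mult star_star)
  qed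
  have su': "star (u i j) * star \<gamma> = star \<gamma> * star (u i j)" if ij: "i < N" "j < N" for i j
  proof -
    have "star (\<gamma> * u i j) = star (u i j * \<gamma>)" using central ij by simp
    then show ?thesis by (simp add: star_mult)
  qed
  have cl: "colour_letter c i j * zpow \<gamma> n = zpow \<gamma> n * colour_letter c i j" if "i < N" "j < N" for c i j n
    using central su su' that by (intro commute_zpow) (cases c; simp add: coloured_entry_def)+
  have wl: "word w is js * zpow \<gamma> n = zpow \<gamma> n * word w is js"
    if "is \<in> idx N (length w)" "js \<in> idx N (length w)" for w "is" js n
    using that
  proof (induction w arbitrary: "is" js)
    case (Cons c w)
    obtain i is' j js' where *: "is = i # is'" "js = j # js'" "i < N" "j < N" "is' \<in> idx N (length w)" "js' \<in> idx N (length w)"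
      using Cons.prems by (metis idx_SucE length_Cons)
    have "colour_letter c i j * word w is' js' * zpow \<gamma> n = colour_letter c i j * (zpow \<gamma> n * word w is' js')"
      using Cons.IH[OF *(5,6)] by (simp add: mult.assoc)
    also have "\<dots> = zpow \<gamma> n * (colour_letter c i j * word w is' js')"
      using cl[OF *(3,4), of c n] by (metis mult.assoc)
    finally show ?case by (simp add: *)
  qed simp
  show "?L (conj_letter h (star h) U)" if U: "?L U" and h: "h \<in> range (zpow \<gamma>)" "star h * h = 1" "h * star h = 1" for U h
  proof
    show "bi_unitary {..<N} (conj_letter h (star h) U)" using bi_unitary_conj_letter U h by blast
    obtain w where w: "merged_word w U" using U by blast
    obtain n where n: "h = zpow \<gamma> n" using h by blast
    have "conj_letter h (star h) U i k = U i k" if ik: "i < N" "k < N" for i k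
    proof -
      have "hd (replicate (length w) i) = i" using w by (auto simp: merged_word_def hd_replicate)
      then have "U i k = word w (replicate (length w) i) (replicate (length w) k)"
        using merged_wordD[OF w, of "replicate (length w) i" k] ik by (simp add: idx_replicate)
      then have "U i k * h = h * U i k" using wl[of "replicate (length w) i" w "replicate (length w) k" n] ik n
        by (simp add: idx_replicate)
      then have "conj_letter h (star h) U i k = U i k * (h * star h)" by (simp add: conj_letter_def mult.assoc[symmetric])
      then show ?thesis using h by simp
    qed
    then have "merged_word w (conj_letter h (star h) U)"
      using w unfolding merged_word_def by (auto simp: of_bool_def elim!: all_equalE)
    then show "\<exists>w. merged_word w (conj_letter h (star h) U)" by blast
  qed
  show "?L (\<lambda>i k. U i k * W i k)" if U: "?L U" and W: "?L W"
    and z1: "\<And>i j k. i < N \<Longrightarrow> j < N \<Longrightarrow> k < N \<Longrightarrow> i \<noteq> j \<Longrightarrow> U i k * W j k = 0"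
    and z2: "\<And>i k l. i < N \<Longrightarrow> k < N \<Longrightarrow> l < N \<Longrightarrow> k \<noteq> l \<Longrightarrow> U i k * W i l = 0" for U W
  proof
    show "bi_unitary {..<N} (\<lambda>i k. U i k * W i k)" using bi_unitary_merge U W z1 z2 by blast
    obtain w where w: "merged_word w U" using U by blast
    obtain w' where w': "merged_word w' W" using W by blast
    have "merged_word (w @ w') (\<lambda>i k. U i k * W i k)"
      unfolding merged_word_def
    proof (intro conjI ballI allI impI)
      show "w @ w' \<noteq> []" using w by (simp add: merged_word_def)
      fix "is" k assume "is \<in> idx N (length (w @ w'))" and k: "k < N"
      then obtain i i' where ii: "is = i @ i'" "i \<in> idx N (length w)" "i' \<in> idx N (length w')"
        by (metis idx_addE length_append)
      note m = merged_word_append[OF w w' ii(2,3)]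
      show "word (w @ w') is (replicate (length (w @ w')) k) = of_bool (all_equal is) * (U (hd is) k * W (hd is) k)"
      proof (cases "hd i = hd i'")
        case True
        then show ?thesis unfolding ii(1) m(3) m(4) m(5)[OF k] by simp
      next
        case False
        then show ?thesis unfolding ii(1) m(3) m(4) m(5)[OF k] using z1[OF m(1,2) k] by simp
      qed
    qed
    then show "\<exists>w. merged_word w (\<lambda>i k. U i k * W i k)" by blast
  qed
qed

text \<open>One \<open>\<gamma>\<close> has to serve all words, so it is fixed before a letter
  system is chosen and a word is reduced.\<close>

theorem semi_inv_word_cyclic:
  assumes sp: "\<And>w. spanned TYPE('l) N (map colour_letter w)"
  obtains \<gamma> where "star \<gamma> * \<gamma> = 1" "\<gamma> * star \<gamma> = 1"
    "\<And>w \<zeta> g i. i \<in> idx N (length w) \<Longrightarrow> \<zeta> i \<noteq> 0 \<Longrightarrow> semi_inv (idx N (length w)) (word w) \<zeta> g \<Longrightarrow> g \<in> range (zpow \<gamma>)"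
proof -
  obtain \<gamma> where \<gamma>: "star \<gamma> * \<gamma> = 1" "\<gamma> * star \<gamma> = 1" and rel: "\<And>w g. block_rel w g \<Longrightarrow> g \<in> range (zpow \<gamma>)"
    and cases: "(\<forall>i<N. \<forall>j<N. u i j * \<gamma> = \<gamma> * u i j) \<or> block_rel [White] \<gamma>"
    by (rule block_rel_generator) blast
  show thesis
  proof (rule that[OF \<gamma>])
    fix w \<zeta> g i assume *: "i \<in> idx N (length w)" "\<zeta> i \<noteq> 0" "semi_inv (idx N (length w)) (word w) \<zeta> g"
    have fin: "g \<in> range (zpow \<gamma>)" if "letter_system scale star N L (range (zpow \<gamma>))" "\<And>c. L (colour_letter c)" for L
    proof -
      interpret letter_system scale star N L "range (zpow \<gamma>)" by (rule that(1))
      show ?thesis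
        by (rule semi_inv_in_Gam[where Us = "map colour_letter w" and \<zeta> = \<zeta> and i = i, OF _ sp]) (use that(2) * in auto)
    qed
    from cases show "g \<in> range (zpow \<gamma>)"
    proof
      assume c: "\<forall>i<N. \<forall>j<N. u i j * \<gamma> = \<gamma> * u i j"
      show ?thesis
      proof (rule fin[OF letter_system_central[OF \<gamma> rel c]])
        fix c
        have "merged_word [c] (colour_letter c)"
          by (auto simp: merged_word_def all_equal_def elim!: idx_SucE)
        then show "bi_unitary {..<N} (colour_letter c) \<and> (\<exists>w. merged_word w (colour_letter c))"
          using bi_unitary_colour_letter by blast
      qed
    next
      assume r: "block_rel [White] \<gamma>"
      \<comment> \<open>In column form the one-letter relation says that every column sums to
        \<open>\<gamma>\<close>; conjugate letters then have column sums
        \<open>star \<gamma>\<close>.\<close>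
      have w: "(\<Sum>j<N. u j k) = \<gamma>" if "k < N" for k
        using block_rel_col[OF r, of "[k]"] that by (simp add: coloured_entry_def all_equal_def)
      show ?thesis
      proof (rule fin[OF letter_system_row[OF \<gamma> r]])
        fix c
        have "(\<Sum>j<N. colour_letter c j k) = zpow \<gamma> (case c of White \<Rightarrow> 1 | Black \<Rightarrow> - 1)" if "k < N" for k
          using w[OF that] by (cases c) (simp_all add: coloured_entry_def star_sum[symmetric])
        then show "bi_unitary {..<N} (colour_letter c) \<and> (\<exists>n. \<forall>k<N. (\<Sum>j<N. colour_letter c j k) = zpow \<gamma> n)"
          using bi_unitary_colour_letter by blast
      qed
    qed
  qed
qed

end

section \<open>The group of one-dimensional representations\<close>

primrec encode :: "nat \<Rightarrow> nat list \<Rightarrow> nat" where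
  "encode N [] = 0"
| "encode N (i # is) = i * N ^ length is + encode N is"

lemma encode_less: "is \<in> idx N k \<Longrightarrow> encode N is < N ^ k"
proof (induction k arbitrary: "is")
  case (Suc k)
  from Suc.prems obtain i is' where *: "is = i # is'" "i < N" "is' \<in> idx N k" by (rule idx_SucE)
  have "encode N is < i * N ^ k + N ^ k" using Suc.IH[OF *(3)] * by (simp add: idx_length)
  also have "\<dots> = Suc i * N ^ k" by simp
  also have "\<dots> \<le> N * N ^ k" using * by (intro mult_right_mono) auto
  finally show ?case by simp
qed simp

lemma digit_encode: "is \<in> idx N k \<Longrightarrow> m < k \<Longrightarrow> digit N k (encode N is) m = is ! m"
proof (induction k arbitrary: "is" m)
  case (Suc k)
  then obtain i is' where *: "is = i # is'" "i < N" "is' \<in> idx N k" by (metis idx_SucE)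
  have e: "encode N is' < N ^ k" by (rule encode_less[OF *(3)])
  have l: "length is' = k" using * by (simp add: idx_length)
  show ?case
  proof (cases m)
    case 0
    then show ?thesis using * e l by (simp add: digit_def)
  next
    case (Suc m')
    then have m': "m' < k" using Suc.prems by simp
    then have "k = Suc m' + (k - Suc m')" by simp
    then have p: "N ^ k = N ^ Suc m' * N ^ (k - Suc m')" by (metis power_add)
    have N0: "N ^ (k - Suc m') > 0" using * by simp
    have "(i * N ^ k + encode N is') div N ^ (k - Suc m') = i * N ^ Suc m' + encode N is' div N ^ (k - Suc m')"
      using N0 unfolding p mult.assoc[symmetric] by (subst div_mult_self3) auto
    then have "digit N (Suc k) (encode N is) m = digit N k (encode N is') m'"
      using Suc by (simp add: digit_def * l mult.left_commute)
    then show ?thesis using Suc.IH[OF *(3) m'] Suc * by simp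
  qed
qed simp

lemma encode_bij: "bij_betw (encode N) (idx N k) {..<N ^ k}"
proof -
  have inj: "inj_on (encode N) (idx N k)"
  proof (rule inj_onI)
    fix x y assume *: "x \<in> idx N k" "y \<in> idx N k" "encode N x = encode N y"
    show "x = y"
      by (rule nth_equalityI) (use * digit_encode[of x N k] digit_encode[of y N k] in \<open>auto simp: idx_length\<close>)
  qed
  have "card (idx N k) = N ^ k"
    using card_lists_length_eq[of "{..<N}" k] by (simp add: idx_def conj_commute)
  then have "encode N ` idx N k = {..<N ^ k}"
    using encode_less[of _ N k] card_image[OF inj] by (intro card_subset_eq) auto
  then show ?thesis using inj by (simp add: bij_betw_def)
qed

lemma sum_encode: "(\<Sum>x<N ^ k. F x) = (\<Sum>is\<in>idx N k. F (encode N is))"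
  using sum.reindex_bij_betw[OF encode_bij[of N k], of F] by simp

lemma encode_surj:
  assumes "x < N ^ k"
  shows "\<exists>is\<in>idx N k. encode N is = x"
proof -
  have "x \<in> encode N ` idx N k" using encode_bij[of N k] assms by (simp add: bij_betw_def)
  then show ?thesis by blast
qed

lemma all_encode: "(\<forall>x<N ^ k. P x) \<longleftrightarrow> (\<forall>is\<in>idx N k. P (encode N is))"
proof (intro iffI allI impI ballI)
  fix x assume "\<forall>is\<in>idx N k. P (encode N is)" "x < N ^ k"
  then show "P x" using encode_surj[of x N k] by blast
qed (use encode_less in blast)

text \<open>Inverse of \<open>boundary_pos\<close> for two rows of the same length
  \<open>k\<close>.\<close>

definition boundary_point :: "nat \<Rightarrow> nat \<Rightarrow> nat + nat" where
  "boundary_point k x = (if x < k then Inl x else Inr (2 * k - Suc x))"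

text \<open>The blocks themselves serve as labels; the union picks out the only block that contains
  the point.\<close>

definition block_label :: "nat \<Rightarrow> cpart \<Rightarrow> nat \<Rightarrow> (nat + nat) set" where
  "block_label k p x = \<Union>{b \<in> blocks p. boundary_point k x \<in> b}"

lemma block_label:
  assumes p: "coloured_partition p" "length (upper p) = k" "length (lower p) = k" and x: "x < 2 * k"
  shows "block_label k p x \<in> blocks p" "boundary_point k x \<in> block_label k p x"
    "\<And>b. b \<in> blocks p \<Longrightarrow> boundary_point k x \<in> b \<Longrightarrow> b = block_label k p x"
proof -
  have part: "partition_on (points k k) (blocks p)" using p by (simp add: coloured_partition_def)
  have "boundary_point k x \<in> points k k"
    using x by (auto simp: boundary_point_def points_def)
  then obtain b where b: "b \<in> blocks p" "boundary_point k x \<in> b"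
    using partition_onD1[OF part] by auto
  have uniq: "b' = b" if "b' \<in> blocks p" "boundary_point k x \<in> b'" for b'
    using that b partition_onD2[OF part] unfolding disjoint_def by blast
  have "{b \<in> blocks p. boundary_point k x \<in> b} = {b}" using b uniq by blast
  then have eq: "block_label k p x = b" by (simp add: block_label_def)
  show "block_label k p x \<in> blocks p" "boundary_point k x \<in> block_label k p x"
    unfolding eq by (rule b)+
  show "b' = block_label k p x" if "b' \<in> blocks p" "boundary_point k x \<in> b'" for b'
    unfolding eq by (rule uniq[OF that])
qed

lemma boundary_pos_point:
  "x < 2 * k \<Longrightarrow> boundary_pos k k (boundary_point k x) = x"
  by (auto simp: boundary_point_def)

lemma boundary_point_pos:
  "y \<in> points k k \<Longrightarrow> boundary_pos k k y < 2 * k \<and> boundary_point k (boundary_pos k k y) = y"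
  by (auto simp: boundary_point_def points_def)

lemma noncrossingD:
  assumes "noncrossing p" "b \<in> blocks p" "b' \<in> blocks p" "b \<noteq> b'" "x1 \<in> b" "x2 \<in> b'" "x3 \<in> b" "x4 \<in> b'"
    and "boundary_pos (length (upper p)) (length (lower p)) x1 < boundary_pos (length (upper p)) (length (lower p)) x2"
    and "boundary_pos (length (upper p)) (length (lower p)) x2 < boundary_pos (length (upper p)) (length (lower p)) x3"
    and "boundary_pos (length (upper p)) (length (lower p)) x3 < boundary_pos (length (upper p)) (length (lower p)) x4"
  shows False
  using assms(1) unfolding noncrossing_def Let_def
  by (rule notE) (intro bexI[OF _ assms(2)] bexI[OF _ assms(3)] conjI assms(4) bexI[OF _ assms(5)]
      bexI[OF _ assms(6)] bexI[OF _ assms(7)] bexI[OF _ assms(8)] assms(9-11))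

lemma nc_block_label:
  assumes p: "coloured_partition p" "length (upper p) = k" "length (lower p) = k" and nc: "noncrossing p"
  shows "nc_labelling (2 * k) (block_label k p)"
  unfolding nc_labelling_def
proof (intro allI impI, elim conjE, rule ccontr)
  fix a b c d assume *: "a < b" "b < c" "c < d" "d < 2 * k" "block_label k p a = block_label k p c"
    "block_label k p b = block_label k p d" "block_label k p a \<noteq> block_label k p b"
  note B = block_label[OF p]
  let ?pos = "boundary_pos k k" and ?pt = "boundary_point k"
  have less: "a < 2 * k" "b < 2 * k" "c < 2 * k" using * by auto
  have m: "?pt a \<in> block_label k p a" "?pt b \<in> block_label k p b" "?pt c \<in> block_label k p a" "?pt d \<in> block_label k p b"
    using B(2)[OF less(1)] B(2)[OF less(2)] B(2)[OF less(3)] B(2)[OF *(4)] *(5,6) by simp_all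
  have "?pos (?pt a) < ?pos (?pt b) \<and> ?pos (?pt b) < ?pos (?pt c) \<and> ?pos (?pt c) < ?pos (?pt d)"
    using *(1-4) less by (simp add: boundary_pos_point)
  then have lt: "?pos (?pt a) < ?pos (?pt b)" "?pos (?pt b) < ?pos (?pt c)" "?pos (?pt c) < ?pos (?pt d)" by auto
  have "block_label k p a \<in> blocks p" "block_label k p b \<in> blocks p" using B(1) less by blast+
  then show False using noncrossingD[OF nc _ _ *(7) m] lt unfolding p by blast
qed

text \<open>At each boundary point the list \<open>c @ rev r\<close> carries the digit that
  \<open>part_map\<close> reads there, so the two index conditions agree block by block.\<close>

lemma part_map_encode:
  assumes p: "coloured_partition p" "length (upper p) = k" "length (lower p) = k"
    and rc: "r \<in> idx N k" "c \<in> idx N k"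
  shows "part_map N p $$ (encode N r, encode N c) = part_op (block_label k p) r c"
proof -
  note B = block_label[OF p]
  have part: "partition_on (points k k) (blocks p)" using p by (simp add: coloured_partition_def)
  let ?ix = "case_sum (digit N k (encode N c)) (digit N k (encode N r))"
  have n: "(c @ rev r) ! x = ?ix (boundary_point k x)" if "x < 2 * k" for x
    using that rc by (auto simp: boundary_point_def nth_append rev_nth idx_length digit_encode mult_2)
  have l: "length (c @ rev r) = 2 * k" using rc by (simp add: idx_length)
  have "(\<forall>b\<in>blocks p. \<forall>x\<in>b. \<forall>y\<in>b. ?ix x = ?ix y) \<longleftrightarrow> agrees (block_label k p) (c @ rev r)"
  proof
    assume H: "\<forall>b\<in>blocks p. \<forall>x\<in>b. \<forall>y\<in>b. ?ix x = ?ix y"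
    show "agrees (block_label k p) (c @ rev r)"
      unfolding agrees_def l
    proof (intro allI impI)
      fix a b assume a: "a < 2 * k" and b: "b < 2 * k" and ab: "block_label k p a = block_label k p b"
      have "boundary_point k b \<in> block_label k p a" using B(2)[OF b] ab by simp
      from H[rule_format, OF B(1)[OF a] B(2)[OF a] this]
      show "(c @ rev r) ! a = (c @ rev r) ! b" unfolding n[OF a] n[OF b] .
    qed
  next
    assume C: "agrees (block_label k p) (c @ rev r)"
    show "\<forall>b\<in>blocks p. \<forall>x\<in>b. \<forall>y\<in>b. ?ix x = ?ix y"
    proof (intro ballI)
      fix b x y assume b: "b \<in> blocks p" "x \<in> b" "y \<in> b"
      then have "x \<in> points k k" "y \<in> points k k" using partition_onD1[OF part] by auto
      then have x: "boundary_pos k k x < 2 * k" "boundary_point k (boundary_pos k k x) = x"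
        and y: "boundary_pos k k y < 2 * k" "boundary_point k (boundary_pos k k y) = y"
        using boundary_point_pos by auto
      have "block_label k p (boundary_pos k k x) = block_label k p (boundary_pos k k y)"
        using B(3)[OF x(1) b(1)] B(3)[OF y(1) b(1)] b x y by simp
      then have "(c @ rev r) ! boundary_pos k k x = (c @ rev r) ! boundary_pos k k y"
        using agreesD[OF C, of "boundary_pos k k x" "boundary_pos k k y"] l x(1) y(1) by simp
      then show "?ix x = ?ix y" unfolding n[OF x(1)] n[OF y(1)] x(2) y(2) .
    qed
  qed
  then show ?thesis
    using encode_less[OF rc(1)] encode_less[OF rc(2)] p by (simp add: part_map_def Let_def part_op_def)
qed

lemma mat_span_superset: "M \<in> X \<Longrightarrow> M \<in> carrier_mat nr nc \<Longrightarrow> M \<in> mat_span nr nc X"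
  unfolding mat_span_def
  by (rule CollectI, rule exI[of _ "{M}"], rule exI[of _ "\<lambda>_. 1"]) auto

lemma part_map_carrier: "part_map N p \<in> carrier_mat (N ^ length (lower p)) (N ^ length (upper p))"
  by (simp add: part_map_def Let_def)

section \<open>Intertwiner spaces of words in coordinates\<close>

context hopf_star_algebra
begin

lemma index_mult: 
  fixes A B :: "'x::semiring_0 mat"
  assumes "i < dim_row A" "j < dim_col B" "dim_col A = dim_row B"
  shows "(A * B) $$ (i, j) = (\<Sum>z<dim_row B. A $$ (i, z) * B $$ (z, j))"
  using assms by (simp add: scalar_prod_def atLeast0LessThan)

lemma hom_space_entries:
  assumes V: "V \<in> carrier_mat n n" and W: "W \<in> carrier_mat m m"
  shows "T \<in> hom_space V W \<longleftrightarrow> T \<in> carrier_mat m n \<and>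
    (\<forall>x<m. \<forall>y<n. (\<Sum>z<n. T $$ (x, z) *s V $$ (z, y)) = (\<Sum>z<m. T $$ (z, y) *s W $$ (x, z)))"
proof -
  have "scalar_mat T * V = W * scalar_mat T \<longleftrightarrow>
    (\<forall>x<m. \<forall>y<n. (\<Sum>z<n. T $$ (x, z) *s V $$ (z, y)) = (\<Sum>z<m. T $$ (z, y) *s W $$ (x, z)))"
    if T: "T \<in> carrier_mat m n"
  proof -
    have L: "(scalar_mat T * V) $$ (x, y) = (\<Sum>z<n. T $$ (x, z) *s V $$ (z, y))" if "x < m" "y < n" for x y
      using that T V by (subst index_mult) (auto simp: scalar_mat_def scale_mult_left)
    have R: "(W * scalar_mat T) $$ (x, y) = (\<Sum>z<m. T $$ (z, y) *s W $$ (x, z))" if "x < m" "y < n" for x y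
      using that T W by (subst index_mult) (auto simp: scalar_mat_def scale_mult_right)
    have "scalar_mat T * V \<in> carrier_mat m n" "W * scalar_mat T \<in> carrier_mat m n"
      using T V W by (auto simp: scalar_mat_def)
    then have "scalar_mat T * V = W * scalar_mat T \<longleftrightarrow>
      (\<forall>x<m. \<forall>y<n. (scalar_mat T * V) $$ (x, y) = (W * scalar_mat T) $$ (x, y))"
      by (auto intro!: eq_matI)
    then show ?thesis using L R by simp
  qed
  then show ?thesis using V W by (auto simp: hom_space_def)
qed

definition entries :: "'a mat \<Rightarrow> nat \<Rightarrow> nat \<Rightarrow> 'a" where
  "entries u i j = u $$ (i, j)"

abbreviation letter_of :: "'a mat \<Rightarrow> colour \<Rightarrow> nat \<Rightarrow> nat \<Rightarrow> 'a" where
  "letter_of u \<equiv> coloured_entry (entries u)"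

lemma word_rep_carrier:
  assumes "u \<in> carrier_mat N N"
  shows "word_rep u w \<in> carrier_mat (N ^ length w) (N ^ length w)"
  using assms by (induction w) (auto simp: kron_def conj_mat_def split: colour.split)

lemma word_rep_encode:
  assumes u: "u \<in> carrier_mat N N" and "is \<in> idx N (length w)" "js \<in> idx N (length w)"
  shows "word_rep u w $$ (encode N is, encode N js) = wprod (map (letter_of u) w) is js"
  using assms(2,3)
proof (induction w arbitrary: "is" js)
  case (Cons c w)
  obtain i is' j js' where *: "is = i # is'" "js = j # js'" "i < N" "j < N" "is' \<in> idx N (length w)" "js' \<in> idx N (length w)"
    using Cons.prems by (metis idx_SucE length_Cons)
  let ?k = "N ^ length w"
  have l: "length is' = length w" "length js' = length w" using * by (auto simp: idx_length)
  have e: "encode N is' < ?k" "encode N js' < ?k" using encode_less[OF *(5)] encode_less[OF *(6)] by auto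
  have W: "word_rep u w \<in> carrier_mat ?k ?k" by (rule word_rep_carrier[OF u])
  have E: "encode N is < N * ?k" "encode N js < N * ?k"
    using encode_less[OF Cons.prems(1)] encode_less[OF Cons.prems(2)] by auto
  have d: "encode N is div ?k = i" "encode N is mod ?k = encode N is'"
    "encode N js div ?k = j" "encode N js mod ?k = encode N js'"
    using * l e by auto
  have A: "(case c of White \<Rightarrow> u | Black \<Rightarrow> conj_mat u) \<in> carrier_mat N N"
    using u by (auto simp: conj_mat_def split: colour.split)
  have a: "(case c of White \<Rightarrow> u | Black \<Rightarrow> conj_mat u) $$ (i, j) = letter_of u c i j"
    using u * by (auto simp: conj_mat_def coloured_entry_def entries_def split: colour.split)
  have "word_rep u (c # w) $$ (encode N is, encode N js) = letter_of u c i j * word_rep u w $$ (encode N is', encode N js')"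
    using A W E d a by (simp add: kron_def)
  then show ?case using Cons.IH[OF *(5,6)] * by simp
qed simp

lemma hom_word_entries:
  assumes u: "u \<in> carrier_mat N N"
  shows "T \<in> hom_space (word_rep u w) (word_rep u w') \<longleftrightarrow> T \<in> carrier_mat (N ^ length w') (N ^ length w) \<and>
    (\<forall>x\<in>idx N (length w'). \<forall>y\<in>idx N (length w).
      (\<Sum>z\<in>idx N (length w). T $$ (encode N x, encode N z) *s wprod (map (letter_of u) w) z y)
      = (\<Sum>z\<in>idx N (length w'). T $$ (encode N z, encode N y) *s wprod (map (letter_of u) w') x z))"
proof -
  let ?k = "N ^ length w" and ?l = "N ^ length w'"
  have "(\<forall>x<?l. \<forall>y<?k. (\<Sum>z<?k. T $$ (x, z) *s word_rep u w $$ (z, y)) = (\<Sum>z<?l. T $$ (z, y) *s word_rep u w' $$ (x, z)))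
    \<longleftrightarrow> (\<forall>x\<in>idx N (length w'). \<forall>y\<in>idx N (length w).
        (\<Sum>z<?k. T $$ (encode N x, z) *s word_rep u w $$ (z, encode N y)) = (\<Sum>z<?l. T $$ (z, encode N y) *s word_rep u w' $$ (encode N x, z)))"
    by (simp only: all_encode)
  also have "\<dots> \<longleftrightarrow> (\<forall>x\<in>idx N (length w'). \<forall>y\<in>idx N (length w).
      (\<Sum>z\<in>idx N (length w). T $$ (encode N x, encode N z) *s wprod (map (letter_of u) w) z y)
      = (\<Sum>z\<in>idx N (length w'). T $$ (encode N z, encode N y) *s wprod (map (letter_of u) w') x z))"
    unfolding sum_encode by (intro ball_cong refl arg_cong2[of _ _ _ _ "(=)"] sum.cong) (simp_all add: word_rep_encode[OF u])
  finally show ?thesis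
    using hom_space_entries[OF word_rep_carrier[OF u, of w] word_rep_carrier[OF u, of w'], of T] by simp
qed

section \<open>Unitarity and spanning from the category\<close>

lemma rotations_in_category:
  assumes C: "category_of_partitions C"
  shows "CPart [] [White, Black] {{Inr 0, Inr 1}} \<in> C" "CPart [] [Black, White] {{Inr 0, Inr 1}} \<in> C"
    "CPart [White, Black] [] {{Inl 0, Inl 1}} \<in> C" "CPart [Black, White] [] {{Inl 0, Inl 1}} \<in> C"
proof -
  have w: "white_identity \<in> C" and "upper white_identity \<noteq> []" "lower white_identity \<noteq> []"
    using C by (auto simp: category_of_partitions_def white_identity_def)
  then have r: "rotate_upper_left white_identity \<in> C" "rotate_upper_right white_identity \<in> C"
    "rotate_lower_left white_identity \<in> C" "rotate_lower_right white_identity \<in> C"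
    using C by (auto simp: category_of_partitions_def)
  show "CPart [] [White, Black] {{Inr 0, Inr 1}} \<in> C"
    using r(2) by (simp add: rotate_upper_right_def white_identity_def relabel_def insert_commute)
  show "CPart [] [Black, White] {{Inr 0, Inr 1}} \<in> C"
    using r(1) by (simp add: rotate_upper_left_def white_identity_def relabel_def insert_commute)
  show "CPart [White, Black] [] {{Inl 0, Inl 1}} \<in> C"
    using r(4) by (simp add: rotate_lower_right_def white_identity_def relabel_def insert_commute)
  show "CPart [Black, White] [] {{Inl 0, Inl 1}} \<in> C"
    using r(3) by (simp add: rotate_lower_left_def white_identity_def relabel_def insert_commute)
qed

lemma easy_hom:
  assumes "easy_for C N u" "p \<in> C"
  shows "part_map N p \<in> hom_space (word_rep u (upper p)) (word_rep u (lower p))"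
  using assms mat_span_superset[OF _ part_map_carrier] unfolding easy_for_def by auto

lemma easy_carrier:
  assumes "easy_for C N u"
  shows "u \<in> carrier_mat N N"
  using assms by (auto simp: easy_for_def fundamental_def fd_rep_def invertible_mat_def)

lemma ball_pair_eq: "(\<forall>B\<in>{{a, b}}. \<forall>x\<in>B. \<forall>y\<in>B. F x = F y) \<longleftrightarrow> F a = F b"
proof
  assume H: "\<forall>B\<in>{{a, b}}. \<forall>x\<in>B. \<forall>y\<in>B. F x = F y"
  show "F a = F b" by (rule H[rule_format, of "{a, b}" a b]) simp_all
next
  assume e: "F a = F b"
  show "\<forall>B\<in>{{a, b}}. \<forall>x\<in>B. \<forall>y\<in>B. F x = F y"
  proof (intro ballI)
    fix B x y assume "B \<in> {{a, b}}" "x \<in> B" "y \<in> B"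
    then have "x = a \<or> x = b" "y = a \<or> y = b" by blast+
    then show "F x = F y" using e by (elim disjE) simp_all
  qed
qed

lemma part_map_lower_pair:
  assumes "k < N" "l < N"
  shows "part_map N (CPart [] [c, d] {{Inr 0, Inr 1}}) $$ (encode N [k, l], 0) = of_bool (k = l)"
proof -
  have kl: "[k, l] \<in> idx N (Suc (Suc 0))" using assms by simp
  have "part_map N (CPart [] [c, d] {{Inr 0, Inr 1}}) $$ (x, 0) =
    of_bool (digit N (Suc (Suc 0)) x 0 = digit N (Suc (Suc 0)) x 1)" if "x < N ^ Suc (Suc 0)" for x
    using that unfolding part_map_def Let_def cpart.sel ball_pair_eq by (simp add: of_bool_def)
  note part_map = this[OF encode_less[OF kl]]
  have "digit N (Suc (Suc 0)) (encode N [k, l]) 0 = k" "digit N (Suc (Suc 0)) (encode N [k, l]) 1 = l"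
    using digit_encode[OF kl, of 0] digit_encode[OF kl, of 1] by simp_all
  with part_map show ?thesis by (simp only:)
qed

lemma part_map_upper_pair:
  assumes "k < N" "l < N"
  shows "part_map N (CPart [c, d] [] {{Inl 0, Inl 1}}) $$ (0, encode N [k, l]) = of_bool (k = l)"
proof -
  have kl: "[k, l] \<in> idx N (Suc (Suc 0))" using assms by simp
  have "part_map N (CPart [c, d] [] {{Inl 0, Inl 1}}) $$ (0, x) =
    of_bool (digit N (Suc (Suc 0)) x 0 = digit N (Suc (Suc 0)) x 1)" if "x < N ^ Suc (Suc 0)" for x
    using that unfolding part_map_def Let_def cpart.sel ball_pair_eq by (simp add: of_bool_def)
  note part_map = this[OF encode_less[OF kl]]
  have "digit N (Suc (Suc 0)) (encode N [k, l]) 0 = k" "digit N (Suc (Suc 0)) (encode N [k, l]) 1 = l"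
    using digit_encode[OF kl, of 0] digit_encode[OF kl, of 1] by simp_all
  with part_map show ?thesis by (simp only:)
qed

text \<open>Invariance of the pair vector, read at the coordinates \<open>i\<close>,
  \<open>j\<close>, is an orthogonality relation for rows; the upper pair gives the one for
  columns.\<close>

lemma easy_lower_pair:
  assumes e: "easy_for C N u" and p: "CPart [] [c, d] {{Inr 0, Inr 1}} \<in> C" and ij: "i < N" "j < N"
  shows "(\<Sum>k<N. letter_of u c i k * letter_of u d j k) = of_bool (i = j)"
proof -
  let ?p = "CPart [] [c, d] {{Inr 0, Inr 1}}"
  have "[i, j] \<in> idx N (length (lower ?p))" "[] \<in> idx N (length (upper ?p))" using ij by simp_all
  then have "(\<Sum>z\<in>idx N 0. part_map N ?p $$ (encode N [i, j], encode N z) *s wprod [] z [])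
    = (\<Sum>z\<in>idx N (Suc (Suc 0)). part_map N ?p $$ (encode N z, encode N []) *s wprod (map (letter_of u) [c, d]) [i, j] z)"
    using easy_hom[OF e p] unfolding hom_word_entries[OF easy_carrier[OF e]]
    by (simp only: cpart.sel list.map list.size add_0_right add_Suc_right)
  moreover have "\<dots> = (\<Sum>k<N. \<Sum>l<N. of_bool (k = l) *s (letter_of u c i k * letter_of u d j l))"
    unfolding sum_idx_2 encode.simps(1) by (intro sum.cong refl) (simp only: lessThan_iff part_map_lower_pair, simp)
  moreover have "\<dots> = (\<Sum>k<N. \<Sum>l<N. if l = k then letter_of u c i k * letter_of u d j l else 0)"
    by (intro sum.cong refl) auto
  ultimately have "part_map N ?p $$ (encode N [i, j], 0) *s 1 = (\<Sum>k<N. letter_of u c i k * letter_of u d j k)"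
    by (simp only: idx_0 sum.insert sum.empty finite.emptyI empty_iff not_False_eq_True add_0_right encode.simps(1) wprod.simps(1)) simp
  then show ?thesis unfolding part_map_lower_pair[OF ij] by (auto simp: of_bool_def)
qed

lemma easy_upper_pair:
  assumes e: "easy_for C N u" and p: "CPart [c, d] [] {{Inl 0, Inl 1}} \<in> C" and ij: "i < N" "j < N"
  shows "(\<Sum>k<N. letter_of u c k i * letter_of u d k j) = of_bool (i = j)"
proof -
  let ?p = "CPart [c, d] [] {{Inl 0, Inl 1}}"
  have "[i, j] \<in> idx N (length (upper ?p))" "[] \<in> idx N (length (lower ?p))" using ij by simp_all
  then have "(\<Sum>z\<in>idx N 0. part_map N ?p $$ (encode N z, encode N [i, j]) *s wprod [] [] z)
    = (\<Sum>z\<in>idx N (Suc (Suc 0)). part_map N ?p $$ (encode N [], encode N z) *s wprod (map (letter_of u) [c, d]) z [i, j])"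
    using easy_hom[OF e p] unfolding hom_word_entries[OF easy_carrier[OF e]]
    by (simp only: cpart.sel list.map list.size add_0_right add_Suc_right)
  moreover have "\<dots> = (\<Sum>k<N. \<Sum>l<N. of_bool (k = l) *s (letter_of u c k i * letter_of u d l j))"
    unfolding sum_idx_2 encode.simps(1) by (intro sum.cong refl) (simp only: lessThan_iff part_map_upper_pair, simp)
  moreover have "\<dots> = (\<Sum>k<N. \<Sum>l<N. if l = k then letter_of u c k i * letter_of u d l j else 0)"
    by (intro sum.cong refl) auto
  ultimately have "part_map N ?p $$ (0, encode N [i, j]) *s 1 = (\<Sum>k<N. letter_of u c k i * letter_of u d k j)"
    by (simp only: idx_0 sum.insert sum.empty finite.emptyI empty_iff not_False_eq_True add_0_right encode.simps(1) wprod.simps(1)) simp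
  then show ?thesis unfolding part_map_upper_pair[OF ij] by (auto simp: of_bool_def)
qed

text \<open>Two orders of the colours in either row: these are exactly the four relations of
  \<open>bi_unitary\<close>.\<close>

lemma easy_uni:
  assumes e: "easy_for C N u" and C: "category_of_partitions C"
  shows "bi_unitary {..<N} (entries u)"
  using easy_lower_pair[OF e rotations_in_category(1)[OF C]] easy_lower_pair[OF e rotations_in_category(2)[OF C]]
    easy_upper_pair[OF e rotations_in_category(3)[OF C]] easy_upper_pair[OF e rotations_in_category(4)[OF C]]
  by (simp add: bi_unitary_def coloured_entry_def)

text \<open>The starting point of the reduction: for words in \<open>u\<close> and its conjugate the
  spanning property is the defining condition of the easy quantum group.\<close>

lemma easy_spanned:
  assumes e: "easy_for C N u" and C: "category_of_partitions C" and nc: "\<forall>p\<in>C. noncrossing p"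
  shows "spanned TYPE((nat + nat) set) N (map (letter_of u) w)"
  unfolding spanned_def length_map
proof (intro allI impI)
  let ?k = "length w" and ?I = "idx N (length w)"
  fix T assume T: "endo ?I (wprod (map (letter_of u) w)) T"
  note u = easy_carrier[OF e]
  define dec where "dec x = map (digit N ?k x) [0..<?k]" for x
  have dec: "dec (encode N x) = x" if "x \<in> ?I" for x
    by (rule nth_equalityI) (use digit_encode[OF that] that in \<open>auto simp: dec_def idx_length\<close>)
  define M where "M = mat (N ^ ?k) (N ^ ?k) (\<lambda>(x, y). T (dec x) (dec y))"
  have M: "M $$ (encode N x, encode N y) = T x y" if "x \<in> ?I" "y \<in> ?I" for x y
    using encode_less[OF that(1)] encode_less[OF that(2)] dec that by (simp add: M_def)
  have "M \<in> hom_space (word_rep u w) (word_rep u w)"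
    unfolding hom_word_entries[OF u]
  proof (intro conjI ballI)
    show "M \<in> carrier_mat (N ^ ?k) (N ^ ?k)" by (simp add: M_def)
    fix x y assume xy: "x \<in> ?I" "y \<in> ?I"
    show "(\<Sum>z\<in>?I. M $$ (encode N x, encode N z) *s wprod (map (letter_of u) w) z y)
        = (\<Sum>z\<in>?I. M $$ (encode N z, encode N y) *s wprod (map (letter_of u) w) x z)"
      using endoD[OF T xy] M xy by simp
  qed
  then have "M \<in> mat_span (N ^ ?k) (N ^ ?k) (part_map N ` {p \<in> C. upper p = w \<and> lower p = w})"
    using e by (simp add: easy_for_def)
  then obtain F c where F: "finite F" "F \<subseteq> part_map N ` {p \<in> C. upper p = w \<and> lower p = w}"
    and MF: "M = mat (N ^ ?k) (N ^ ?k) (\<lambda>ij. \<Sum>A\<in>F. c A * A $$ ij)"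
    unfolding mat_span_def by blast
  \<comment> \<open>The span runs over matrices, and several partitions may have the same matrix, so
    one partition is chosen for each.\<close>
  define P where "P A = (SOME p. p \<in> C \<and> upper p = w \<and> lower p = w \<and> part_map N p = A)" for A
  have P: "P A \<in> C" "upper (P A) = w" "lower (P A) = w" "part_map N (P A) = A" if "A \<in> F" for A
  proof -
    have "\<exists>p. p \<in> C \<and> upper p = w \<and> lower p = w \<and> part_map N p = A" using F(2) that by blast
    then have "P A \<in> C \<and> upper (P A) = w \<and> lower (P A) = w \<and> part_map N (P A) = A"
      unfolding P_def by (rule someI_ex)
    then show "P A \<in> C" "upper (P A) = w" "lower (P A) = w" "part_map N (P A) = A" by auto
  qed
  define lab where "lab A = block_label ?k (P A)" for A
  have cp: "coloured_partition (P A)" "noncrossing (P A)" if "A \<in> F" for A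
    using P(1)[OF that] C nc by (auto simp: category_of_partitions_def)
  have A: "A $$ (encode N r, encode N s) = part_op (lab A) r s" if "A \<in> F" "r \<in> ?I" "s \<in> ?I" for A r s
    using part_map_encode[OF cp(1)[OF that(1)], of ?k r N s] P[OF that(1)] that by (simp add: lab_def)
  have endo_A: "endo ?I (wprod (map (letter_of u) w)) (part_op (lab A))" if "A \<in> F" for A
  proof -
    have "A \<in> hom_space (word_rep u w) (word_rep u w)" using easy_hom[OF e P(1)[OF that]] P[OF that] by simp
    then show ?thesis
      unfolding hom_word_entries[OF u] endo_def using A[OF that] by (auto simp: eq_commute)
  qed
  obtain As where As: "set As = F" "distinct As" using finite_distinct_list[OF F(1)] by blast
  show "\<exists>qs :: (complex \<times> (nat \<Rightarrow> (nat + nat) set)) list.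
        (\<forall>(\<kappa>, f)\<in>set qs. nc_labelling (2 * ?k) f \<and> endo ?I (wprod (map (letter_of u) w)) (part_op f)) \<and>
        (\<forall>r\<in>?I. \<forall>c\<in>?I. T r c = (\<Sum>(\<kappa>, f)\<leftarrow>qs. \<kappa> * part_op f r c))"
  proof (intro exI[of _ "map (\<lambda>A. (c A, lab A)) As"] conjI ballI)
    fix q assume "q \<in> set (map (\<lambda>A. (c A, lab A)) As)"
    then obtain A where "A \<in> F" "q = (c A, lab A)" using As by auto
    then show "case q of (\<kappa>, f) \<Rightarrow> nc_labelling (2 * ?k) f \<and> endo ?I (wprod (map (letter_of u) w)) (part_op f)"
      using endo_A nc_block_label[OF cp(1) _ _ cp(2)] P by (auto simp: lab_def)
  next
    fix r s assume rs: "r \<in> ?I" "s \<in> ?I"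
    have "T r s = M $$ (encode N r, encode N s)" using M rs by simp
    also have "\<dots> = (\<Sum>A\<in>F. c A * part_op (lab A) r s)"
      unfolding MF using encode_less[OF rs(1)] encode_less[OF rs(2)] A rs by simp
    also have "\<dots> = (\<Sum>(\<kappa>, f)\<leftarrow>map (\<lambda>A. (c A, lab A)) As. \<kappa> * part_op f r s)"
      using As(1) sum.distinct_set_conv_list[OF As(2), of "\<lambda>A. c A * part_op (lab A) r s"]
      by (simp add: comp_def)
    finally show "T r s = (\<Sum>(\<kappa>, f)\<leftarrow>map (\<lambda>A. (c A, lab A)) As. \<kappa> * part_op f r s)" .
  qed
qed

text \<open>A block-diagonal matrix acts on each block separately, so a block on which
  \<open>\<tau>\<close> does not vanish inherits the equation.\<close>

lemma diag_block_component:
  fixes As :: "'a mat list" and \<tau> :: "nat \<Rightarrow> complex"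
  assumes "\<And>A. A \<in> set As \<Longrightarrow> dim_col A = dim_row A"
    and "\<And>x. x < dim_row (diag_block_mat As) \<Longrightarrow>
      (\<Sum>z<dim_row (diag_block_mat As). \<tau> z *s diag_block_mat As $$ (x, z)) = \<tau> x *s g"
    and "x0 < dim_row (diag_block_mat As)" "\<tau> x0 \<noteq> 0"
  shows "\<exists>A\<in>set As. \<exists>\<sigma>. (\<forall>x<dim_row A. (\<Sum>z<dim_row A. \<sigma> z *s A $$ (x, z)) = \<sigma> x *s g) \<and> (\<exists>x<dim_row A. \<sigma> x \<noteq> 0)"
  using assms
proof (induction As arbitrary: \<tau> x0)
  case (Cons A As)
  let ?D = "diag_block_mat As" and ?E = "diag_block_mat (A # As)"
  have sqA: "dim_col A = dim_row A" using Cons.prems(1) by simp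
  have sqD: "dim_col ?D = dim_row ?D"
    using diag_block_mat_square[of As] Cons.prems(1) by simp
  have E: "?E = four_block_mat A (0\<^sub>m (dim_row A) (dim_col ?D)) (0\<^sub>m (dim_row ?D) (dim_col A)) ?D"
    by (simp add: Let_def)
  have dE: "dim_row ?E = dim_row A + dim_row ?D" unfolding E by simp
  have split: "(\<Sum>z<a + b. F z) = (\<Sum>z<a. F z) + (\<Sum>z<b. F (a + z))" for F :: "nat \<Rightarrow> 'a" and a b :: nat
    by (induction b) (simp_all add: add.assoc)
  show ?case
  proof (cases "\<exists>x<dim_row A. \<tau> x \<noteq> 0")
    case True
    have "(\<Sum>z<dim_row A. \<tau> z *s A $$ (x, z)) = \<tau> x *s g" if x: "x < dim_row A" for x
    proof -
      have "(\<Sum>z<dim_row ?E. \<tau> z *s ?E $$ (x, z)) = (\<Sum>z<dim_row A. \<tau> z *s A $$ (x, z))"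
        unfolding dE split unfolding E using x sqA sqD by simp
      then show ?thesis using Cons.prems(2)[of x] x dE by simp
    qed
    then show ?thesis using True by auto
  next
    case False
    define \<sigma> where "\<sigma> z = \<tau> (dim_row A + z)" for z
    have "(\<Sum>z<dim_row ?D. \<sigma> z *s ?D $$ (x, z)) = \<sigma> x *s g" if x: "x < dim_row ?D" for x
    proof -
      have "(\<Sum>z<dim_row ?E. \<tau> z *s ?E $$ (dim_row A + x, z)) = (\<Sum>z<dim_row ?D. \<sigma> z *s ?D $$ (x, z))"
        unfolding dE split \<sigma>_def unfolding E using x sqA sqD by simp
      then show ?thesis using Cons.prems(2)[of "dim_row A + x"] x dE by (simp add: \<sigma>_def)
    qed
    moreover have "x0 - dim_row A < dim_row ?D" "\<sigma> (x0 - dim_row A) \<noteq> 0"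
    proof -
      have "dim_row A \<le> x0" using False Cons.prems(4) by (meson not_less)
      then show "x0 - dim_row A < dim_row ?D" "\<sigma> (x0 - dim_row A) \<noteq> 0"
        using Cons.prems(3,4) unfolding dE \<sigma>_def by auto
    qed
    ultimately have "\<exists>A\<in>set As. \<exists>\<sigma>. (\<forall>x<dim_row A. (\<Sum>z<dim_row A. \<sigma> z *s A $$ (x, z)) = \<sigma> x *s g) \<and> (\<exists>x<dim_row A. \<sigma> x \<noteq> 0)"
      using Cons.prems(1) by (intro Cons.IH[of \<sigma>]) auto
    then show ?thesis by auto
  qed
qed simp

section \<open>Group-like elements and their group\<close>

definition singleton_mat :: "'a \<Rightarrow> 'a mat" where
  "singleton_mat g = mat 1 1 (\<lambda>_. g)"

definition grouplike :: "'a set" where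
  "grouplike = {g. fd_rep (singleton_mat g)}"

lemma one_dim_reps_eq: "one_dim_reps = singleton_mat ` grouplike"
proof -
  have "v = singleton_mat (v $$ (0, 0))" if "fd_rep v" "dim_row v = 1" for v
    using that by (intro eq_matI) (auto simp: singleton_mat_def fd_rep_def invertible_mat_def)
  then show ?thesis unfolding one_dim_reps_def grouplike_def
    by (force simp: singleton_mat_def)
qed

lemma singleton_mat_inject [simp]: "singleton_mat g = singleton_mat h \<longleftrightarrow> g = h"
proof
  assume "singleton_mat g = singleton_mat h"
  then have "singleton_mat g $$ (0, 0) = singleton_mat h $$ (0, 0)" by simp
  then show "g = h" by (simp add: singleton_mat_def)
qed simp

lemma singleton_mat_mult: "singleton_mat g * singleton_mat h = singleton_mat (g * h)"
  by (intro eq_matI) (auto simp: singleton_mat_def scalar_prod_def)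

lemma one_singleton_mat: "1\<^sub>m (Suc 0) = singleton_mat 1"
  by (intro eq_matI) (auto simp: singleton_mat_def)

lemma dim_singleton_mat [simp]: "dim_row (singleton_mat g) = Suc 0" "dim_col (singleton_mat g) = Suc 0"
  by (simp_all add: singleton_mat_def)

lemma grouplike_iff:
  "g \<in> grouplike \<longleftrightarrow> (\<exists>h. g * h = 1 \<and> h * g = 1) \<and> comult g = tensor2 [(g, g)]"
proof -
  have "invertible_mat (singleton_mat g) \<longleftrightarrow> (\<exists>h. g * h = 1 \<and> h * g = 1)"
  proof
    assume "invertible_mat (singleton_mat g)"
    then obtain B where B: "singleton_mat g * B = 1\<^sub>m (dim_row (singleton_mat g))" "B * singleton_mat g = 1\<^sub>m (dim_row B)"
      by (auto simp: invertible_mat_def inverts_mat_def)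
    \<comment> \<open>The inverse is not known to be square; the shapes of the two products force it
      to be of size one.\<close>
    have "dim_row B = 1" "dim_col B = 1"
      using arg_cong[OF B(1), of dim_col] arg_cong[OF B(2), of dim_col] by (auto simp: singleton_mat_def)
    then have "B = singleton_mat (B $$ (0, 0))"
      by (intro eq_matI) (auto simp: singleton_mat_def)
    then obtain b where "B = singleton_mat b" by blast
    then have "singleton_mat (g * b) = singleton_mat 1" "singleton_mat (b * g) = singleton_mat 1"
      using B by (simp_all only: singleton_mat_mult dim_singleton_mat one_singleton_mat)
    then show "\<exists>h. g * h = 1 \<and> h * g = 1" by auto
  next
    assume "\<exists>h. g * h = 1 \<and> h * g = 1"
    then obtain h where h: "g * h = 1" "h * g = 1" by blast
    have "singleton_mat g * singleton_mat h = 1\<^sub>m 1" "singleton_mat h * singleton_mat g = 1\<^sub>m 1"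
      using h by (simp_all add: singleton_mat_mult one_singleton_mat)
    then show "invertible_mat (singleton_mat g)"
      by (auto simp: invertible_mat_def inverts_mat_def singleton_mat_def)
  qed
  then show ?thesis by (simp add: grouplike_def fd_rep_def) (simp add: singleton_mat_def)
qed

lemma grouplike_one: "1 \<in> grouplike"
  using comult_one by (auto simp: grouplike_iff intro: exI[of _ 1])

lemma grouplike_mult:
  assumes "g \<in> grouplike" "h \<in> grouplike"
  shows "g * h \<in> grouplike"
proof -
  obtain g' h' where inv: "g * g' = 1" "g' * g = 1" "h * h' = 1" "h' * h = 1"
    and c: "comult g = tensor2 [(g, g)]" "comult h = tensor2 [(h, h)]"
    using assms by (auto simp: grouplike_iff)
  have "g * h * (h' * g') = g * (h * h') * g'" "h' * g' * (g * h) = h' * (g' * g) * h"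
    by (simp_all only: mult.assoc)
  then have "g * h * (h' * g') = 1" "h' * g' * (g * h) = 1" using inv by simp_all
  moreover have "comult (g * h) = tensor2 [(g * h, g * h)]" using comult_mult[OF c] by simp
  ultimately show ?thesis by (auto simp: grouplike_iff)
qed

lemma linear_left_mult:
  assumes "Vector_Spaces.linear scale (*) f"
  shows "Vector_Spaces.linear scale (*) (\<lambda>x. f (h * x))"
  using assms by (simp add: Vector_Spaces.linear_iff distrib_left scale_mult_right)

text \<open>\<open>\<Delta>(h) = (h \<otimes> h)(g \<otimes> g)\<Delta>(h) = (h \<otimes> h)\<Delta>(gh)\<close>, evaluated on bilinear forms.\<close>

lemma grouplike_inverse:
  assumes g: "g \<in> grouplike" and h: "g * h = 1" "h * g = 1"
  shows "h \<in> grouplike"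
proof -
  have c: "comult g = tensor2 [(g, g)]" using g by (simp add: grouplike_iff)
  obtain xs where xs: "comult h = tensor2 xs" using comult_tensor by blast
  have "tensor2 [(1, 1)] = comult (g * h)" using h comult_one by simp
  also have "\<dots> = tensor2 [(g * x, g * y). (x, y) \<leftarrow> xs]" using comult_mult[OF c xs] by simp
  finally have e: "tensor2 [(1, 1)] = tensor2 [(g * x, g * y). (x, y) \<leftarrow> xs]" .
  have "tensor2 xs = tensor2 [(h, h)]"
  proof
    fix f
    show "tensor2 xs f = tensor2 [(h, h)] f"
    proof (cases "bilinear_form f")
      case True
      have a: "h * (g * x) = x" for x using h by (simp add: mult.assoc[symmetric])
      have "bilinear_form (\<lambda>x y. f (h * x) (h * y))"
        using True linear_left_mult unfolding bilinear_form_def by blast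
      then show ?thesis
        using fun_cong[OF e, of "\<lambda>x y. f (h * x) (h * y)"] True
        by (simp add: tensor2_def comp_def case_prod_unfold a)
    next
      case False
      then show ?thesis by (simp add: tensor2_def)
    qed
  qed
  then show ?thesis using xs h by (auto simp: grouplike_iff)
qed

text \<open>Scalars commute with the algebra, so an invertible intertwiner of size one forces
  equality, and equivalence classes are single elements.\<close>

lemma one_dim_equiv_eq: "one_dim_equiv = Id_on one_dim_reps"
proof -
  have "g = h" if "equivalent (singleton_mat g) (singleton_mat h)" for g h
  proof -
    from that obtain T where T: "T \<in> hom_space (singleton_mat g) (singleton_mat h)" "invertible_mat T"
      by (auto simp: equivalent_def)
    have c: "singleton_mat g \<in> carrier_mat 1 1" "singleton_mat h \<in> carrier_mat 1 1" by (auto simp: singleton_mat_def)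
    have Tc: "T \<in> carrier_mat 1 1" and e: "T $$ (0, 0) *s g = T $$ (0, 0) *s h"
      using T(1) unfolding hom_space_entries[OF c] by (auto simp: singleton_mat_def)
    obtain B where B: "T * B = 1\<^sub>m 1" "B * T = 1\<^sub>m (dim_row B)"
      using T(2) Tc by (auto simp: invertible_mat_def inverts_mat_def)
    have "dim_row B = 1" "dim_col B = 1"
      using arg_cong[OF B(1), of dim_col] arg_cong[OF B(2), of dim_col] Tc by auto
    then have "T $$ (0, 0) * B $$ (0, 0) = 1"
      using arg_cong[OF B(1), of "\<lambda>M. M $$ (0, 0)"] Tc by (simp add: scalar_prod_def)
    then have "T $$ (0, 0) \<noteq> 0" by auto
    then show ?thesis using e by simp
  qed
  moreover have "equivalent (singleton_mat g) (singleton_mat g)" for g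
  proof -
    have c: "singleton_mat g \<in> carrier_mat 1 1" by (auto simp: singleton_mat_def)
    have "1\<^sub>m 1 \<in> hom_space (singleton_mat g) (singleton_mat g)"
      unfolding hom_space_entries[OF c c] by (auto simp: singleton_mat_def)
    moreover have "invertible_mat (1\<^sub>m 1 :: complex mat)"
      unfolding invertible_mat_def by (auto intro: exI[of _ "1\<^sub>m 1"] simp: inverts_mat_def)
    ultimately show ?thesis by (auto simp: equivalent_def)
  qed
  ultimately show ?thesis unfolding one_dim_equiv_def one_dim_reps_eq by auto
qed

lemma one_dim_group_simps:
  "carrier one_dim_group = (\<lambda>g. {singleton_mat g}) ` grouplike"
  "monoid.one one_dim_group = {singleton_mat 1}"
  "g \<in> grouplike \<Longrightarrow> h \<in> grouplike \<Longrightarrow> {singleton_mat g} \<otimes>\<^bsub>one_dim_group\<^esub> {singleton_mat h} = {singleton_mat (g * h)}"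
proof -
  have im: "one_dim_equiv `` {singleton_mat g} = {singleton_mat g}" if "g \<in> grouplike" for g
    using that by (auto simp: one_dim_equiv_eq one_dim_reps_eq)
  show "carrier one_dim_group = (\<lambda>g. {singleton_mat g}) ` grouplike"
    using im by (auto simp: one_dim_group_def quotient_def one_dim_reps_eq)
  show "monoid.one one_dim_group = {singleton_mat 1}"
    using im[OF grouplike_one] by (simp add: one_dim_group_def one_singleton_mat)
  have "kron (singleton_mat g) (singleton_mat h) = singleton_mat (g * h)"
    by (intro eq_matI) (auto simp: kron_def singleton_mat_def)
  then show "{singleton_mat g} \<otimes>\<^bsub>one_dim_group\<^esub> {singleton_mat h} = {singleton_mat (g * h)}"
    if "g \<in> grouplike" "h \<in> grouplike"
    using im[OF grouplike_mult[OF that]] by (simp add: one_dim_group_def)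
qed

lemma group_one_dim_group: "group one_dim_group"
proof (rule groupI)
  show "\<And>x y. x \<in> carrier one_dim_group \<Longrightarrow> y \<in> carrier one_dim_group \<Longrightarrow> x \<otimes>\<^bsub>one_dim_group\<^esub> y \<in> carrier one_dim_group"
    using grouplike_mult by (auto simp: one_dim_group_simps)
  show "\<one>\<^bsub>one_dim_group\<^esub> \<in> carrier one_dim_group"
    using grouplike_one by (auto simp: one_dim_group_simps)
  show "\<And>x y z. x \<in> carrier one_dim_group \<Longrightarrow> y \<in> carrier one_dim_group \<Longrightarrow> z \<in> carrier one_dim_group \<Longrightarrow>
      x \<otimes>\<^bsub>one_dim_group\<^esub> y \<otimes>\<^bsub>one_dim_group\<^esub> z = x \<otimes>\<^bsub>one_dim_group\<^esub> (y \<otimes>\<^bsub>one_dim_group\<^esub> z)"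
    using grouplike_mult by (auto simp: one_dim_group_simps mult.assoc)
  show "\<And>x. x \<in> carrier one_dim_group \<Longrightarrow> \<one>\<^bsub>one_dim_group\<^esub> \<otimes>\<^bsub>one_dim_group\<^esub> x = x"
    using grouplike_one by (auto simp: one_dim_group_simps)
  fix x assume "x \<in> carrier one_dim_group"
  then obtain g where g: "g \<in> grouplike" "x = {singleton_mat g}" by (auto simp: one_dim_group_simps)
  then obtain h where h: "g * h = 1" "h * g = 1" by (auto simp: grouplike_iff)
  have "h \<in> grouplike" by (rule grouplike_inverse[OF g(1) h])
  then show "\<exists>y\<in>carrier one_dim_group. y \<otimes>\<^bsub>one_dim_group\<^esub> x = \<one>\<^bsub>one_dim_group\<^esub>"
    using g h by (auto simp: one_dim_group_simps intro!: bexI[of _ h])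
qed

text \<open>\<open>\<gamma>\<close> is not assumed to be group-like, so the exponents of its
  group-like powers are studied. They form a subgroup of the integers and hence are the multiples of
  some \<open>d\<close>, by division with remainder.\<close>

lemma cyclic_one_dim_group:
  assumes u: "star \<gamma> * \<gamma> = 1" "\<gamma> * star \<gamma> = 1" and sub: "grouplike \<subseteq> range (zpow \<gamma>)"
  shows "cyclic_group one_dim_group"
proof -
  interpret G: group one_dim_group by (rule group_one_dim_group)
  define S where "S = {n. zpow \<gamma> n \<in> grouplike}"
  have S_neg: "- n \<in> S" if "n \<in> S" for n
    using that zpow_add[OF u, of n "- n"] zpow_add[OF u, of "- n" n] grouplike_inverse[of "zpow \<gamma> n" "zpow \<gamma> (- n)"]
    by (simp add: S_def)
  have S_add: "m + n \<in> S" if "m \<in> S" "n \<in> S" for m n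
    using that grouplike_mult zpow_add[OF u] by (simp add: S_def)
  \<comment> \<open>The value \<open>0\<close> covers the case without positive exponents, in which
    only the exponent zero occurs.\<close>
  define d where "d = (if \<exists>n::nat. n > 0 \<and> int n \<in> S then int (LEAST n. n > 0 \<and> int n \<in> S) else 0)"
  have S0: "0 \<in> S" using grouplike_one by (simp add: S_def)
  have dS: "d \<in> S" using S0 LeastI_ex[of "\<lambda>n. n > 0 \<and> int n \<in> S"] by (auto simp: d_def)
  have d_mult: "d * q \<in> S" for q
  proof (induction q rule: int_induct[of _ 0])
    case (step1 i)
    then show ?case using S_add[OF _ dS] by (simp add: distrib_left)
  next
    case (step2 i)
    then show ?case using S_add[OF _ S_neg[OF dS], of "d * i"] by (simp add: algebra_simps)
  qed (use S0 in simp)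
  have S_d: "\<exists>q. n = d * q" if n: "n \<in> S" for n
  proof (cases "\<exists>n::nat. n > 0 \<and> int n \<in> S")
    case True
    define k where "k = (LEAST n. n > 0 \<and> int n \<in> S)"
    have k: "k > 0" "int k \<in> S" and least: "\<And>m. m > 0 \<Longrightarrow> int m \<in> S \<Longrightarrow> k \<le> m"
      using LeastI_ex[OF True] unfolding k_def by (auto intro: Least_le)
    have dk: "d = int k" using True by (simp add: d_def k_def)
    have "n mod d = n + d * (- (n div d))" by (simp add: minus_mult_div_eq_mod[symmetric])
    then have m: "n mod d \<in> S" using S_add[OF n d_mult[of "- (n div d)"]] by (simp only:)
    have "0 \<le> n mod d" "n mod d < d" using k dk by auto
    then have "n mod d = 0"
      using least[of "nat (n mod d)"] m dk by (cases "n mod d = 0") auto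
    then show ?thesis by (auto simp: mod_eq_0_iff_dvd dvd_def)
  next
    case False
    have "n = 0"
    proof (rule ccontr)
      assume "n \<noteq> 0"
      moreover have "int (nat \<bar>n\<bar>) \<in> S" using n S_neg by (cases "n \<ge> 0") auto
      ultimately show False using False by (metis zero_less_nat_eq zero_less_abs_iff)
    qed
    then show ?thesis by simp
  qed
  define x where "x = {singleton_mat (zpow \<gamma> d)}"
  have xG: "x \<in> carrier one_dim_group" using dS by (auto simp: x_def S_def one_dim_group_simps)
  have pw: "x [^]\<^bsub>one_dim_group\<^esub> q = {singleton_mat (zpow \<gamma> (d * q))}" for q :: int
  proof -
    \<comment> \<open>Stated as an equivalence so that it serves the induction in both
      directions.\<close>
    have step: "x [^]\<^bsub>one_dim_group\<^esub> (i + 1) = {singleton_mat (zpow \<gamma> (d * (i + 1)))} \<longleftrightarrow>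
      x [^]\<^bsub>one_dim_group\<^esub> i = {singleton_mat (zpow \<gamma> (d * i))}" for i :: int
    proof -
      have 1: "x [^]\<^bsub>one_dim_group\<^esub> (i + 1) = x [^]\<^bsub>one_dim_group\<^esub> i \<otimes>\<^bsub>one_dim_group\<^esub> x"
        using G.int_pow_mult[OF xG, of i 1] xG by simp
      have 2: "{singleton_mat (zpow \<gamma> (d * (i + 1)))} = {singleton_mat (zpow \<gamma> (d * i))} \<otimes>\<^bsub>one_dim_group\<^esub> x"
        using d_mult[of i] dS zpow_add[OF u, of "d * i" d]
        by (simp add: x_def one_dim_group_simps S_def distrib_left)
      have 3: "{singleton_mat (zpow \<gamma> (d * i))} \<in> carrier one_dim_group"
        using d_mult[of i] by (auto simp: one_dim_group_simps S_def)
      show ?thesis unfolding 1 2 using xG 3 by (intro G.right_cancel) auto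
    qed
    show ?thesis
    proof (induction q rule: int_induct[of _ 0])
      case (step2 i)
      then show ?case using step[of "i - 1"] by simp
    qed (use step in \<open>simp_all add: one_dim_group_simps\<close>)
  qed
  have "carrier one_dim_group = range (\<lambda>n::int. x [^]\<^bsub>one_dim_group\<^esub> n)"
  proof
    show "range (\<lambda>n::int. x [^]\<^bsub>one_dim_group\<^esub> n) \<subseteq> carrier one_dim_group" using xG by auto
    show "carrier one_dim_group \<subseteq> range (\<lambda>n::int. x [^]\<^bsub>one_dim_group\<^esub> n)"
    proof
      fix y assume "y \<in> carrier one_dim_group"
      then obtain g where g: "g \<in> grouplike" "y = {singleton_mat g}" by (auto simp: one_dim_group_simps)
      then obtain n where n: "g = zpow \<gamma> n" using sub by blast
      then have "n \<in> S" using g by (simp add: S_def)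
      then obtain q where "n = d * q" using S_d by blast
      then have "y = x [^]\<^bsub>one_dim_group\<^esub> q" using g n pw by simp
      then show "y \<in> range (\<lambda>n::int. x [^]\<^bsub>one_dim_group\<^esub> n)" by blast
    qed
  qed
  then show ?thesis using G.cyclic_group xG by blast
qed

text \<open>The embedding \<open>T\<close> of a one-dimensional representation is a single column,
  nonzero by injectivity. It spans an invariant line in a direct sum of words, and a summand where
  it does not vanish yields \<open>\<zeta>\<close>.\<close>

lemma grouplike_in_word:
  assumes e: "easy_for C N u" and g: "g \<in> grouplike"
  obtains w \<zeta> i where "i \<in> idx N (length w)" "\<zeta> i \<noteq> 0" "semi_inv (idx N (length w)) (wprod (map (letter_of u) w)) \<zeta> g"
proof -
  note u = easy_carrier[OF e]
  let ?v = "singleton_mat g"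
  have vc: "?v \<in> carrier_mat 1 1" by (simp add: singleton_mat_def)
  obtain ws where "contained_in ?v (diag_block_mat (map (word_rep u) ws))"
    using e g by (auto simp: easy_for_def fundamental_def grouplike_def)
  moreover define D where "D = diag_block_mat (map (word_rep u) ws)"
  ultimately obtain T where T: "T \<in> hom_space ?v D"
    and inj: "\<And>x. x \<in> carrier_vec (dim_row ?v) \<Longrightarrow> T *\<^sub>v x = 0\<^sub>v (dim_row D) \<Longrightarrow> x = 0\<^sub>v (dim_row ?v)"
    by (auto simp: contained_in_def)
  have sq: "dim_col A = dim_row A" if "A \<in> set (map (word_rep u) ws)" for A
    using that carrier_matD[OF word_rep_carrier[OF u]] by auto
  have Dc: "D \<in> carrier_mat (dim_row D) (dim_row D)"
    using diag_block_mat_square[of "map (word_rep u) ws"] sq by (auto simp: D_def)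
  define \<tau> where "\<tau> x = T $$ (x, 0)" for x
  have Tc: "T \<in> carrier_mat (dim_row D) 1"
    and TD: "\<And>x. x < dim_row D \<Longrightarrow> (\<Sum>z<dim_row D. \<tau> z *s D $$ (x, z)) = \<tau> x *s g"
    using T unfolding hom_space_entries[OF vc Dc] by (auto simp: \<tau>_def singleton_mat_def)
  have "\<exists>x0<dim_row D. \<tau> x0 \<noteq> 0"
  proof (rule ccontr)
    assume "\<not> ?thesis"
    then have z: "T $$ (x, 0) = 0" if "x < dim_row D" for x using that by (auto simp: \<tau>_def)
    have "T *\<^sub>v vec 1 (\<lambda>_. 1) = 0\<^sub>v (dim_row D)"
      using Tc z by (intro eq_vecI) (auto simp: scalar_prod_def)
    then have "vec 1 (\<lambda>_. 1) = (0\<^sub>v (dim_row ?v) :: complex vec)" using vc by (intro inj) auto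
    then have "vec 1 (\<lambda>_. 1) $ 0 = (0\<^sub>v 1 :: complex vec) $ 0" using vc by simp
    then show False by simp
  qed
  then obtain x0 where x0: "x0 < dim_row D" "\<tau> x0 \<noteq> 0" by blast
  have "\<exists>A\<in>set (map (word_rep u) ws). \<exists>\<sigma>. (\<forall>x<dim_row A. (\<Sum>z<dim_row A. \<sigma> z *s A $$ (x, z)) = \<sigma> x *s g) \<and> (\<exists>x<dim_row A. \<sigma> x \<noteq> 0)"
    by (rule diag_block_component[of _ \<tau> g x0]) (use sq TD x0 in \<open>auto simp: D_def\<close>)
  then obtain w \<sigma> x where w: "\<And>x. x < dim_row (word_rep u w) \<Longrightarrow> (\<Sum>z<dim_row (word_rep u w). \<sigma> z *s word_rep u w $$ (x, z)) = \<sigma> x *s g"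
    and x: "x < dim_row (word_rep u w)" "\<sigma> x \<noteq> 0"
    by auto
  have d: "dim_row (word_rep u w) = N ^ length w" using word_rep_carrier[OF u, of w] by auto
  obtain i where i: "i \<in> idx N (length w)" "encode N i = x" using encode_surj x d by metis
  show thesis
  proof (rule that[of i w "\<lambda>i. \<sigma> (encode N i)"])
    show "i \<in> idx N (length w)" "\<sigma> (encode N i) \<noteq> 0" using i x by auto
    show "semi_inv (idx N (length w)) (wprod (map (letter_of u) w)) (\<lambda>i. \<sigma> (encode N i)) g"
      unfolding semi_inv_def
    proof
      fix y assume y: "y \<in> idx N (length w)"
      show "(\<Sum>j\<in>idx N (length w). \<sigma> (encode N j) *s wprod (map (letter_of u) w) y j) = \<sigma> (encode N y) *s g"
        using w[of "encode N y"] encode_less[OF y] word_rep_encode[OF u y] unfolding d sum_encode by simp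
    qed
  qed
qed

theorem easy_one_dim_group_cyclic:
  assumes N: "N \<ge> 4" and C: "category_of_partitions C" and nc: "\<forall>p\<in>C. noncrossing p"
    and e: "easy_for C N u"
  shows "cyclic_group one_dim_group"
proof -
  interpret biunitary_matrix scale star N "entries u"
    by unfold_locales (use easy_uni[OF e C] N in auto)
  have "spanned TYPE((nat + nat) set) N (map colour_letter w)" for w
    by (rule easy_spanned[OF e C nc])
  then obtain \<gamma> where \<gamma>: "star \<gamma> * \<gamma> = 1" "\<gamma> * star \<gamma> = 1"
    and r: "\<And>w \<zeta> g i. i \<in> idx N (length w) \<Longrightarrow> \<zeta> i \<noteq> 0 \<Longrightarrow> semi_inv (idx N (length w)) (word w) \<zeta> g \<Longrightarrow> g \<in> range (zpow \<gamma>)"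
    by (rule semi_inv_word_cyclic) blast
  have "grouplike \<subseteq> range (zpow \<gamma>)"
  proof
    fix g assume "g \<in> grouplike"
    from grouplike_in_word[OF e this] show "g \<in> range (zpow \<gamma>)"
      using r by metis
  qed
  then show ?thesis by (rule cyclic_one_dim_group[OF \<gamma>])
qed

end

theorem proposition5p4:
  fixes N :: nat and C :: "cpart set"
    and scale :: "complex \<Rightarrow> 'a::ring_1 \<Rightarrow> 'a" and star :: "'a \<Rightarrow> 'a"
    and comult :: "'a \<Rightarrow> ('a \<Rightarrow> 'a \<Rightarrow> complex) \<Rightarrow> complex"
    and counit :: "'a \<Rightarrow> complex" and antipode :: "'a \<Rightarrow> 'a"
    and u :: "'a mat"
  assumes "N \<ge> 4"
    and "category_of_partitions C" and "\<forall>p\<in>C. noncrossing p"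
    and "compact_quantum_group scale star comult counit antipode"
    and "hopf_star_algebra.easy_for scale star comult C N u"
  shows "let G = hopf_star_algebra.one_dim_group scale comult
         in group G \<and> cyclic_group G \<and> comm_group G"
proof -
  interpret compact_quantum_group scale star comult counit antipode by fact
  have c: "cyclic_group one_dim_group"
    by (rule easy_one_dim_group_cyclic[OF assms(1-3,5)])
  then show ?thesis
    using group_one_dim_group group.cyclic_imp_abelian_group by (auto simp: Let_def)
qed

end
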